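(* Let $\mathbb{H}$ be a complex Hilbert space, let $A$ be a sectorial operator of type $\omega\in(0,\pi)$ on $\mathbb{H}$, and suppose that $A$ is one-one. Let $\theta\in(\omega,\pi)$ and $0<\alpha,\beta<\frac{\theta-\omega}{2}$, and let $F$ and $G$ be two nonzero functions in $H^\infty_0(\Sigma_\theta)$. Then: (i) There is a constant $K>0$ such that for any $f\in H^\infty(\Sigma_\theta)$, $$\left(\int_{\Sigma_\alpha}\|f(A)F(zA)x\|^2\,\frac{dm(z)}{|z|^2}\right)^{1/2}\le K\,\|f\|_{\infty,\theta}\,\|x\|_{G,\beta},\qquad \forall x\in\mathbb{H}.$$ (ii) There is a constant $C>0$ such that $$C^{-1}\|x\|_{G,\beta}\le\|x\|_{F,\alpha}\le C\|x\|_{G,\beta},\qquad\forall x\in\mathbb{H}.$$ (Both sides of these inequalities are allowed to take the value $+\infty$.)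
   Context: Sectors: for $\omega\in(0,\pi)$, $\Sigma_\omega=\{z\in\mathbb{C}\setminus\{0\}: |\mathrm{Arg}(z)|<\omega\}$. Sectorial operators: a closed densely defined operator $A$ on $\mathbb{H}$ is sectorial of type $\omega\in(0,\pi)$ if its spectrum satisfies $\sigma(A)\subset\overline{\Sigma}_\omega$ and for every $\theta'\in(\omega,\pi)$ there is a constant $K_{\theta'}>0$ with $\|zR(z,A)\|\le K_{\theta'}$ for all $z\in\mathbb{C}\setminus\overline{\Sigma}_{\theta'}$, where $R(z,A)=(z-A)^{-1}$. Function spaces: for $\theta\in(0,\pi)$, $H^\infty(\Sigma_\theta)$ is the algebra of bounded analytic functions $f:\Sigma_\theta\to\mathbb{C}$ with norm $\|f\|_{\infty,\theta}=\sup_{z\in\Sigma_\theta}|f(z)|$. $H^\infty_0(\Sigma_\theta)$ is the subalgebra of those $f$ for which there exist $s,c>0$ with $|f(z)|\le c\,|z|^s/(1+|z|)^{2s}$ for all $z\in\Sigma_\theta$. Functional calculus: if $A$ is sectorial of type $\omega$, $\theta\in(\omega,\pi)$ and $f\in H^\infty_0(\Sigma_\theta)$, then $f(A)=\frac{1}{2\pi i}\int_{\Gamma_\gamma}f(z)R(z,A)\,dz$, a bounded operator on $\mathbb{H}$, where $\gamma\in(\omega,\theta)$ and $\Gamma_\gamma$ is the boundary of $\Sigma_\gamma$ oriented counterclockwise ($\Gamma_\gamma(t)=-te^{i\gamma}$ for $t\le 0$ and $te^{-i\gamma}$ for $t\ge0$); this is independent of $\gamma$. If $A$ is one-one on a Hilbert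 space, it has dense range, and with $\varphi(z)=z(1+z)^{-2}$ the operator $\varphi(A)=A(1+A)^{-2}$ is one-one. For $f\in H^\infty(\Sigma_\theta)$ one then defines the closed, densely defined (possibly unbounded) operator $f(A)=\varphi(A)^{-1}(f\varphi)(A)$ with domain $\{x: (f\varphi)(A)x\in \mathrm{D}(A)\cap\mathrm{R}(A)\}$, where $\mathrm{D}(A)$ and $\mathrm{R}(A)$ are the domain and range of $A$. Area integral functions: for $F\in H^\infty_0(\Sigma_\theta)$, $0<\alpha<\frac{\theta-\omega}{2}$ and $z\in\Sigma_\alpha$, let $F_z(w)=F(zw)$ for $w\in\Sigma_{\theta-\alpha}$; then $F_z\in H^\infty_0(\Sigma_{\theta-\alpha})$ with $\theta-\alpha>\omega$, and $F(zA)$ means $F_z(A)$. The product $f(A)F(zA)$ is the composition of operators (i.e. the bounded operator $(fF_z)(A)$). With $dm$ the Lebesgue measure on $\mathbb{R}^2\cong\mathbb{C}$, $$\|x\|_{F,\alpha}=\left(\int_{\Sigma_\alpha}\|F(zA)x\|^2\,\frac{dm(z)}{|z|^2}\right)^{1/2}\in[0,\infty],\qquad x\in\mathbb{H}.$$ $\|x\|_{G,\beta}$ is defined in the same way. *)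

theory Defs
  imports "HOL-Analysis.Analysis"
begin

section \<open>Complex Hilbert spaces\<close>

text \<open>
  The norm, metric and topology are those of the underlying real inner product space, whose inner
  product is the real part of the complex one. Hence \<open>cinner x x\<close> is the squared norm of
  \<open>x\<close>, and positive definiteness is inherited. The complex inner product is linear in its first
  argument.
\<close>

class complex_hilbert_space = real_inner + complete_space +
  fixes scaleC :: "complex \<Rightarrow> 'a \<Rightarrow> 'a"  (infixr "*\<^sub>C" 75)
    and cinner :: "'a \<Rightarrow> 'a \<Rightarrow> complex"
  assumes scaleC_add_right: "c *\<^sub>C (x + y) = c *\<^sub>C x + c *\<^sub>C y"
    and scaleC_add_left: "(c + d) *\<^sub>C x = c *\<^sub>C x + d *\<^sub>C x"
    and scaleC_scaleC: "c *\<^sub>C (d *\<^sub>C x) = (c * d) *\<^sub>C x"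
    and scaleC_one: "1 *\<^sub>C x = x"
    and scaleR_scaleC: "r *\<^sub>R x = complex_of_real r *\<^sub>C x"
    and cinner_add_left: "cinner (x + y) z = cinner x z + cinner y z"
    and cinner_scaleC_left: "cinner (c *\<^sub>C x) y = c * cinner x y"
    and cinner_commute: "cinner x y = cnj (cinner y x)"
    and inner_eq_Re_cinner: "inner x y = Re (cinner x y)"

instance complex_hilbert_space \<subseteq> banach ..

section \<open>Sectors and spaces of bounded analytic functions\<close>

text \<open>
  Functions on a sector are total functions on \<open>complex\<close>; their values outside the sector
  play no role.
\<close>

definition sector :: "real \<Rightarrow> complex set" where
  "sector \<theta> = {z. z \<noteq> 0 \<and> \<bar>Arg z\<bar> < \<theta>}"

definition Hinf :: "real \<Rightarrow> (complex \<Rightarrow> complex) set" where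
  "Hinf \<theta> = {f. f holomorphic_on sector \<theta> \<and> bounded (f ` sector \<theta>)}"

definition Hinf_norm :: "real \<Rightarrow> (complex \<Rightarrow> complex) \<Rightarrow> real" where
  "Hinf_norm \<theta> f = (SUP z\<in>sector \<theta>. cmod (f z))"

definition Hinf0 :: "real \<Rightarrow> (complex \<Rightarrow> complex) set" where
  "Hinf0 \<theta> = {f \<in> Hinf \<theta>. \<exists>s>0. \<exists>c>0. \<forall>z\<in>sector \<theta>.
     cmod (f z) \<le> c * (cmod z powr s / (1 + cmod z) powr (2 * s))}"

section \<open>Unbounded operators\<close>

text \<open>
  An unbounded operator is a partial function: its domain is \<open>dom A\<close>, its range
  is \<open>ran A\<close>, its graph is \<open>Map.graph A\<close>, and its value at a point \<open>x\<close> of the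
  domain is \<open>the (A x)\<close>.
\<close>

definition clinear_operator :: "('a::complex_hilbert_space \<rightharpoonup> 'a) \<Rightarrow> bool" where
  "clinear_operator A \<longleftrightarrow>
     A 0 = Some 0 \<and>
     (\<forall>x y u v. A x = Some u \<longrightarrow> A y = Some v \<longrightarrow> A (x + y) = Some (u + v)) \<and>
     (\<forall>c x u. A x = Some u \<longrightarrow> A (c *\<^sub>C x) = Some (c *\<^sub>C u))"

definition closed_operator :: "('a::complex_hilbert_space \<rightharpoonup> 'a) \<Rightarrow> bool" where
  "closed_operator A \<longleftrightarrow> clinear_operator A \<and> closed (Map.graph A)"

definition densely_defined :: "('a::complex_hilbert_space \<rightharpoonup> 'a) \<Rightarrow> bool" where
  "densely_defined A \<longleftrightarrow> closure (dom A) = UNIV"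

text \<open>The inverse of \<open>z - A\<close>; meaningful for \<open>z\<close> in the resolvent set only.\<close>

definition resolvent :: "('a::complex_hilbert_space \<rightharpoonup> 'a) \<Rightarrow> complex \<Rightarrow> 'a \<Rightarrow> 'a" where
  "resolvent A z = inv_into (dom A) (\<lambda>x. z *\<^sub>C x - the (A x))"

definition resolvent_set :: "('a::complex_hilbert_space \<rightharpoonup> 'a) \<Rightarrow> complex set" where
  "resolvent_set A = {z. bij_betw (\<lambda>x. z *\<^sub>C x - the (A x)) (dom A) UNIV \<and>
     bounded_linear (resolvent A z)}"

definition spectrum :: "('a::complex_hilbert_space \<rightharpoonup> 'a) \<Rightarrow> complex set" where
  "spectrum A = - resolvent_set A"

definition sectorial :: "real \<Rightarrow> ('a::complex_hilbert_space \<rightharpoonup> 'a) \<Rightarrow> bool" where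
  "sectorial \<omega> A \<longleftrightarrow>
     closed_operator A \<and> densely_defined A \<and>
     spectrum A \<subseteq> closure (sector \<omega>) \<and>
     (\<forall>\<theta>'. \<omega> < \<theta>' \<and> \<theta>' < pi \<longrightarrow>
        (\<exists>K>0. \<forall>z. z \<notin> closure (sector \<theta>') \<longrightarrow> onorm (\<lambda>x. z *\<^sub>C resolvent A z x) \<le> K))"

section \<open>Functional calculus\<close>

definition sector_contour :: "real \<Rightarrow> real \<Rightarrow> complex" where
  "sector_contour \<gamma> t =
     (if t \<le> 0 then - complex_of_real t * exp (\<i> * complex_of_real \<gamma>)
      else complex_of_real t * exp (- \<i> * complex_of_real \<gamma>))"

text \<open>
  The integral is taken pointwise in \<open>x\<close> and is a gauge integral, which, unlike the library's
  Bochner integral, does not require a separable space. For \<open>f\<close> in \<open>Hinf0 \<theta>\<close> the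
  integrand is continuous away from \<open>t = 0\<close> and absolutely integrable in operator norm, so this is
  the value at \<open>x\<close> of the operator-valued contour integral. The exceptional point
  \<open>t = 0\<close>, where the curve has a corner, is a null set.
\<close>

definition contour_calc ::
  "('a::complex_hilbert_space \<rightharpoonup> 'a) \<Rightarrow> real \<Rightarrow> (complex \<Rightarrow> complex) \<Rightarrow> 'a \<Rightarrow> 'a" where
  "contour_calc A \<gamma> f x =
     (1 / (2 * complex_of_real pi * \<i>)) *\<^sub>C
     integral UNIV (\<lambda>t. (f (sector_contour \<gamma> t) * vector_derivative (sector_contour \<gamma>) (at t)) *\<^sub>C
       resolvent A (sector_contour \<gamma> t) x)"

text \<open>
  \<open>f(A)\<close> for \<open>A\<close> sectorial of type \<open>\<omega>\<close> and \<open>f\<close> in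
  \<open>Hinf0 \<theta>\<close>. By Cauchy's theorem every angle strictly between \<open>\<omega>\<close> and
  \<open>\<theta>\<close> gives the same operator; we take the midpoint.
\<close>

definition Hinf0_calc ::
  "('a::complex_hilbert_space \<rightharpoonup> 'a) \<Rightarrow> real \<Rightarrow> real \<Rightarrow> (complex \<Rightarrow> complex) \<Rightarrow> 'a \<Rightarrow> 'a" where
  "Hinf0_calc A \<omega> \<theta> f = contour_calc A ((\<omega> + \<theta>) / 2) f"

definition regularizer :: "complex \<Rightarrow> complex" where
  "regularizer z = z / (1 + z)\<^sup>2"

text \<open>
  \<open>f(A)\<close> for \<open>f\<close> in \<open>Hinf \<theta>\<close> and \<open>A\<close> one-one. The operator
  \<open>Hinf0_calc A \<omega> \<theta> regularizer\<close> is then one-one and its range is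
  \<open>dom A \<inter> ran A\<close>.
\<close>

definition Hinf_calc ::
  "('a::complex_hilbert_space \<rightharpoonup> 'a) \<Rightarrow> real \<Rightarrow> real \<Rightarrow> (complex \<Rightarrow> complex) \<Rightarrow> ('a \<rightharpoonup> 'a)" where
  "Hinf_calc A \<omega> \<theta> f x =
     (let y = Hinf0_calc A \<omega> \<theta> (\<lambda>z. f z * regularizer z) x in
      if y \<in> dom A \<inter> ran A then Some (inv (Hinf0_calc A \<omega> \<theta> regularizer) y) else None)"

section \<open>Area integral functions\<close>

text \<open>
  \<open>F(zA)\<close> for \<open>z\<close> in \<open>sector \<alpha>\<close>: the function \<open>w \<mapsto> F (z w)\<close>
  is used on the smaller sector of angle \<open>\<theta> - \<alpha>\<close>.
\<close>

definition dilated_calc ::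
  "('a::complex_hilbert_space \<rightharpoonup> 'a) \<Rightarrow> real \<Rightarrow> real \<Rightarrow> (complex \<Rightarrow> complex) \<Rightarrow> real \<Rightarrow> complex \<Rightarrow> 'a \<Rightarrow> 'a"
  where
  "dilated_calc A \<omega> \<theta> F \<alpha> z = Hinf0_calc A \<omega> (\<theta> - \<alpha>) (\<lambda>w. F (z * w))"

definition ennsqrt :: "ennreal \<Rightarrow> ennreal" where
  "ennsqrt a = (if a = \<infinity> then \<infinity> else ennreal (sqrt (enn2real a)))"

definition sector_L2_norm :: "real \<Rightarrow> (complex \<Rightarrow> 'a::complex_hilbert_space) \<Rightarrow> ennreal" where
  "sector_L2_norm \<alpha> u = ennsqrt (\<integral>\<^sup>+z\<in>sector \<alpha>. ennreal ((norm (u z))\<^sup>2 / (cmod z)\<^sup>2) \<partial>lborel)"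

definition area_norm ::
  "('a::complex_hilbert_space \<rightharpoonup> 'a) \<Rightarrow> real \<Rightarrow> real \<Rightarrow> (complex \<Rightarrow> complex) \<Rightarrow> real \<Rightarrow> 'a \<Rightarrow> ennreal" where
  "area_norm A \<omega> \<theta> F \<alpha> x = sector_L2_norm \<alpha> (\<lambda>z. dilated_calc A \<omega> \<theta> F \<alpha> z x)"

end

theory Submission
  imports Defs "HOL-Complex_Analysis.Complex_Analysis"
begin

text \<open>
  In the coordinate \<open>\<zeta> = log z\<close> a sector becomes a horizontal strip and its boundary two horizontal
  lines; the measure \<open>dr/r\<close> on a ray becomes Lebesgue measure, dilations become translations, and the
  functions in \<^const>\<open>Hinf0\<close> are those which decay exponentially. Tested against a vector, the operator
  \<open>f(A)\<close> is a difference of two scalar Lebesgue integrals over these lines (\<open>cinner_calc\<close>), so that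
  Cauchy's theorem and Fubini's theorem are needed for scalar functions only. They give the properties
  of the functional calculus that the argument uses: \<open>f(A)\<close> does not depend on the angle of the contour
  (\<open>calc_angle_independent\<close>), it is multiplicative in \<open>f\<close> (\<open>calc_mult\<close>), and the regularizer \<open>\<phi>\<close>
  satisfies \<open>\<phi>(A) = A(1+A)\<^sup>-\<^sup>2\<close> (\<open>calc_regularizer\<close>). Consequently the composition \<open>f(A)F(zA)\<close> of
  the theorem is the bounded operator \<open>(f F\<^sub>z)(A)\<close> (\<open>Hinf_calc_calc\<close>).

  The heart of the proof is a reproducing formula. Put \<open>H(z) = cnj (G (cnj z))\<close>. By Cauchy's theorem the
  integral of \<open>HG\<close> with respect to \<open>dr/r\<close> has the same value \<open>c\<close> along every ray of the large
  sector; on the positive axis \<open>HG = \<bar>G\<bar>\<^sup>2\<close>, so \<open>c > 0\<close> because \<open>G \<noteq> 0\<close>. Inserting \<open>c\<close> into the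
  contour integral of \<open>(f F\<^sub>w)(A)x\<close> and exchanging the integrals yields, for every fixed direction \<open>z\<close>,
  that \<open>c f(A)F(wA)x\<close> is the integral of \<open>(f F\<^sub>w H\<^sub>r\<^sub>z)(A) G(rzA)x\<close> with respect to \<open>dr/r\<close>. The norm of
  the operator \<open>(f F\<^sub>w H\<^sub>r\<^sub>z)(A)\<close> is at most \<open>\<parallel>f\<parallel>\<close> times a convolution kernel in \<open>ln \<bar>w\<bar>\<close> and
  \<open>ln \<bar>rz\<bar>\<close> which is integrable in each variable (\<open>calc_dilate_average_bound\<close>). Schur's test then bounds the
  square function of \<open>f(A)F(\<cdot>A)x\<close> along any ray in the sector of angle \<open>\<alpha>\<close> by the square function of
  \<open>G(\<cdot>A)x\<close> along any ray in the sector of angle \<open>\<beta>\<close>, with a constant that depends on neither ray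
  (\<open>calc_dilate_ray_bound\<close>). Averaging over both rays proves (i). Part (ii) is the case \<open>f = 1\<close>, used once
  more with \<open>F\<close> and \<open>G\<close> interchanged.
\<close>

section \<open>Complex Hilbert spaces\<close>

lemma scaleC_zero_right: "c *\<^sub>C (0::'a::complex_hilbert_space) = 0"
  using scaleC_add_right[of c 0 "0::'a"] by simp

lemma scaleC_zero_left: "0 *\<^sub>C (x::'a::complex_hilbert_space) = 0"
  using scaleR_scaleC[of 0 x] by simp

lemma scaleC_minus_left: "(- c) *\<^sub>C (x::'a::complex_hilbert_space) = - (c *\<^sub>C x)"
  using scaleC_add_left[of c "-c" x] by (simp add: scaleC_zero_left eq_neg_iff_add_eq_0 add.commute)

lemma scaleC_minus_right: "c *\<^sub>C (- x::'a::complex_hilbert_space) = - (c *\<^sub>C x)"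
  using scaleC_add_right[of c x "-x"] by (simp add: scaleC_zero_right eq_neg_iff_add_eq_0 add.commute)

lemma scaleC_diff_left: "(c - d) *\<^sub>C (x::'a::complex_hilbert_space) = c *\<^sub>C x - d *\<^sub>C x"
  using scaleC_add_left[of c "-d" x] by (simp add: scaleC_minus_left)

lemma scaleC_diff_right: "c *\<^sub>C (x - y::'a::complex_hilbert_space) = c *\<^sub>C x - c *\<^sub>C y"
  using scaleC_add_right[of c x "-y"] by (simp add: scaleC_minus_right)

lemma cinner_scaleC_right: "cinner x (c *\<^sub>C y) = cnj c * cinner (x::'a::complex_hilbert_space) y"
  by (metis cinner_commute cinner_scaleC_left complex_cnj_cnj complex_cnj_mult)

lemma cinner_self: "cinner x x = complex_of_real ((norm (x::'a::complex_hilbert_space))\<^sup>2)"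
proof -
  have "Im (cinner x x) = 0"
    using cinner_commute[of x x] by (metis Reals_cnj_iff complex_is_Real_iff)
  then show ?thesis
    by (simp add: complex_eq_iff power2_norm_eq_inner inner_eq_Re_cinner del: Re_complex_of_real)
       (simp add: inner_eq_Re_cinner)
qed

lemma norm_scaleC: "norm (c *\<^sub>C (x::'a::complex_hilbert_space)) = cmod c * norm x"
proof -
  have "complex_of_real ((norm (c *\<^sub>C x))\<^sup>2) = c * cnj c * cinner x x"
    unfolding cinner_self[symmetric] by (simp add: cinner_scaleC_left cinner_scaleC_right)
  also have "\<dots> = complex_of_real ((cmod c * norm x)\<^sup>2)"
    by (simp add: complex_norm_square cinner_self power_mult_distrib del: of_real_power)
  finally have "(norm (c *\<^sub>C x))\<^sup>2 = (cmod c * norm x)\<^sup>2"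
    using of_real_eq_iff by blast
  then show ?thesis
    by (simp add: power2_eq_iff_nonneg)
qed

lemma norm_cinner_le: "cmod (cinner x y) \<le> norm (x::'a::complex_hilbert_space) * norm y"
proof (cases "cinner x y = 0")
  case False
  \<comment> \<open>a rotation of \<open>x\<close> makes the complex product equal to the real one\<close>
  define c where "c = cnj (cinner x y) / cmod (cinner x y)"
  have c: "cmod c = 1" using False by (simp add: c_def norm_divide)
  have "cinner (c *\<^sub>C x) y = cmod (cinner x y)"
    using False complex_norm_square[of "cinner x y"]
    by (simp add: c_def cinner_scaleC_left power2_eq_square mult.commute divide_eq_eq)
  then have "cmod (cinner x y) = inner (c *\<^sub>C x) y" by (simp add: inner_eq_Re_cinner)
  also have "\<dots> \<le> norm (c *\<^sub>C x) * norm y" by (rule norm_cauchy_schwarz)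
  finally show ?thesis by (simp add: norm_scaleC c)
qed auto

lemma bounded_linear_cinner_left: "bounded_linear (\<lambda>x. cinner (x::'a::complex_hilbert_space) y)"
  by (rule bounded_linear_intro[where K="norm y"])
     (auto simp: cinner_add_left scaleR_scaleC cinner_scaleC_left norm_cinner_le scaleR_conv_of_real)

lemma bounded_bilinear_scaleC:
  "bounded_bilinear (\<lambda>c (x::'a::complex_hilbert_space). c *\<^sub>C x)"
  by (rule bounded_bilinear.intro)
     (auto simp: scaleC_add_left scaleC_add_right scaleR_scaleC scaleC_scaleC norm_scaleC
        scaleR_conv_of_real mult.commute intro!: exI[of _ 1])

lemma bounded_linear_scaleC: "bounded_linear (\<lambda>x::'a::complex_hilbert_space. c *\<^sub>C x)"
  by (rule bounded_bilinear.bounded_linear_right[OF bounded_bilinear_scaleC])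

lemma cinner_diff_left: "cinner (x - y) (z::'a::complex_hilbert_space) = cinner x z - cinner y z"
  using bounded_linear_cinner_left linear_diff bounded_linear.linear by blast

lemma cinner_zero_left: "cinner 0 (z::'a::complex_hilbert_space) = 0"
  using cinner_diff_left[of 0 0 z] by simp

lemma cinner_minus_left: "cinner (- x) (z::'a::complex_hilbert_space) = - cinner x z"
  using cinner_diff_left[of 0 x z] by (simp add: cinner_zero_left)

lemma cinner_left_cancel:
  assumes "\<And>z. cinner x z = cinner y (z::'a::complex_hilbert_space)"
  shows "x = y"
proof -
  have "cinner (x - y) (x - y) = 0" using assms by (simp add: cinner_diff_left)
  then show ?thesis by (simp add: cinner_self)
qed

text \<open>Norms are recovered from the pairings by testing against the vector itself.\<close>

lemma norm_le_of_cinner: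
  assumes "cmod (cinner x x) \<le> B * norm (x::'a::complex_hilbert_space)" "0 \<le> B"
  shows "norm x \<le> B"
proof (cases "x = 0")
  case False
  have "norm x * norm x \<le> B * norm x"
    using assms(1) by (simp add: cinner_self norm_power power2_eq_square norm_mult)
  with False show ?thesis by simp
qed (use assms in simp)

section \<open>Gauge integrals with values in a Banach space\<close>

text \<open>
  The gauge-integrable functions are closed under approximation in the \<open>L\<^sup>1\<close> sense. A function
  whose distance to an integrable function has small integral has Riemann sums that nearly
  satisfy the Cauchy condition, because the error of every Riemann sum is dominated by a Riemann sum
  of the small majorant.
\<close>

lemma integrable_on_cbox_L1_approx:
  fixes f :: "'n::euclidean_space \<Rightarrow> 'b::banach"
  assumes "\<And>e. e > 0 \<Longrightarrow> \<exists>h k. h integrable_on cbox a b \<and> k integrable_on cbox a b \<and>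
     (\<forall>x\<in>cbox a b. norm (f x - h x) \<le> k x) \<and> integral (cbox a b) k \<le> (e::real)"
  shows "f integrable_on cbox a b"
  unfolding integrable_Cauchy
proof (intro allI impI)
  fix e :: real assume "e > 0"
  then have "e/8 > 0" "e/4 > 0" by auto
  from assms[OF this(1)] obtain h k where h: "h integrable_on cbox a b" and k: "k integrable_on cbox a b"
    and le: "\<forall>x\<in>cbox a b. norm (f x - h x) \<le> k x" and small: "integral (cbox a b) k \<le> e/8"
    by (elim exE conjE)
  from h[unfolded integrable_Cauchy, rule_format, OF \<open>e/4 > 0\<close>] obtain \<gamma>1 where \<gamma>1: "gauge \<gamma>1" "\<forall>D1 D2.
      D1 tagged_division_of (cbox a b) \<and> \<gamma>1 fine D1 \<and> D2 tagged_division_of (cbox a b) \<and> \<gamma>1 fine D2 \<longrightarrow>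
      norm ((\<Sum>(x,K)\<in>D1. measure lborel K *\<^sub>R h x) - (\<Sum>(x,K)\<in>D2. measure lborel K *\<^sub>R h x)) < e/4"
    by (elim exE conjE)
  from integrable_integral[OF k, unfolded has_integral, rule_format, OF \<open>e/8 > 0\<close>] obtain \<gamma>2 where \<gamma>2: "gauge \<gamma>2" "\<forall>D.
      D tagged_division_of (cbox a b) \<and> \<gamma>2 fine D \<longrightarrow>
      norm ((\<Sum>(x,K)\<in>D. measure lborel K *\<^sub>R k x) - integral (cbox a b) k) < e/8"
    by (elim exE conjE)
  have err: "norm ((\<Sum>(x,K)\<in>D. measure lborel K *\<^sub>R f x) - (\<Sum>(x,K)\<in>D. measure lborel K *\<^sub>R h x)) < e/4"
    if D: "D tagged_division_of (cbox a b)" "\<gamma>2 fine D" for D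
  proof -
    have "norm ((\<Sum>(x,K)\<in>D. measure lborel K *\<^sub>R f x) - (\<Sum>(x,K)\<in>D. measure lborel K *\<^sub>R h x))
        = norm (\<Sum>(x,K)\<in>D. measure lborel K *\<^sub>R (f x - h x))"
      by (simp add: sum_subtractf[symmetric] case_prod_beta scaleR_diff_right)
    also have "\<dots> \<le> (\<Sum>(x,K)\<in>D. measure lborel K *\<^sub>R k x)"
      unfolding case_prod_beta
    proof (rule sum_norm_le)
      fix z assume "z \<in> D"
      then have "fst z \<in> cbox a b" using tagged_division_ofD(2,3)[OF D(1)] by (metis prod.collapse subsetD)
      with le have "norm (f (fst z) - h (fst z)) \<le> k (fst z)" by blast
      then show "norm (measure lborel (snd z) *\<^sub>R (f (fst z) - h (fst z))) \<le> measure lborel (snd z) *\<^sub>R k (fst z)"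
        by (simp add: mult_left_mono)
    qed
    also have "\<dots> < e/4"
      using \<gamma>2(2)[rule_format, OF conjI[OF D]] small unfolding real_norm_def by linarith
    finally show ?thesis .
  qed
  have tri: "norm (u - v) < e"
    if "norm (u - u') < e/4" "norm (v - v') < e/4" "norm (u' - v') < e/4" for u v u' v' :: 'b
  proof -
    have "u - v = (u - u') + (u' - v') - (v - v')" by simp
    then have "norm (u - v) \<le> norm ((u - u') + (u' - v')) + norm (v - v')"
      using norm_triangle_ineq4[of "(u - u') + (u' - v')" "v - v'"] by simp
    with that norm_triangle_ineq[of "u - u'" "u' - v'"] \<open>e > 0\<close> show ?thesis by linarith
  qed
  show "\<exists>\<gamma>. gauge \<gamma> \<and> (\<forall>D1 D2. D1 tagged_division_of (cbox a b) \<and> \<gamma> fine D1 \<and>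
            D2 tagged_division_of (cbox a b) \<and> \<gamma> fine D2 \<longrightarrow>
            norm ((\<Sum>(x,K)\<in>D1. measure lborel K *\<^sub>R f x) - (\<Sum>(x,K)\<in>D2. measure lborel K *\<^sub>R f x)) < e)"
  proof (intro exI[of _ "\<lambda>x. \<gamma>1 x \<inter> \<gamma>2 x"] conjI allI impI)
    show "gauge (\<lambda>x. \<gamma>1 x \<inter> \<gamma>2 x)" using \<gamma>1(1) \<gamma>2(1) by (rule gauge_Int)
    fix D1 D2
    assume D: "D1 tagged_division_of (cbox a b) \<and> (\<lambda>x. \<gamma>1 x \<inter> \<gamma>2 x) fine D1 \<and>
            D2 tagged_division_of (cbox a b) \<and> (\<lambda>x. \<gamma>1 x \<inter> \<gamma>2 x) fine D2"
    let ?S = "\<lambda>D f. (\<Sum>(x,K)\<in>D. measure lborel K *\<^sub>R f x)"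
    have D': "\<gamma>1 fine D1" "\<gamma>2 fine D1" "\<gamma>1 fine D2" "\<gamma>2 fine D2"
      using D by (auto simp: fine_Int)
    have "norm (?S D1 f - ?S D1 h) < e/4" "norm (?S D2 f - ?S D2 h) < e/4"
      "norm (?S D1 h - ?S D2 h) < e/4"
      using D D' by (blast intro: err \<gamma>1(2)[rule_format])+
    then show "norm (?S D1 f - ?S D2 f) < e"
      by (rule tri)
  qed
qed

lemma integrable_on_UNIV_L1_approx:
  fixes f :: "'n::euclidean_space \<Rightarrow> 'b::banach"
  assumes "\<And>e. e > 0 \<Longrightarrow> \<exists>h k. h integrable_on UNIV \<and> k integrable_on UNIV \<and>
     (\<forall>x. norm (f x - h x) \<le> k x) \<and> integral UNIV k \<le> (e::real)"
  shows "f integrable_on UNIV"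
proof -
  have box: "k integrable_on cbox a b" "integral (cbox a b) k \<le> integral UNIV k"
    if "k integrable_on UNIV" "\<And>x. 0 \<le> k x" for k :: "'n \<Rightarrow> real" and a b
    using that integrable_on_subcbox integral_subset_le[of "cbox a b" UNIV k]
    by (auto intro: integrable_on_subcbox)
  have loc: "f integrable_on cbox a b" for a b
  proof (rule integrable_on_cbox_L1_approx)
    fix e :: real assume "e > 0"
    from assms[OF this] obtain h k where *: "h integrable_on UNIV" "k integrable_on UNIV"
      "\<forall>x. norm (f x - h x) \<le> k x" "integral UNIV k \<le> e" by (elim exE conjE)
    have "k x \<ge> 0" for x using *(3) by (metis norm_ge_zero order_trans)
    with * box[of k a b] show "\<exists>h k. h integrable_on cbox a b \<and> k integrable_on cbox a b \<and>
     (\<forall>x\<in>cbox a b. norm (f x - h x) \<le> k x) \<and> integral (cbox a b) k \<le> e"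
      using integrable_on_subcbox[OF *(1)] by (intro exI[of _ h] exI[of _ k]) auto
  qed
  show ?thesis
    unfolding integrable_alt[of f]
  proof (intro conjI allI impI)
    fix e :: real assume "e > 0"
    then have "e/4 > 0" by simp
    from assms[OF this] obtain h k where *: "h integrable_on UNIV" "k integrable_on UNIV"
      "\<forall>x. norm (f x - h x) \<le> k x" "integral UNIV k \<le> e/4" by (elim exE conjE)
    have k0: "k x \<ge> 0" for x using *(3) by (metis norm_ge_zero order_trans)
    from integrable_altD(2)[OF *(1), of "e/4"] \<open>e > 0\<close> obtain B where B: "B > 0"
      "\<And>a b c d. ball 0 B \<subseteq> cbox a b \<Longrightarrow> ball 0 B \<subseteq> cbox c d \<Longrightarrow>
        norm (integral (cbox a b) h - integral (cbox c d) h) < e/4"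
      by auto
    have err: "norm (integral (cbox a b) f - integral (cbox a b) h) \<le> e/4" for a b
    proof -
      have hi: "h integrable_on cbox a b" using integrable_on_subcbox[OF *(1)] by auto
      have "norm (integral (cbox a b) f - integral (cbox a b) h) = norm (integral (cbox a b) (\<lambda>x. f x - h x))"
        using loc hi by (simp add: integral_diff)
      also have "\<dots> \<le> integral (cbox a b) k"
        using loc hi box[OF *(2) k0] *(3)
        by (intro integral_norm_bound_integral) (auto intro: integrable_diff)
      also have "\<dots> \<le> e/4" using box(2)[OF *(2) k0, of a b] *(4) by linarith
      finally show ?thesis .
    qed
    have "norm (integral (cbox a b) f - integral (cbox c d) f) < e"
      if "ball 0 B \<subseteq> cbox a b" "ball 0 B \<subseteq> cbox c d" for a b c d
      using err[of a b] err[of c d] B(2)[OF that] \<open>e > 0\<close> by norm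
    then show "\<exists>B>0. \<forall>a b c d. ball 0 B \<subseteq> cbox a b \<and> ball 0 B \<subseteq> cbox c d \<longrightarrow>
      norm (integral (cbox a b) (\<lambda>x. if x \<in> UNIV then f x else 0) -
      integral (cbox c d)  (\<lambda>x. if x \<in> UNIV then f x else 0)) < e"
      using B(1) by auto
  qed (use loc in simp)
qed

text \<open>
  The integrand of the functional calculus has a singularity at the corner of the contour, and
  its values need not lie in a separable space. Its restrictions to compact sets that avoid the corner
  are integrable by continuity, and they approximate it in the sense of the previous lemma.
\<close>

lemma dominated_punctured_integrable_on:
  fixes f :: "real \<Rightarrow> 'b::banach"
  assumes cont: "continuous_on (- {0}) f" and g: "g integrable_on UNIV"
    and le: "\<And>t. t \<noteq> 0 \<Longrightarrow> norm (f t) \<le> g t"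
  shows "f integrable_on UNIV"
proof -
  define f' g' where "f' = (\<lambda>t. if t = 0 then 0 else f t)" and "g' = (\<lambda>t. if t = 0 then 0 else g t)"
  have g': "g' integrable_on UNIV"
    by (rule integrable_spike[OF g, of "{0}"]) (auto simp: g'_def)
  have le': "norm (f' t) \<le> g' t" for t using le by (simp add: f'_def g'_def)
  then have g'0: "0 \<le> g' t" for t by (metis norm_ge_zero order_trans)
  define S where "S n = {- real n .. - inverse (real n)} \<union> {inverse (real n) .. real n}" for n
  have S_ev: "eventually (\<lambda>n. t \<in> S n) sequentially" if "t \<noteq> 0" for t
  proof -
    have "eventually (\<lambda>n. inverse (real n) < \<bar>t\<bar>) sequentially"
      using that by real_asymp
    moreover have "eventually (\<lambda>n. \<bar>t\<bar> \<le> real n) sequentially" by real_asymp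
    ultimately show ?thesis by eventually_elim (auto simp: S_def)
  qed
  have Sleb: "S n \<in> sets lebesgue" for n unfolding S_def by auto
  define k where "k n t = (if t \<in> S n then 0 else g' t)" for n t
  have kint: "k n integrable_on UNIV" for n
  proof -
    have "g' absolutely_integrable_on - S n"
      by (rule set_integrable_subset[OF nonnegative_absolutely_integrable_1[OF g']])
         (use g'0 Sleb in \<open>auto simp: Compl_in_sets_lebesgue\<close>)
    then have "(\<lambda>t. if t \<in> - S n then g' t else 0) integrable_on UNIV"
      using integrable_restrict_UNIV set_lebesgue_integral_eq_integral(1) by blast
    then show ?thesis by (rule integrable_eq) (auto simp: k_def)
  qed
  have "(\<lambda>n. integral UNIV (k n)) \<longlonglongrightarrow> integral UNIV (\<lambda>t::real. 0::real)"
  proof (rule dominated_convergence(2)[OF kint g'])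
    show "norm (k n x) \<le> g' x" for n x using g'0 by (simp add: k_def)
    show "(\<lambda>n. k n t) \<longlonglongrightarrow> 0" for t
    proof (cases "t = 0")
      case False
      from S_ev[OF this] have "eventually (\<lambda>n. k n t = 0) sequentially"
        by eventually_elim (simp add: k_def)
      then show ?thesis by (rule tendsto_eventually)
    next
      case True
      have "k n t = 0" for n using True by (simp add: k_def g'_def)
      then show ?thesis by simp
    qed
  qed
  then have k0: "(\<lambda>n. integral UNIV (k n)) \<longlonglongrightarrow> 0" by simp
  have "f' integrable_on UNIV"
  proof (rule integrable_on_UNIV_L1_approx)
    fix e :: real assume "e > 0"
    with k0 have "eventually (\<lambda>n. integral UNIV (k n) < e) sequentially"
      by (simp add: order_tendsto_iff)
    then obtain n where n: "integral UNIV (k n) < e" "n > 1"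
      using eventually_conj[OF _ eventually_gt_at_top[of 1]] eventually_happens'[OF sequentially_bot] by blast
    have pos: "inverse (real n) > 0" "inverse (real n) < real n"
      using n(2) less_1_mult[of "real n" "real n"] by (auto simp: field_simps)
    have fi: "f integrable_on {- real n .. - inverse (real n)}" "f integrable_on {inverse (real n) .. real n}"
      using pos by (auto intro!: integrable_continuous_interval continuous_on_subset[OF cont])
    have "f integrable_on S n"
      unfolding S_def
      by (rule integrable_Un[OF _ fi]) (use pos in \<open>auto intro!: negligible_subset[of "{}"]\<close>)
    then have "(\<lambda>t. if t \<in> S n then f t else 0) integrable_on UNIV"
      by (simp add: integrable_restrict_UNIV)
    moreover have "norm (f' t - (if t \<in> S n then f t else 0)) \<le> k n t" for t
      using le'[of t] pos by (auto simp: k_def f'_def S_def split: if_splits)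
    ultimately show "\<exists>h k. h integrable_on UNIV \<and> k integrable_on UNIV \<and>
     (\<forall>x. norm (f' x - h x) \<le> k x) \<and> integral UNIV k \<le> e"
      using kint n(1) by (intro exI[of _ "\<lambda>t. if t \<in> S n then f t else 0"] exI[of _ "k n"]) auto
  qed
  then show ?thesis
    by (rule integrable_spike[where S="{0}"]) (auto simp: f'_def)
qed

section \<open>Sectors and logarithmic coordinates\<close>

lemma exp_in_sector:
  assumes "\<bar>Im \<zeta>\<bar> < \<delta>" "\<delta> \<le> pi"
  shows "exp \<zeta> \<in> sector \<delta>"
  using assms by (simp add: sector_def Arg_exp)

lemma sector_Ln:
  assumes "z \<in> sector \<delta>"
  shows "exp (Ln z) = z" "\<bar>Im (Ln z)\<bar> < \<delta>" "Re (Ln z) = ln (cmod z)"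
  using assms by (auto simp: sector_def Arg_eq_Im_Ln)

lemma sector_eq_exp_image: "\<delta> \<le> pi \<Longrightarrow> sector \<delta> = exp ` {\<zeta>. \<bar>Im \<zeta>\<bar> < \<delta>}"
  using exp_in_sector sector_Ln by (fastforce simp: image_iff)

lemma sector_nonzero: "z \<in> sector \<delta> \<Longrightarrow> z \<noteq> 0"
  by (simp add: sector_def)

lemma sector_mono: "a \<le> b \<Longrightarrow> sector a \<subseteq> sector b"
  by (auto simp: sector_def)

lemma sector_mult:
  assumes "z \<in> sector a" "w \<in> sector b" "a + b \<le> pi"
  shows "z * w \<in> sector (a + b)"
proof -
  have "z * w = exp (Ln z + Ln w)"
    using sector_Ln(1)[OF assms(1)] sector_Ln(1)[OF assms(2)] by (simp add: exp_add)
  then show ?thesis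
    using sector_Ln(2)[OF assms(1)] sector_Ln(2)[OF assms(2)] assms(3)
    by (auto intro!: exp_in_sector)
qed

lemma cnj_in_sector: "z \<in> sector \<delta> \<Longrightarrow> \<delta> \<le> pi \<Longrightarrow> cnj z \<in> sector \<delta>"
  using exp_in_sector[of "cnj (Ln z)" \<delta>] sector_Ln[of z \<delta>] by (simp flip: exp_cnj)

text \<open>
  In this form the sector is seen to be open, and its closure is contained in the closed cone with
  the weak inequality.
\<close>

lemma sector_iff_cos:
  assumes "0 \<le> \<delta>" "\<delta> \<le> pi"
  shows "z \<in> sector \<delta> \<longleftrightarrow> z \<noteq> 0 \<and> cos \<delta> * cmod z < Re z"
proof (cases "z = 0")
  case False
  have "\<bar>Arg z\<bar> < \<delta> \<longleftrightarrow> cos \<delta> < cos \<bar>Arg z\<bar>"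
    using cos_mono_less_eq[of \<delta> "\<bar>Arg z\<bar>"] assms Arg_bounded[of z] by auto
  also have "\<dots> \<longleftrightarrow> cos \<delta> * cmod z < Re z"
    using False by (simp add: cos_Arg pos_less_divide_eq)
  finally show ?thesis using False by (simp add: sector_def)
qed (simp add: sector_def)

lemma cos_less_of_abs:
  assumes "0 \<le> t" "t < \<bar>v\<bar>" "\<bar>v\<bar> \<le> pi"
  shows "cos v < cos t"
  using cos_monotone_0_pi[OF assms] by simp

lemma open_sector: "0 \<le> \<delta> \<Longrightarrow> \<delta> \<le> pi \<Longrightarrow> open (sector \<delta>)"
proof -
  assume d: "0 \<le> \<delta>" "\<delta> \<le> pi"
  have "open ({z. z \<noteq> 0} \<inter> {z. cos \<delta> * cmod z < Re z})"
    by (intro open_Int open_Collect_neq open_Collect_less continuous_intros)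
  also have "\<dots> = sector \<delta>" using sector_iff_cos[OF d] by auto
  finally show ?thesis .
qed

lemma connected_sector: "\<delta> \<le> pi \<Longrightarrow> connected (sector \<delta>)"
proof -
  assume d: "\<delta> \<le> pi"
  have "convex {\<zeta>. \<bar>Im \<zeta>\<bar> < \<delta>}"
    using convex_Int[OF convex_halfspace_Im_gt[of "-\<delta>"] convex_halfspace_Im_lt[of \<delta>]]
    by (simp add: abs_less_iff Collect_conj_eq[symmetric] conj_commute minus_less_iff)
  then show ?thesis
    unfolding sector_eq_exp_image[OF d]
    by (intro connected_continuous_image continuous_intros convex_connected)
qed

lemma notin_closure_sector:
  assumes "0 \<le> \<delta>" "\<delta> \<le> pi" "Re z < cos \<delta> * cmod z"
  shows "z \<notin> closure (sector \<delta>)"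
proof
  have "closed {z. cos \<delta> * cmod z \<le> Re z}"
    by (intro closed_Collect_le continuous_intros)
  moreover have "sector \<delta> \<subseteq> {z. cos \<delta> * cmod z \<le> Re z}"
    using sector_iff_cos[OF assms(1,2)] less_imp_le by blast
  ultimately have "closure (sector \<delta>) \<subseteq> {z. cos \<delta> * cmod z \<le> Re z}"
    by (rule closure_minimal[rotated])
  moreover assume "z \<in> closure (sector \<delta>)"
  ultimately have "z \<in> {z. cos \<delta> * cmod z \<le> Re z}" by (rule subsetD)
  then show False
    using assms(3) by simp
qed

text \<open>
  The bound defining \<^const>\<open>Hinf0\<close> becomes exponential decay in the variable \<open>ln \<bar>z\<bar>\<close>, since
  \<open>r/(1+r)\<^sup>2 \<le> min r (1/r)\<close>.
\<close>

lemma powr_quotient_le_exp: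
  fixes r s :: real
  assumes "0 < r" "0 < s"
  shows "r powr s / (1 + r) powr (2 * s) \<le> exp (- s * \<bar>ln r\<bar>)"
proof -
  have "r powr s / (1 + r) powr (2 * s) = exp (s * (ln r - 2 * ln (1 + r)))"
    using assms by (simp add: powr_def exp_diff[symmetric] algebra_simps)
  moreover have "ln r - 2 * ln (1 + r) \<le> - \<bar>ln r\<bar>"
    using assms ln_mono[of r "1 + r"] ln_ge_zero[of "1 + r"] by (auto simp: abs_if)
  ultimately show ?thesis
    using mult_left_mono[of "ln r - 2 * ln (1 + r)" "- \<bar>ln r\<bar>" s] assms by simp
qed

text \<open>
  The exponent and the constant are explicit because the estimates must be uniform under dilations
  and under multiplication by a bounded function.
\<close>

definition sector_decay :: "real \<Rightarrow> real \<Rightarrow> real \<Rightarrow> (complex \<Rightarrow> complex) \<Rightarrow> bool" where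
  "sector_decay \<delta> s c f \<longleftrightarrow> f holomorphic_on sector \<delta> \<and> 0 < s \<and> 0 \<le> c \<and>
     (\<forall>z\<in>sector \<delta>. cmod (f z) \<le> c * exp (- s * \<bar>ln (cmod z)\<bar>))"

lemma Hinf0_decay:
  assumes "f \<in> Hinf0 \<delta>"
  obtains s c where "sector_decay \<delta> s c f"
proof -
  from assms obtain s c where sc: "s > 0" "c > 0"
    "\<forall>z\<in>sector \<delta>. cmod (f z) \<le> c * (cmod z powr s / (1 + cmod z) powr (2 * s))"
    unfolding Hinf0_def by blast
  have "cmod (f z) \<le> c * exp (- s * \<bar>ln (cmod z)\<bar>)" if "z \<in> sector \<delta>" for z
  proof -
    have "cmod (f z) \<le> c * (cmod z powr s / (1 + cmod z) powr (2 * s))"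
      using sc(3) that by blast
    also have "\<dots> \<le> c * exp (- s * \<bar>ln (cmod z)\<bar>)"
      using powr_quotient_le_exp[of "cmod z" s] sector_nonzero[OF that] sc
      by (intro mult_left_mono) auto
    finally show ?thesis .
  qed
  with sc assms show ?thesis
    by (intro that[of s c]) (auto simp: sector_decay_def Hinf0_def Hinf_def)
qed

section \<open>Integrals over horizontal lines\<close>

lemma integrable_exp_abs:
  assumes "0 < s"
  shows "integrable lborel (\<lambda>x::real. exp (- s * \<bar>x\<bar>))"
proof -
  have "(\<lambda>x. exp (- s * x)) integrable_on {0..}"
    using has_integral_exp_minus_to_infinity[OF assms, of 0] by (auto simp: integrable_on_def)
  then have "set_integrable lebesgue {0..} (\<lambda>x. exp (- s * x))"
    by (intro nonnegative_absolutely_integrable_1) auto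
  then have i: "integrable lborel (\<lambda>x. indicator {0..} x *\<^sub>R exp (- s * x))"
    unfolding set_integrable_def by (subst (asm) integrable_completion) auto
  from lborel_integrable_real_affine[OF i, of "-1" 0]
  have "integrable lborel (\<lambda>x. indicator {0..} x *\<^sub>R exp (- s * x) + indicator {0..} (-x) *\<^sub>R exp (s * x))"
    using i by (intro Bochner_Integration.integrable_add) simp_all
  then show ?thesis
    by (rule Bochner_Integration.integrable_bound) (auto simp: indicator_def)
qed

lemma integrable_exp_abs_shift:
  assumes "0 < s"
  shows "integrable lborel (\<lambda>x::real. exp (- s * \<bar>t + x\<bar>))"
  using lborel_integrable_real_affine[OF integrable_exp_abs[OF assms], of 1 t] by simp

text \<open>
  Decay is required outside a bounded interval only, so that the Cauchy kernel, which is large near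
  its pole, is admitted.
\<close>

lemma tail_decay_integrable:
  fixes f :: "real \<Rightarrow> complex"
  assumes cont: "continuous_on UNIV f" and s: "0 < s"
    and bd: "\<And>x. R \<le> \<bar>x\<bar> \<Longrightarrow> cmod (f x) \<le> C * exp (- s * \<bar>x\<bar>)"
  shows "integrable lborel f"
proof -
  have "bounded (f ` {-\<bar>R\<bar>..\<bar>R\<bar>})"
    by (intro compact_imp_bounded compact_continuous_image continuous_on_subset[OF cont]) auto
  then obtain M where M: "\<And>x. x \<in> {-\<bar>R\<bar>..\<bar>R\<bar>} \<Longrightarrow> cmod (f x) \<le> M"
    unfolding bounded_iff by blast
  have M0: "0 \<le> M" using order_trans[OF norm_ge_zero M[of 0]] by simp
  define D where "D = \<bar>C\<bar> + M * exp (s * \<bar>R\<bar>)"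
  have le: "cmod (f x) \<le> D * exp (- s * \<bar>x\<bar>)" for x
  proof (cases "R \<le> \<bar>x\<bar>")
    case True
    have "C \<le> D"
      using M0 abs_ge_self[of C] by (simp add: D_def add_increasing2)
    then have "C * exp (- s * \<bar>x\<bar>) \<le> D * exp (- s * \<bar>x\<bar>)"
      by (rule mult_right_mono) simp
    with bd[OF True] show ?thesis by linarith
  next
    case False
    have "M * 1 \<le> M * exp (s * \<bar>R\<bar> + - s * \<bar>x\<bar>)"
      using False s M0 by (intro mult_left_mono) (auto simp: algebra_simps mult_left_mono)
    also have "\<dots> = M * exp (s * \<bar>R\<bar>) * exp (- s * \<bar>x\<bar>)"
      by (simp only: exp_add mult.assoc)
    also have "\<dots> \<le> D * exp (- s * \<bar>x\<bar>)"
      by (intro mult_right_mono) (simp_all add: D_def)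
    finally have "M * 1 \<le> D * exp (- s * \<bar>x\<bar>)" .
    moreover have "x \<in> {-\<bar>R\<bar>..\<bar>R\<bar>}" using False by auto
    ultimately show ?thesis using M by fastforce
  qed
  show ?thesis
  proof (rule Bochner_Integration.integrable_bound[OF integrable_mult_right[OF integrable_exp_abs[OF s], of D]])
    show "f \<in> borel_measurable lborel"
      using borel_measurable_continuous_onI[OF cont] by simp
    show "AE x in lborel. norm (f x) \<le> norm (D * exp (- s * \<bar>x\<bar>))"
      using le by (auto intro: order_trans[OF _ abs_ge_self])
  qed
qed

definition line_integral :: "real \<Rightarrow> (complex \<Rightarrow> complex) \<Rightarrow> complex" where
  "line_integral y \<Theta> = (\<integral>x. \<Theta> (Complex x y) \<partial>lborel)"

lemma has_contour_integral_horizontal: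
  assumes "p < q"
  shows "(f has_contour_integral I) (linepath (Complex p c) (Complex q c)) \<longleftrightarrow>
         ((\<lambda>x. f (Complex x c)) has_integral I) {p..q}"
proof -
  have eq: "f (linepath (Complex p c) (Complex q c) x) * (Complex q c - Complex p c) =
      f (linepath (complex_of_real p) (complex_of_real q) x + \<i> * c) * (complex_of_real q - complex_of_real p)" for x
  proof -
    have "linepath (Complex p c) (Complex q c) x = linepath (complex_of_real p) (complex_of_real q) x + \<i> * c"
      by (simp add: linepath_def complex_eq_iff algebra_simps)
    moreover have "Complex q c - Complex p c = complex_of_real q - complex_of_real p"
      by (simp add: complex_eq_iff)
    ultimately show ?thesis by simp
  qed
  have "(f has_contour_integral I) (linepath (Complex p c) (Complex q c)) \<longleftrightarrow>
      ((\<lambda>z. f (z + \<i> * c)) has_contour_integral I) (linepath (complex_of_real p) (complex_of_real q))"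
    unfolding has_contour_integral_linepath eq ..
  also have "\<dots> \<longleftrightarrow> ((\<lambda>x. f (complex_of_real x + \<i> * c)) has_integral I) {p..q}"
    using assms by (subst has_contour_integral_linepath_Reals_iff) auto
  finally show ?thesis by (simp add: Complex_eq)
qed

lemma set_integral_to_line_integral:
  fixes f :: "real \<Rightarrow> complex"
  assumes f: "integrable lborel f"
  shows "(\<lambda>n. integral {- real n..real n} f) \<longlonglongrightarrow> (\<integral>x. f x \<partial>lborel)"
proof -
  have "(\<lambda>n. \<integral>x. indicator {- real n..real n} x *\<^sub>R f x \<partial>lborel) \<longlonglongrightarrow> (\<integral>x. f x \<partial>lborel)"
  proof (rule integral_dominated_convergence)
    show "integrable lborel (\<lambda>x. norm (f x))" using f by simp
    show "AE x in lborel. (\<lambda>n. indicator {- real n..real n} x *\<^sub>R f x) \<longlonglongrightarrow> f x"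
    proof (intro AE_I2)
      fix x
      have "eventually (\<lambda>n. \<bar>x\<bar> \<le> real n) sequentially" by real_asymp
      then have "eventually (\<lambda>n. indicator {- real n..real n} x *\<^sub>R f x = f x) sequentially"
        by eventually_elim (auto simp: indicator_def)
      then show "(\<lambda>n. indicator {- real n..real n} x *\<^sub>R f x) \<longlonglongrightarrow> f x" by (rule tendsto_eventually)
    qed
  qed (use f in \<open>auto simp: indicator_def\<close>)
  moreover have "(\<integral>x. indicator {- real n..real n} x *\<^sub>R f x \<partial>lborel) = integral {- real n..real n} f" for n
  proof -
    have "set_integrable lborel {- real n..real n} f"
      unfolding set_integrable_def using f by (intro integrable_mult_indicator) auto
    from set_borel_integral_eq_integral(2)[OF this] show ?thesis
      by (simp add: set_lebesgue_integral_def)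
  qed
  ultimately show ?thesis by simp
qed

text \<open>
  A contour integral over all large rectangles of a strip turns into the difference of the
  integrals over its two boundary lines, because the vertical sides contribute exponentially little.
\<close>

lemma strip_contour_limit:
  fixes \<Theta> :: "complex \<Rightarrow> complex"
  assumes ab: "a < b" and s: "0 < s"
    and conta: "continuous_on UNIV (\<lambda>x. \<Theta> (Complex x a))"
    and contb: "continuous_on UNIV (\<lambda>x. \<Theta> (Complex x b))"
    and rect: "\<And>n. n > R \<Longrightarrow> n > 0 \<Longrightarrow> (\<Theta> has_contour_integral I) (rectpath (Complex (-n) a) (Complex n b))"
    and bd: "\<And>\<zeta>. a \<le> Im \<zeta> \<Longrightarrow> Im \<zeta> \<le> b \<Longrightarrow> R \<le> \<bar>Re \<zeta>\<bar> \<Longrightarrow> cmod (\<Theta> \<zeta>) \<le> C * exp (- s * \<bar>Re \<zeta>\<bar>)"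
  shows "line_integral a \<Theta> - line_integral b \<Theta> = I"
proof -
  have ia: "integrable lborel (\<lambda>x. \<Theta> (Complex x a))"
    by (rule tail_decay_integrable[OF conta s]) (use bd[of "Complex _ a"] ab in auto)
  have ib: "integrable lborel (\<lambda>x. \<Theta> (Complex x b))"
    by (rule tail_decay_integrable[OF contb s]) (use bd[of "Complex _ b"] ab in auto)
  define D where "D n = integral {- real n..real n} (\<lambda>x. \<Theta> (Complex x a)) -
                        integral {- real n..real n} (\<lambda>x. \<Theta> (Complex x b))" for n
  have "D \<longlonglongrightarrow> line_integral a \<Theta> - line_integral b \<Theta>"
    unfolding D_def line_integral_def
    by (intro tendsto_diff set_integral_to_line_integral ia ib)
  moreover have "D \<longlonglongrightarrow> I"
  proof (rule LIM_zero_cancel, rule Lim_null_comparison)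
    show "(\<lambda>n. 2 * (\<bar>C\<bar> * exp (- s * real n) * (b - a))) \<longlonglongrightarrow> 0"
      using s by real_asymp
    have "eventually (\<lambda>n. real n > R \<and> n > 0) sequentially"
      by (intro eventually_conj eventually_gt_at_top) real_asymp
    then show "eventually (\<lambda>n. norm (D n - I) \<le> 2 * (\<bar>C\<bar> * exp (- s * real n) * (b - a))) sequentially"
    proof eventually_elim
      case (elim n)
      let ?p1 = "linepath (Complex (- real n) a) (Complex (real n) a)"
      let ?p2 = "linepath (Complex (real n) a) (Complex (real n) b)"
      let ?p3 = "linepath (Complex (real n) b) (Complex (- real n) b)"
      let ?p4 = "linepath (Complex (- real n) b) (Complex (- real n) a)"
      have hc: "(\<Theta> has_contour_integral I) (?p1 +++ ?p2 +++ ?p3 +++ ?p4)"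
        using rect[of "real n"] elim by (simp add: rectpath_def Let_def)
      have cs: "\<Theta> contour_integrable_on (?p1 +++ ?p2 +++ ?p3 +++ ?p4)"
        using hc by (auto simp: contour_integrable_on_def)
      then have cs': "\<Theta> contour_integrable_on ?p1" "\<Theta> contour_integrable_on ?p2"
        "\<Theta> contour_integrable_on ?p3" "\<Theta> contour_integrable_on ?p4"
        by (simp_all add: valid_path_join)
      have I: "I = contour_integral ?p1 \<Theta> + (contour_integral ?p2 \<Theta> + (contour_integral ?p3 \<Theta> + contour_integral ?p4 \<Theta>))"
        using contour_integral_unique[OF hc] cs' by (simp add: valid_path_join contour_integrable_joinI)
      have horiz: "contour_integral (linepath (Complex (- real n) c) (Complex (real n) c)) \<Theta>
          = integral {- real n..real n} (\<lambda>x. \<Theta> (Complex x c))"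
        if "\<Theta> contour_integrable_on (linepath (Complex (- real n) c) (Complex (real n) c))" for c
        using has_contour_integral_integral[OF that] elim
        by (subst (asm) has_contour_integral_horizontal) (auto simp: integral_unique)
      have r3: "linepath (Complex (real n) b) (Complex (- real n) b) = reversepath (linepath (Complex (- real n) b) (Complex (real n) b))"
        by simp
      have h3: "contour_integral ?p3 \<Theta> = - integral {- real n..real n} (\<lambda>x. \<Theta> (Complex x b))"
        using cs'(3) horiz[of b] unfolding r3
        by (simp add: contour_integral_reversepath contour_integrable_reversepath_eq del: reversepath_linepath)
      have B: "0 \<le> \<bar>C\<bar> * exp (- s * real n)" by simp
      have vb: "cmod (\<Theta> w) \<le> \<bar>C\<bar> * exp (- s * real n)"
        if "a \<le> Im w" "Im w \<le> b" "\<bar>Re w\<bar> = real n" for w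
      proof -
        have "cmod (\<Theta> w) \<le> C * exp (- s * real n)" using bd[of w] that elim by auto
        also have "\<dots> \<le> \<bar>C\<bar> * exp (- s * real n)" by (intro mult_right_mono) auto
        finally show ?thesis .
      qed
      have v2: "norm (contour_integral ?p2 \<Theta>) \<le> \<bar>C\<bar> * exp (- s * real n) * norm (Complex (real n) b - Complex (real n) a)"
        by (rule contour_integral_bound_linepath[OF cs'(2) B], rule vb)
           (use ab in \<open>auto simp: closed_segment_same_Re closed_segment_eq_real_ivl\<close>)
      have v4: "norm (contour_integral ?p4 \<Theta>) \<le> \<bar>C\<bar> * exp (- s * real n) * norm (Complex (- real n) a - Complex (- real n) b)"
        by (rule contour_integral_bound_linepath[OF cs'(4) B], rule vb)
           (use ab in \<open>auto simp: closed_segment_same_Re closed_segment_eq_real_ivl\<close>)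
      have n2: "norm (Complex (real n) b - Complex (real n) a) = b - a" "norm (Complex (- real n) a - Complex (- real n) b) = b - a"
        using ab by (simp_all add: cmod_def)
      have "D n - I = - (contour_integral ?p2 \<Theta> + contour_integral ?p4 \<Theta>)"
        unfolding D_def I h3 horiz[OF cs'(1)] by simp
      then have "norm (D n - I) \<le> norm (contour_integral ?p2 \<Theta>) + norm (contour_integral ?p4 \<Theta>)"
        by (simp add: norm_triangle_ineq del: minus_add_distrib)
      with v2 v4 show ?case unfolding n2 by linarith
    qed
  qed
  ultimately show ?thesis using LIMSEQ_unique by blast
qed

lemma open_strip: "open {\<zeta>. a < Im \<zeta> \<and> Im \<zeta> < b}"
  unfolding Collect_conj_eq by (intro open_Int open_halfspace_Im_gt open_halfspace_Im_lt)

lemma convex_strip: "convex {\<zeta>. a < Im \<zeta> \<and> Im \<zeta> < b}"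
  unfolding Collect_conj_eq by (intro convex_Int convex_halfspace_Im_gt convex_halfspace_Im_lt)

lemma path_image_rectpath_strip:
  assumes "a \<le> b" "0 < n" "a' < a" "b < b'"
  shows "path_image (rectpath (Complex (-n) a) (Complex n b)) \<subseteq> {\<zeta>. a' < Im \<zeta> \<and> Im \<zeta> < b'}"
  using assms by (subst path_image_rectpath) auto

lemma rectpath_Cauchy:
  assumes P: "P holomorphic_on {\<zeta>. a' < Im \<zeta> \<and> Im \<zeta> < b'}"
    and "a \<le> b" "0 < n" "a' < a" "b < b'"
  shows "(P has_contour_integral 0) (rectpath (Complex (-n) a) (Complex n b))"
  by (rule Cauchy_theorem_convex_simple[OF P convex_strip])
     (use path_image_rectpath_strip[OF assms(2-)] in auto)

text \<open>
  In logarithmic coordinates the Cauchy kernel \<open>d\<mu>/(\<mu> - \<lambda>)\<close> reads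
  \<open>e\<^sup>\<zeta>/(e\<^sup>\<zeta> - e\<^sup>p) d\<zeta>\<close>, with a single simple pole in a strip of width at most \<open>2\<pi>\<close>.
\<close>

lemma rectpath_kernel:
  assumes P: "P holomorphic_on {\<zeta>. a' < Im \<zeta> \<and> Im \<zeta> < b'}"
    and ab: "a' < a" "b < b'" "b' - a' \<le> 2 * pi"
    and p: "a < Im p" "Im p < b" "\<bar>Re p\<bar> < n"
  shows "((\<lambda>\<zeta>. P \<zeta> * (exp \<zeta> / (exp \<zeta> - exp p))) has_contour_integral 2 * pi * \<i> * P p)
           (rectpath (Complex (-n) a) (Complex n b))"
proof -
  let ?T = "{\<zeta>. a' < Im \<zeta> \<and> Im \<zeta> < b'}"
  define q where "q = (\<lambda>\<zeta>. if \<zeta> = p then deriv exp p else (exp \<zeta> - exp p) / (\<zeta> - p))"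
  have q: "q holomorphic_on ?T"
    unfolding q_def by (rule pole_lemma_open[OF _ open_strip]) (auto intro!: holomorphic_intros)
  have q0: "q \<zeta> \<noteq> 0" if "\<zeta> \<in> ?T" for \<zeta>
  proof (cases "\<zeta> = p")
    case False
    have "\<bar>Im \<zeta> - Im p\<bar> < 2 * pi" using that ab p by auto
    with False exp_complex_eqI[of \<zeta> p] show ?thesis by (auto simp: q_def)
  qed (simp add: q_def DERIV_imp_deriv[OF DERIV_exp])
  define \<Phi> where "\<Phi> = (\<lambda>\<zeta>. P \<zeta> * exp \<zeta> / q \<zeta>)"
  have \<Phi>: "\<Phi> holomorphic_on ?T"
    unfolding \<Phi>_def by (intro holomorphic_intros P q q0) auto
  have n: "0 < n" using p by auto
  have sub: "path_image (rectpath (Complex (-n) a) (Complex n b)) \<subseteq> ?T"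
    by (rule path_image_rectpath_strip) (use ab p n in auto)
  have pni: "p \<notin> path_image (rectpath (Complex (-n) a) (Complex n b))"
    using p n by (subst path_image_rectpath) auto
  have "winding_number (rectpath (Complex (-n) a) (Complex n b)) p = 1"
    by (rule winding_number_rectpath) (use p in \<open>auto simp: in_box_complex_iff\<close>)
  moreover have "\<Phi> p = P p" by (simp add: \<Phi>_def q_def DERIV_imp_deriv[OF DERIV_exp])
  moreover have "((\<lambda>w. \<Phi> w / (w - p)) has_contour_integral
      (2 * pi * \<i> * winding_number (rectpath (Complex (-n) a) (Complex n b)) p * \<Phi> p))
      (rectpath (Complex (-n) a) (Complex n b))"
  proof (rule Cauchy_integral_formula_convex_simple[OF convex_strip \<Phi>])
    show "p \<in> interior ?T" using p ab by (subst interior_open[OF open_strip]) auto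
  qed (use sub pni in auto)
  ultimately have "((\<lambda>w. \<Phi> w / (w - p)) has_contour_integral 2 * pi * \<i> * P p)
      (rectpath (Complex (-n) a) (Complex n b))" by simp
  then show ?thesis
    by (rule has_contour_integral_eq) (use pni in \<open>auto simp: \<Phi>_def q_def\<close>)
qed

lemma holomorphic_continuous_on_line:
  assumes "P holomorphic_on {\<zeta>. a < Im \<zeta> \<and> Im \<zeta> < b}" "a < y" "y < b"
  shows "continuous_on UNIV (\<lambda>x. P (Complex x y))"
proof -
  have "continuous_on UNIV (\<lambda>x. complex_of_real x + \<i> * y)" by (intro continuous_intros)
  then have "continuous_on UNIV (\<lambda>x. Complex x y)" by (simp add: Complex_eq)
  then show ?thesis
    by (rule continuous_on_compose2[OF holomorphic_on_imp_continuous_on[OF assms(1)]])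
       (use assms in auto)
qed

text \<open>
  Cauchy's theorem in a strip; in the original coordinates this is the rotation of a ray inside a
  sector.
\<close>

lemma line_integral_shift:
  assumes P: "P holomorphic_on {\<zeta>. a' < Im \<zeta> \<and> Im \<zeta> < b'}" and s: "0 < s"
    and bd: "\<And>\<zeta>. a' < Im \<zeta> \<Longrightarrow> Im \<zeta> < b' \<Longrightarrow> cmod (P \<zeta>) \<le> C * exp (- s * \<bar>Re \<zeta>\<bar>)"
    and "a' < a" "a < b'" "a' < b" "b < b'"
  shows "line_integral a P = line_integral b P"
proof -
  have lt: "line_integral u P = line_integral v P" if "a' < u" "u < v" "v < b'" for u v
  proof -
    have "line_integral u P - line_integral v P = 0"
      by (rule strip_contour_limit[OF that(2) s, where R=0 and C=C])
         (use that bd in \<open>auto intro!: rectpath_Cauchy[OF P] holomorphic_continuous_on_line[OF P]\<close>)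
    then show ?thesis by simp
  qed
  then show ?thesis using assms(4-) by (cases a b rule: linorder_cases) auto
qed

section \<open>The resolvent of a sectorial operator\<close>

locale sectorial_operator =
  fixes A :: "'a::complex_hilbert_space \<rightharpoonup> 'a" and \<omega> :: real
  assumes omega: "0 < \<omega>" "\<omega> < pi" and sectorial_A: "sectorial \<omega> A"
begin

abbreviation res :: "complex \<Rightarrow> 'a \<Rightarrow> 'a" where
  "res \<equiv> resolvent A"

lemma clinear_A:
  "A x = Some u \<Longrightarrow> A y = Some v \<Longrightarrow> A (x + y) = Some (u + v)"
  "A x = Some u \<Longrightarrow> A (c *\<^sub>C x) = Some (c *\<^sub>C u)"
  "A 0 = Some 0"
  using sectorial_A unfolding sectorial_def closed_operator_def clinear_operator_def by blast+

lemma bounded_linear_res: "z \<in> resolvent_set A \<Longrightarrow> bounded_linear (res z)"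
  by (simp add: resolvent_set_def)

lemma res_solves:
  assumes "z \<in> resolvent_set A"
  shows "A (res z x) = Some (z *\<^sub>C res z x - x)"
proof -
  have b: "bij_betw (\<lambda>x. z *\<^sub>C x - the (A x)) (dom A) UNIV"
    using assms by (simp add: resolvent_set_def)
  have d: "res z x \<in> dom A"
    unfolding resolvent_def using b by (metis UNIV_I bij_betw_imp_surj_on inv_into_into)
  have "z *\<^sub>C res z x - the (A (res z x)) = x"
    unfolding resolvent_def using b by (metis (no_types, lifting) UNIV_I bij_betw_inv_into_right)
  then have "the (A (res z x)) = z *\<^sub>C res z x - x" by (simp add: algebra_simps)
  with d show ?thesis by auto
qed

lemma res_inverts:
  assumes "z \<in> resolvent_set A" "A x = Some u"
  shows "res z (z *\<^sub>C x - u) = x"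
proof -
  have b: "bij_betw (\<lambda>x. z *\<^sub>C x - the (A x)) (dom A) UNIV"
    using assms by (simp add: resolvent_set_def)
  have "x \<in> dom A" using assms(2) by auto
  from bij_betw_inv_into_left[OF b this] show ?thesis
    unfolding resolvent_def using assms(2) by simp
qed

lemma res_scaleC:
  assumes "z \<in> resolvent_set A"
  shows "res z (c *\<^sub>C x) = c *\<^sub>C res z x"
  using res_inverts[OF assms clinear_A(2)[OF res_solves[OF assms, of x], of c]]
  by (simp add: scaleC_diff_right scaleC_scaleC mult.commute)

lemma res_add: "z \<in> resolvent_set A \<Longrightarrow> res z (x + y) = res z x + res z y"
  using bounded_linear_res bounded_linear.linear linear_add by blast

text \<open>
  Apply \<open>R(\<nu>, A)\<close> to \<open>(\<nu> - A) R(\<mu>, A) x = x + (\<nu> - \<mu>) R(\<mu>, A) x\<close>.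
\<close>

lemma resolvent_identity:
  assumes l: "\<nu> \<in> resolvent_set A" and m: "\<mu> \<in> resolvent_set A"
  shows "res \<nu> x - res \<mu> x = (\<mu> - \<nu>) *\<^sub>C res \<nu> (res \<mu> x)"
proof -
  have "\<nu> *\<^sub>C res \<mu> x - (\<mu> *\<^sub>C res \<mu> x - x) = x + (\<nu> - \<mu>) *\<^sub>C res \<mu> x"
    by (simp add: scaleC_diff_left)
  with res_inverts[OF l res_solves[OF m, of x]]
  have "res \<nu> x + (\<nu> - \<mu>) *\<^sub>C res \<nu> (res \<mu> x) = res \<mu> x"
    by (simp add: res_add[OF l] res_scaleC[OF l])
  then show ?thesis
    by (simp add: scaleC_diff_left algebra_simps)
qed

lemma in_resolvent_set:
  assumes "\<omega> \<le> \<theta>'" "\<theta>' \<le> pi" "Re z < cos \<theta>' * cmod z"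
  shows "z \<in> resolvent_set A"
proof -
  have "cos \<theta>' * cmod z \<le> cos \<omega> * cmod z"
    using assms omega by (intro mult_right_mono cos_monotone_0_pi_le) auto
  then have "z \<notin> closure (sector \<omega>)"
    using assms omega by (intro notin_closure_sector) auto
  then show ?thesis
    using sectorial_A unfolding sectorial_def spectrum_def by blast
qed

lemma res_bound:
  assumes "\<omega> < \<theta>'" "\<theta>' < pi"
  obtains K where "0 < K" "\<And>z x. Re z < cos \<theta>' * cmod z \<Longrightarrow> norm (z *\<^sub>C res z x) \<le> K * norm x"
proof -
  obtain K where K: "K > 0" "\<forall>z. z \<notin> closure (sector \<theta>') \<longrightarrow> onorm (\<lambda>x. z *\<^sub>C res z x) \<le> K"
    using sectorial_A assms unfolding sectorial_def by blast
  have "norm (z *\<^sub>C res z x) \<le> K * norm x" if z: "Re z < cos \<theta>' * cmod z" for z x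
  proof -
    have "bounded_linear (\<lambda>x. z *\<^sub>C res z x)"
      using in_resolvent_set[OF _ _ z] assms
      by (intro bounded_linear_compose[OF bounded_linear_scaleC bounded_linear_res]) auto
    then have "norm (z *\<^sub>C res z x) \<le> onorm (\<lambda>x. z *\<^sub>C res z x) * norm x" by (rule onorm)
    also have "\<dots> \<le> K * norm x"
      using K(2) notin_closure_sector[OF _ _ z] assms omega by (intro mult_right_mono) auto
    finally show ?thesis .
  qed
  with K(1) show ?thesis by (rule that)
qed

lemma res_bound_norm:
  assumes "\<omega> < \<theta>'" "\<theta>' < pi"
  obtains K where "0 < K" "\<And>z x. Re z < cos \<theta>' * cmod z \<Longrightarrow> norm (res z x) \<le> K / cmod z * norm x"
proof -
  obtain K where K: "0 < K" "\<And>z x. Re z < cos \<theta>' * cmod z \<Longrightarrow> norm (z *\<^sub>C res z x) \<le> K * norm x"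
    using res_bound[OF assms] by blast
  have "norm (res z x) \<le> K / cmod z * norm x" if z: "Re z < cos \<theta>' * cmod z" for z x
  proof -
    have "z \<noteq> 0" using z by auto
    then show ?thesis
      using K(2)[OF z, of x] by (simp add: norm_scaleC field_simps)
  qed
  with K(1) show ?thesis by (rule that)
qed

lemma open_cone_complement: "open {z. Re z < cos t * cmod z}"
  by (intro open_Collect_less continuous_intros)

text \<open>
  The difference of two resolvents is controlled by the resolvent identity, together with the bound
  \<open>K/\<bar>z\<bar>\<close> that sectoriality provides locally uniformly.
\<close>

lemma res_continuous:
  assumes "\<omega> < \<theta>'" "\<theta>' < pi"
  shows "continuous_on {z. Re z < cos \<theta>' * cmod z} (\<lambda>z. res z x)"
proof -
  let ?W = "{z. Re z < cos \<theta>' * cmod z}"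
  obtain K where K: "0 < K" "\<And>z x. Re z < cos \<theta>' * cmod z \<Longrightarrow> norm (res z x) \<le> K / cmod z * norm x"
    using res_bound_norm[OF assms] by blast
  have rs: "z \<in> resolvent_set A" if "z \<in> ?W" for z
    using in_resolvent_set[of \<theta>' z] that assms by simp
  show ?thesis
    unfolding continuous_on
  proof
    fix w assume w: "w \<in> ?W"
    then have w0: "w \<noteq> 0" by auto
    show "((\<lambda>z. res z x) \<longlongrightarrow> res w x) (at w within ?W)"
    proof (rule LIM_zero_cancel, rule Lim_null_comparison)
      show "eventually (\<lambda>z. norm (res z x - res w x) \<le> cmod (w - z) * (K / cmod z * norm (res w x))) (at w within ?W)"
        unfolding eventually_at_topological
      proof (intro exI[of _ UNIV] conjI ballI impI)
        fix z assume z: "z \<in> ?W"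
        have "norm (res z x - res w x) = cmod (w - z) * norm (res z (res w x))"
          using resolvent_identity[OF rs[OF z] rs[OF w], of x] by (simp add: norm_scaleC)
        also have "\<dots> \<le> cmod (w - z) * (K / cmod z * norm (res w x))"
          using K(2)[of z "res w x"] z by (intro mult_left_mono) auto
        finally show "norm (res z x - res w x) \<le> cmod (w - z) * (K / cmod z * norm (res w x))" .
      qed auto
      have "((\<lambda>z. cmod (w - z) * (K / cmod z * norm (res w x))) \<longlongrightarrow> cmod (w - w) * (K / cmod w * norm (res w x))) (at w within ?W)"
        by (intro tendsto_intros) (use w0 in auto)
      then show "((\<lambda>z. cmod (w - z) * (K / cmod z * norm (res w x))) \<longlongrightarrow> 0) (at w within ?W)"
        by simp
    qed
  qed
qed

lemma res_holomorphic:
  assumes "\<omega> < \<theta>'" "\<theta>' < pi"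
  shows "(\<lambda>z. cinner (res z x) y) holomorphic_on {z. Re z < cos \<theta>' * cmod z}"
proof -
  let ?W = "{z. Re z < cos \<theta>' * cmod z}"
  have rs: "z \<in> resolvent_set A" if "z \<in> ?W" for z
    using in_resolvent_set[of \<theta>' z] that assms by simp
  have "((\<lambda>z. cinner (res z x) y) has_field_derivative - cinner (res w (res w x)) y) (at w)" if w: "w \<in> ?W" for w
  proof -
    have "((\<lambda>z. cinner (res z (res w x)) y) \<longlongrightarrow> cinner (res w (res w x)) y) (at w)"
    proof -
      have "isCont (\<lambda>z. res z (res w x)) w"
        using continuous_on_interior[OF res_continuous[OF assms]] w
        by (simp add: interior_open[OF open_cone_complement])
      then show ?thesis
        by (intro bounded_linear.tendsto[OF bounded_linear_cinner_left]) (simp add: isCont_def)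
    qed
    then have lim: "((\<lambda>z. - cinner (res z (res w x)) y) \<longlongrightarrow> - cinner (res w (res w x)) y) (at w)"
      by (rule tendsto_minus)
    have "eventually (\<lambda>z. z \<in> ?W) (at w)"
      using w open_cone_complement by (intro eventually_at_in_open') auto
    then have "eventually (\<lambda>z. - cinner (res z (res w x)) y =
        (cinner (res z x) y - cinner (res w x) y) / (z - w)) (at w)"
      using eventually_neq_at_within[of w w UNIV]
    proof eventually_elim
      case (elim z)
      have "cinner (res z x) y - cinner (res w x) y = (w - z) * cinner (res z (res w x)) y"
        using resolvent_identity[OF rs[OF elim(1)] rs[OF w], of x]
        by (simp add: cinner_diff_left[symmetric] cinner_scaleC_left)
      with elim(2) show ?case by (simp add: field_simps)
    qed
    with lim show ?thesis
      unfolding has_field_derivative_iff by (rule Lim_transform_eventually)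
  qed
  then show ?thesis
    by (subst holomorphic_on_open[OF open_cone_complement]) auto
qed

text \<open>
  The integrand of the functional calculus in logarithmic coordinates, tested against a vector.
  The factor \<open>e\<^sup>\<zeta>\<close> comes from \<open>d\<lambda> = e\<^sup>\<zeta> d\<zeta>\<close> and makes the pairing bounded.
\<close>

definition res_pair :: "'a \<Rightarrow> 'a \<Rightarrow> complex \<Rightarrow> complex" where
  "res_pair x y \<zeta> = exp \<zeta> * cinner (res (exp \<zeta>) x) y"

lemma exp_in_cone_complement: "cos (Im \<zeta>) < cos t \<Longrightarrow> exp \<zeta> \<in> {z. Re z < cos t * cmod z}"
  by (simp add: Re_exp mult.commute)

lemma res_pair_holomorphic:
  assumes "\<omega> < \<theta>'" "\<theta>' < pi" "\<And>\<zeta>. \<zeta> \<in> S \<Longrightarrow> cos (Im \<zeta>) < cos \<theta>'"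
  shows "res_pair x y holomorphic_on S"
proof -
  have "((\<lambda>z. cinner (res z x) y) \<circ> exp) holomorphic_on S"
    by (rule holomorphic_on_compose_gen[OF _ res_holomorphic[OF assms(1,2)]])
       (use exp_in_cone_complement[OF assms(3)] in \<open>auto intro!: holomorphic_intros\<close>)
  then show ?thesis
    unfolding res_pair_def comp_def by (intro holomorphic_intros)
qed

lemma res_pair_bound:
  assumes "\<omega> < \<theta>'" "\<theta>' < pi"
  obtains K where "0 < K"
    "\<And>\<zeta> x y. cos (Im \<zeta>) < cos \<theta>' \<Longrightarrow> cmod (res_pair x y \<zeta>) \<le> K * norm x * norm y"
proof -
  obtain K where K: "0 < K" "\<And>z x. Re z < cos \<theta>' * cmod z \<Longrightarrow> norm (z *\<^sub>C res z x) \<le> K * norm x"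
    using res_bound[OF assms] by blast
  have "cmod (res_pair x y \<zeta>) \<le> K * norm x * norm y" if "cos (Im \<zeta>) < cos \<theta>'" for x y \<zeta>
  proof -
    have "res_pair x y \<zeta> = cinner (exp \<zeta> *\<^sub>C res (exp \<zeta>) x) y"
      by (simp add: res_pair_def cinner_scaleC_left)
    then have "cmod (res_pair x y \<zeta>) \<le> norm (exp \<zeta> *\<^sub>C res (exp \<zeta>) x) * norm y"
      by (simp add: norm_cinner_le)
    also have "\<dots> \<le> K * norm x * norm y"
      using K(2)[of "exp \<zeta>" x] exp_in_cone_complement[OF that] by (intro mult_right_mono) auto
    finally show ?thesis .
  qed
  with K(1) show ?thesis by (rule that)
qed

end

section \<open>The contour integral in logarithmic coordinates\<close>

text \<open>
  The substitutions \<open>t = e\<^sup>s\<close> and \<open>t = - e\<^sup>s\<close> on the two half-lines. The weight \<open>1/t\<close> changes its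
  sign with \<open>t\<close>, which accounts for the opposite orientations of the two rays of the contour.
\<close>

lemma log_substitution:
  fixes \<Phi>1 \<Phi>2 :: "real \<Rightarrow> 'b::euclidean_space"
  assumes "integrable lborel \<Phi>1" "integrable lborel \<Phi>2"
  shows "((\<lambda>t. (1 / t) *\<^sub>R (if t > 0 then \<Phi>1 (ln t) else \<Phi>2 (ln (- t)))) has_integral
           ((\<integral>s. \<Phi>1 s \<partial>lborel) - (\<integral>s. \<Phi>2 s \<partial>lborel))) UNIV"
proof -
  have abs: "\<Phi> absolutely_integrable_on UNIV \<and> integral UNIV \<Phi> = (\<integral>s. \<Phi> s \<partial>lborel)"
    if "integrable lborel \<Phi>" for \<Phi> :: "real \<Rightarrow> 'b"
    using that integral_lborel[OF that]
    by (simp add: set_integrable_def integrable_completion borel_measurable_integrable)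
  define F1 where "F1 t = (1 / t) *\<^sub>R \<Phi>1 (ln t)" for t
  define F2 where "F2 t = (1 / t) *\<^sub>R \<Phi>2 (ln (- t))" for t
  have r1: "range exp = {0::real<..}"
  proof -
    have "t \<in> range exp" if "0 < t" for t :: real using exp_ln[OF that] by (metis rangeI)
    then show ?thesis by auto
  qed
  have r2: "range (\<lambda>s. - exp s) = {..<0::real}"
  proof -
    have "range (\<lambda>s. - exp s) = uminus ` range (exp :: real \<Rightarrow> real)" by auto
    then show ?thesis unfolding r1 by (simp add: image_uminus_greaterThan)
  qed
  have "F1 absolutely_integrable_on range exp \<and> integral (range exp) F1 = (\<integral>s. \<Phi>1 s \<partial>lborel)"
    by (subst has_absolute_integral_change_of_variables_real[symmetric, where h=exp])
       (use abs[OF assms(1)] in \<open>auto simp: F1_def intro!: derivative_eq_intros inj_onI\<close>)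
  then have "(F1 has_integral (\<integral>s. \<Phi>1 s \<partial>lborel)) {0<..}"
    unfolding r1 using set_lebesgue_integral_eq_integral(1) integrable_integral by metis
  then have 1: "((\<lambda>t. if t \<in> {0<..} then F1 t else 0) has_integral (\<integral>s. \<Phi>1 s \<partial>lborel)) UNIV"
    by (subst has_integral_restrict_UNIV)
  have "F2 absolutely_integrable_on range (\<lambda>s. - exp s) \<and> integral (range (\<lambda>s. - exp s)) F2 = - (\<integral>s. \<Phi>2 s \<partial>lborel)"
    by (subst has_absolute_integral_change_of_variables_real[symmetric, where h="\<lambda>s. - exp s"])
       (use abs[of "\<lambda>s. - \<Phi>2 s"] assms(2) in \<open>auto simp: F2_def intro!: derivative_eq_intros inj_onI\<close>)
  then have "(F2 has_integral - (\<integral>s. \<Phi>2 s \<partial>lborel)) {..<0}"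
    unfolding r2 using set_lebesgue_integral_eq_integral(1) integrable_integral by metis
  then have 2: "((\<lambda>t. if t \<in> {..<0} then F2 t else 0) has_integral - (\<integral>s. \<Phi>2 s \<partial>lborel)) UNIV"
    by (subst has_integral_restrict_UNIV)
  have eq: "(\<lambda>t. (if t \<in> {0<..} then F1 t else 0) + (if t \<in> {..<0} then F2 t else 0)) =
      (\<lambda>t. (1 / t) *\<^sub>R (if t > 0 then \<Phi>1 (ln t) else \<Phi>2 (ln (- t))))"
    by (auto simp: F1_def F2_def fun_eq_iff)
  show ?thesis
    using has_integral_add[OF 1 2] unfolding eq diff_conv_add_uminus .
qed

lemma sector_contour_exp:
  "0 < t \<Longrightarrow> sector_contour \<gamma> t = exp (Complex (ln t) (- \<gamma>))"
  "t < 0 \<Longrightarrow> sector_contour \<gamma> t = exp (Complex (ln (- t)) \<gamma>)"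
proof -
  have "exp (Complex a b) = complex_of_real (exp a) * exp (\<i> * complex_of_real b)" for a b
    by (simp add: Complex_eq exp_add exp_of_real)
  then show "0 < t \<Longrightarrow> sector_contour \<gamma> t = exp (Complex (ln t) (- \<gamma>))"
    "t < 0 \<Longrightarrow> sector_contour \<gamma> t = exp (Complex (ln (- t)) \<gamma>)"
    by (simp_all add: sector_contour_def)
qed

lemma vector_derivative_sector_contour:
  assumes "t \<noteq> 0"
  shows "vector_derivative (sector_contour \<gamma>) (at t) = sector_contour \<gamma> t / complex_of_real t"
proof (cases "0 < t")
  case True
  have "((\<lambda>t. complex_of_real t * exp (- \<i> * complex_of_real \<gamma>)) has_vector_derivative
      exp (- \<i> * complex_of_real \<gamma>)) (at t)"
    by (auto intro!: derivative_eq_intros)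
  then have "(sector_contour \<gamma> has_vector_derivative exp (- \<i> * complex_of_real \<gamma>)) (at t)"
    by (rule has_vector_derivative_transform_within_open[where S="{0<..}"])
       (use True in \<open>auto simp: sector_contour_def\<close>)
  then show ?thesis
    using True by (simp add: vector_derivative_at sector_contour_def)
next
  case False
  have "((\<lambda>t. - complex_of_real t * exp (\<i> * complex_of_real \<gamma>)) has_vector_derivative
      - exp (\<i> * complex_of_real \<gamma>)) (at t)"
    by (auto intro!: derivative_eq_intros)
  then have "(sector_contour \<gamma> has_vector_derivative - exp (\<i> * complex_of_real \<gamma>)) (at t)"
    by (rule has_vector_derivative_transform_within_open[where S="{..<0}"])
       (use False assms in \<open>auto simp: sector_contour_def\<close>)
  then show ?thesis
    using False assms by (simp add: vector_derivative_at sector_contour_def)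
qed

lemma continuous_sector_contour: "continuous_on S (sector_contour \<gamma>)"
proof -
  have "continuous_on UNIV (\<lambda>t. if t \<le> 0 then - complex_of_real t * exp (\<i> * complex_of_real \<gamma>)
      else complex_of_real t * exp (- \<i> * complex_of_real \<gamma>))"
    by (rule continuous_on_cases_le[where h="\<lambda>t. t"]) (auto intro!: continuous_intros)
  then show ?thesis
    unfolding sector_contour_def[abs_def] by (rule continuous_on_subset) auto
qed

lemma cmod_sector_contour: "cmod (sector_contour \<gamma> t) = \<bar>t\<bar>"
  by (simp add: sector_contour_def norm_mult)

lemma sector_contour_in_sector:
  assumes "t \<noteq> 0" "0 \<le> \<gamma>" "\<gamma> < \<delta>" "\<delta> \<le> pi"
  shows "sector_contour \<gamma> t \<in> sector \<delta>"
proof (cases "0 < t")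
  case True
  then show ?thesis using assms by (simp add: sector_contour_exp exp_in_sector)
next
  case False
  then have "t < 0" using assms by simp
  then show ?thesis using assms by (simp add: sector_contour_exp exp_in_sector)
qed

lemma Re_sector_contour_less:
  assumes "t \<noteq> 0" "0 \<le> \<theta>'" "\<theta>' < \<gamma>" "\<gamma> \<le> pi"
  shows "Re (sector_contour \<gamma> t) < cos \<theta>' * cmod (sector_contour \<gamma> t)"
proof -
  have c: "cos \<gamma> < cos \<theta>'" using assms by (intro cos_monotone_0_pi) auto
  show ?thesis
  proof (cases "0 < t")
    case True
    then show ?thesis using c by (simp add: sector_contour_exp Re_exp)
  next
    case False
    then have "t < 0" using assms by simp
    then show ?thesis using c by (simp add: sector_contour_exp Re_exp)
  qed
qed

text \<open>
  In logarithmic coordinates the boundary of the sector consists of two horizontal lines. For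
  \<open>\<Psi>(\<zeta>) = f(e\<^sup>\<zeta>) e\<^sup>\<zeta> L (R(e\<^sup>\<zeta>, A) x)\<close> with a linear functional \<open>L\<close>, this is the value
  \<open>L (f(A)x)\<close> (\<open>functional_calc\<close>).
\<close>

definition sector_integral :: "real \<Rightarrow> (complex \<Rightarrow> complex) \<Rightarrow> complex" where
  "sector_integral \<gamma> \<Psi> = (line_integral (- \<gamma>) \<Psi> - line_integral \<gamma> \<Psi>) / (2 * complex_of_real pi * \<i>)"

lemma sector_decay_exp:
  assumes "sector_decay \<delta> s c f" "\<delta> \<le> pi"
  shows "(\<lambda>\<zeta>. f (exp \<zeta>)) holomorphic_on {\<zeta>. - \<delta> < Im \<zeta> \<and> Im \<zeta> < \<delta>}"
    and "\<And>\<zeta>. - \<delta> < Im \<zeta> \<Longrightarrow> Im \<zeta> < \<delta> \<Longrightarrow> cmod (f (exp \<zeta>)) \<le> c * exp (- s * \<bar>Re \<zeta>\<bar>)"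
proof -
  have "f \<circ> exp holomorphic_on {\<zeta>. - \<delta> < Im \<zeta> \<and> Im \<zeta> < \<delta>}"
    by (rule holomorphic_on_compose_gen[where t="sector \<delta>"])
       (use assms exp_in_sector in \<open>auto simp: sector_decay_def intro!: holomorphic_intros\<close>)
  then show "(\<lambda>\<zeta>. f (exp \<zeta>)) holomorphic_on {\<zeta>. - \<delta> < Im \<zeta> \<and> Im \<zeta> < \<delta>}"
    by (simp add: comp_def)
  fix \<zeta> assume "- \<delta> < Im \<zeta>" "Im \<zeta> < \<delta>"
  then have "exp \<zeta> \<in> sector \<delta>" using assms(2) by (intro exp_in_sector) auto
  then show "cmod (f (exp \<zeta>)) \<le> c * exp (- s * \<bar>Re \<zeta>\<bar>)"
    using assms(1) by (fastforce simp: sector_decay_def)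
qed

lemma sector_decay_mult:
  assumes "sector_decay \<delta> s c f" "g holomorphic_on sector \<delta>" "\<And>z. z \<in> sector \<delta> \<Longrightarrow> cmod (g z) \<le> M" "0 \<le> M"
  shows "sector_decay \<delta> s (c * M) (\<lambda>z. g z * f z)"
proof -
  have "cmod (g z * f z) \<le> c * M * exp (- s * \<bar>ln (cmod z)\<bar>)" if z: "z \<in> sector \<delta>" for z
  proof -
    have "cmod (f z) \<le> c * exp (- s * \<bar>ln (cmod z)\<bar>)" using assms(1) z by (simp add: sector_decay_def)
    then have "cmod (g z) * cmod (f z) \<le> M * (c * exp (- s * \<bar>ln (cmod z)\<bar>))"
      using assms z by (intro mult_mono) auto
    then show ?thesis by (simp add: norm_mult mult_ac)
  qed
  then show ?thesis
    using assms by (auto simp: sector_decay_def intro!: holomorphic_intros)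
qed

lemma sector_decay_bounded:
  assumes "sector_decay \<delta> s c f" "z \<in> sector \<delta>"
  shows "cmod (f z) \<le> c"
proof -
  have "cmod (f z) \<le> c * exp (- s * \<bar>ln (cmod z)\<bar>)" using assms by (simp add: sector_decay_def)
  also have "\<dots> \<le> c * 1" using assms by (intro mult_left_mono) (auto simp: sector_decay_def)
  finally show ?thesis by simp
qed

lemma sector_decay_mult_decay:
  assumes "sector_decay \<delta> s c f" "sector_decay \<delta> s' c' g"
  shows "sector_decay \<delta> s (c * c') (\<lambda>z. g z * f z)"
  using assms(2) by (intro sector_decay_mult[OF assms(1)] sector_decay_bounded[OF assms(2)])
     (auto simp: sector_decay_def)

lemma sector_decay_diff:
  assumes "sector_decay \<delta> s c f" "sector_decay \<delta> s c' g"
  shows "sector_decay \<delta> s (c + c') (\<lambda>z. f z - g z)"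
proof -
  have "cmod (f z - g z) \<le> (c + c') * exp (- s * \<bar>ln (cmod z)\<bar>)" if z: "z \<in> sector \<delta>" for z
  proof -
    have "cmod (f z) \<le> c * exp (- s * \<bar>ln (cmod z)\<bar>)" "cmod (g z) \<le> c' * exp (- s * \<bar>ln (cmod z)\<bar>)"
      using assms z by (simp_all add: sector_decay_def)
    then show ?thesis
      using norm_triangle_ineq4[of "f z" "g z"] by (simp add: distrib_right)
  qed
  then show ?thesis
    using assms by (auto simp: sector_decay_def intro!: holomorphic_intros)
qed

text \<open>
  The decay is in \<open>\<bar>ln \<bar>z\<bar>\<bar>\<close>, and a dilation by \<open>w\<close> shifts \<open>ln \<bar>z\<bar>\<close> by \<open>ln \<bar>w\<bar>\<close>.
\<close>

lemma sector_decay_dilate: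
  assumes F: "sector_decay \<theta> s c F" and w: "w \<in> sector a" and "a + \<delta> \<le> \<theta>" "\<theta> \<le> pi"
  shows "sector_decay \<delta> s (c * exp (s * \<bar>ln (cmod w)\<bar>)) (\<lambda>z. F (w * z))"
proof -
  have sub: "w * z \<in> sector \<theta>" if "z \<in> sector \<delta>" for z
    using sector_mult[OF w that] sector_mono[OF assms(3)] assms by auto
  have "cmod (F (w * z)) \<le> c * exp (s * \<bar>ln (cmod w)\<bar>) * exp (- s * \<bar>ln (cmod z)\<bar>)" if z: "z \<in> sector \<delta>" for z
  proof -
    have nz: "cmod w > 0" "cmod z > 0" using w z by (auto dest: sector_nonzero)
    have s: "s > 0" "c \<ge> 0" using F by (auto simp: sector_decay_def)
    have "cmod (F (w * z)) \<le> c * exp (- s * \<bar>ln (cmod (w * z))\<bar>)"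
      using F sub[OF z] by (simp add: sector_decay_def)
    also have "ln (cmod (w * z)) = ln (cmod w) + ln (cmod z)"
      using nz by (simp add: norm_mult ln_mult)
    also have "c * exp (- s * \<bar>ln (cmod w) + ln (cmod z)\<bar>) \<le> c * exp (s * \<bar>ln (cmod w)\<bar> + - s * \<bar>ln (cmod z)\<bar>)"
    proof -
      have "s * \<bar>ln (cmod z)\<bar> \<le> s * (\<bar>ln (cmod w)\<bar> + \<bar>ln (cmod w) + ln (cmod z)\<bar>)"
        using s by (intro mult_left_mono) auto
      then show ?thesis using s by (intro mult_left_mono) (auto simp: algebra_simps)
    qed
    also have "\<dots> = c * exp (s * \<bar>ln (cmod w)\<bar>) * exp (- s * \<bar>ln (cmod z)\<bar>)"
      by (simp only: exp_add mult.assoc)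
    finally show ?thesis .
  qed
  moreover have "(\<lambda>z. F (w * z)) holomorphic_on sector \<delta>"
  proof -
    have "F \<circ> (\<lambda>z. w * z) holomorphic_on sector \<delta>"
      by (rule holomorphic_on_compose_gen[where t="sector \<theta>"])
         (use F sub in \<open>auto simp: sector_decay_def intro!: holomorphic_intros\<close>)
    then show ?thesis by (simp add: comp_def)
  qed
  ultimately show ?thesis using F by (auto simp: sector_decay_def)
qed

context sectorial_operator
begin

abbreviation calc :: "real \<Rightarrow> (complex \<Rightarrow> complex) \<Rightarrow> 'a \<Rightarrow> 'a" where
  "calc \<equiv> contour_calc A"

definition calc_integrand :: "real \<Rightarrow> (complex \<Rightarrow> complex) \<Rightarrow> 'a \<Rightarrow> real \<Rightarrow> 'a" where
  "calc_integrand \<gamma> f x t = (f (sector_contour \<gamma> t) * vector_derivative (sector_contour \<gamma>) (at t)) *\<^sub>C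
       res (sector_contour \<gamma> t) x"

lemma calc_eq: "calc \<gamma> f x = (1 / (2 * complex_of_real pi * \<i>)) *\<^sub>C integral UNIV (calc_integrand \<gamma> f x)"
  by (simp add: contour_calc_def calc_integrand_def[abs_def])

lemma calc_integrand_integrable:
  assumes f: "sector_decay \<delta> s c f" and g: "\<omega> < \<gamma>" "\<gamma> < \<delta>" "\<delta> \<le> pi"
  shows "calc_integrand \<gamma> f x integrable_on UNIV"
proof -
  define \<theta>' where "\<theta>' = (\<omega> + \<gamma>) / 2"
  have t': "\<omega> < \<theta>'" "\<theta>' < \<gamma>" "\<theta>' < pi" "0 \<le> \<theta>'" using g omega by (auto simp: \<theta>'_def)
  have s: "s > 0" "c \<ge> 0" using f by (auto simp: sector_decay_def)
  let ?W = "{z. Re z < cos \<theta>' * cmod z}"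
  have inW: "sector_contour \<gamma> t \<in> ?W" if "t \<noteq> 0" for t
    using Re_sector_contour_less[OF that t'(4,2)] g by simp
  have inS: "sector_contour \<gamma> t \<in> sector \<delta>" if "t \<noteq> 0" for t
    using sector_contour_in_sector[OF that _ g(2,3)] g omega by simp
  obtain K where K: "0 < K" "\<And>z x. Re z < cos \<theta>' * cmod z \<Longrightarrow> norm (z *\<^sub>C res z x) \<le> K * norm x"
    using res_bound[OF t'(1,3)] by blast
  define B where "B = K * norm x * c"
  have int: "integrable lborel (\<lambda>u. B * exp (- s * \<bar>u\<bar>))"
    by (intro integrable_mult_right integrable_exp_abs s)
  show ?thesis
  proof (rule dominated_punctured_integrable_on)
    show "continuous_on (- {0}) (calc_integrand \<gamma> f x)"
    proof -
      have "continuous_on (- {0}) (\<lambda>t. (f (sector_contour \<gamma> t) * (sector_contour \<gamma> t / complex_of_real t)) *\<^sub>C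
         res (sector_contour \<gamma> t) x)"
      proof (intro bounded_bilinear.continuous_on[OF bounded_bilinear_scaleC] continuous_on_mult)
        show "continuous_on (- {0}) (\<lambda>t. f (sector_contour \<gamma> t))"
          by (rule continuous_on_compose2[of "sector \<delta>" f])
             (use f inS in \<open>auto simp: sector_decay_def holomorphic_on_imp_continuous_on continuous_sector_contour\<close>)
        show "continuous_on (- {0}) (\<lambda>t. sector_contour \<gamma> t / complex_of_real t)"
          by (intro continuous_intros continuous_sector_contour) auto
        show "continuous_on (- {0}) (\<lambda>t. res (sector_contour \<gamma> t) x)"
          by (rule continuous_on_compose2[OF res_continuous[OF t'(1,3)] continuous_sector_contour])
             (use inW in auto)
      qed
      then show ?thesis
        by (rule continuous_on_eq) (simp add: calc_integrand_def vector_derivative_sector_contour)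
    qed
    show "(\<lambda>t. (1 / t) *\<^sub>R (if t > 0 then B * exp (- s * \<bar>ln t\<bar>) else - (B * exp (- s * \<bar>ln (- t)\<bar>)))) integrable_on UNIV"
      by (rule has_integral_integrable[OF log_substitution[OF int Bochner_Integration.integrable_minus[OF int]]])
    show "norm (calc_integrand \<gamma> f x t) \<le> (1 / t) *\<^sub>R (if t > 0 then B * exp (- s * \<bar>ln t\<bar>) else - (B * exp (- s * \<bar>ln (- t)\<bar>)))"
      if t: "t \<noteq> 0" for t
    proof -
      let ?z = "sector_contour \<gamma> t"
      have "calc_integrand \<gamma> f x t = (f ?z / complex_of_real t) *\<^sub>C (?z *\<^sub>C res ?z x)"
        using t by (simp add: calc_integrand_def vector_derivative_sector_contour scaleC_scaleC)
      then have "norm (calc_integrand \<gamma> f x t) = cmod (f ?z) / \<bar>t\<bar> * norm (?z *\<^sub>C res ?z x)"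
        by (simp add: norm_scaleC norm_divide)
      also have "\<dots> \<le> (c * exp (- s * \<bar>ln \<bar>t\<bar>\<bar>)) / \<bar>t\<bar> * (K * norm x)"
      proof (intro mult_mono divide_right_mono)
        show "cmod (f ?z) \<le> c * exp (- s * \<bar>ln \<bar>t\<bar>\<bar>)"
          using f inS[OF t] by (auto simp: sector_decay_def cmod_sector_contour)
        show "norm (?z *\<^sub>C res ?z x) \<le> K * norm x" using K(2) inW[OF t] by simp
      qed (use s in auto)
      also have "\<dots> = (1 / t) *\<^sub>R (if t > 0 then B * exp (- s * \<bar>ln t\<bar>) else - (B * exp (- s * \<bar>ln (- t)\<bar>)))"
        using t by (auto simp: B_def abs_if)
      finally show ?thesis .
    qed
  qed
qed

text \<open>
  All scalar information about \<open>f(A)x\<close> comes from the following formula, which replaces the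
  vector-valued gauge integral by two Lebesgue integrals over horizontal lines.
\<close>

lemma functional_calc:
  assumes f: "sector_decay \<delta> s c f" and g: "\<omega> < \<gamma>" "\<gamma> < \<delta>" "\<delta> \<le> pi"
    and L: "bounded_linear L" and Lc: "\<And>a x. L (a *\<^sub>C x) = a * L x"
  shows "L (calc \<gamma> f x) = sector_integral \<gamma> (\<lambda>\<zeta>. f (exp \<zeta>) * (exp \<zeta> * L (res (exp \<zeta>) x)))"
    and "\<And>y. \<bar>y\<bar> = \<gamma> \<Longrightarrow> integrable lborel (\<lambda>t. f (exp (Complex t y)) * (exp (Complex t y) * L (res (exp (Complex t y)) x)))"
proof -
  define \<Psi> where "\<Psi> = (\<lambda>\<zeta>. f (exp \<zeta>) * (exp \<zeta> * L (res (exp \<zeta>) x)))"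
  define \<theta>' where "\<theta>' = (\<omega> + \<gamma>) / 2"
  have t': "\<omega> < \<theta>'" "\<theta>' < \<gamma>" "\<theta>' < pi" "0 \<le> \<theta>'" using g omega by (auto simp: \<theta>'_def)
  have s: "s > 0" "c \<ge> 0" using f by (auto simp: sector_decay_def)
  let ?W = "{z. Re z < cos \<theta>' * cmod z}"
  obtain K where K: "0 < K" "\<And>z x. Re z < cos \<theta>' * cmod z \<Longrightarrow> norm (z *\<^sub>C res z x) \<le> K * norm x"
    using res_bound[OF t'(1,3)] by blast
  obtain M where M: "M > 0" "\<And>x. cmod (L x) \<le> norm x * M" using bounded_linear.pos_bounded[OF L] by blast
  have line: "integrable lborel (\<lambda>t. \<Psi> (Complex t y))" if y: "\<bar>y\<bar> = \<gamma>" for y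
  proof (rule tail_decay_integrable[where R=0, OF _ s(1)])
    have cosy: "cos y < cos \<theta>'"
      by (rule cos_less_of_abs) (use y t' g in auto)
    have inW: "exp (Complex t y) \<in> ?W" for t using exp_in_cone_complement[of "Complex t y" \<theta>'] cosy by simp
    have cline: "continuous_on UNIV (\<lambda>t. Complex t y)"
      by (simp add: Complex_eq continuous_intros)
    show "continuous_on UNIV (\<lambda>t. \<Psi> (Complex t y))"
      unfolding \<Psi>_def
    proof (intro continuous_on_mult)
      show "continuous_on UNIV (\<lambda>t. f (exp (Complex t y)))"
        by (rule holomorphic_continuous_on_line[OF sector_decay_exp(1)[OF f g(3)]]) (use y g in auto)
      show "continuous_on UNIV (\<lambda>t. exp (Complex t y))" by (intro continuous_intros cline)
      then have "continuous_on UNIV (\<lambda>t. res (exp (Complex t y)) x)"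
        by (rule continuous_on_compose2[OF res_continuous[OF t'(1,3)]]) (use inW in auto)
      then show "continuous_on UNIV (\<lambda>t. L (res (exp (Complex t y)) x))"
        by (rule bounded_linear.continuous_on[OF L])
    qed
    show "cmod (\<Psi> (Complex t y)) \<le> (c * (K * norm x * M)) * exp (- s * \<bar>t\<bar>)" for t
    proof -
      let ?z = "exp (Complex t y)"
      have "\<Psi> (Complex t y) = f ?z * L (?z *\<^sub>C res ?z x)" by (simp add: \<Psi>_def Lc)
      then have "cmod (\<Psi> (Complex t y)) = cmod (f ?z) * cmod (L (?z *\<^sub>C res ?z x))" by (simp add: norm_mult)
      also have "\<dots> \<le> (c * exp (- s * \<bar>t\<bar>)) * (K * norm x * M)"
      proof (rule mult_mono)
        show "cmod (f ?z) \<le> c * exp (- s * \<bar>t\<bar>)"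
          using sector_decay_exp(2)[OF f g(3), of "Complex t y"] y g by auto
        show "cmod (L (?z *\<^sub>C res ?z x)) \<le> K * norm x * M"
        proof (rule order_trans[OF M(2)])
          show "norm (?z *\<^sub>C res ?z x) * M \<le> K * norm x * M"
            using K(2)[of ?z x] inW[of t] M(1) by (intro mult_right_mono) auto
        qed
      qed (use s in auto)
      finally show ?thesis by (simp add: mult_ac)
    qed
  qed
  then show "\<And>y. \<bar>y\<bar> = \<gamma> \<Longrightarrow> integrable lborel (\<lambda>t. f (exp (Complex t y)) * (exp (Complex t y) * L (res (exp (Complex t y)) x)))"
    by (simp add: \<Psi>_def)
  have g0: "0 \<le> \<gamma>" using g omega by simp
  have "((\<lambda>t. (1 / t) *\<^sub>R (if t > 0 then \<Psi> (Complex (ln t) (- \<gamma>)) else \<Psi> (Complex (ln (- t)) \<gamma>)))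
      has_integral (line_integral (- \<gamma>) \<Psi> - line_integral \<gamma> \<Psi>)) UNIV"
    unfolding line_integral_def by (intro log_substitution line) (use g0 in auto)
  then have "((L \<circ> calc_integrand \<gamma> f x) has_integral (line_integral (- \<gamma>) \<Psi> - line_integral \<gamma> \<Psi>)) UNIV"
  proof (rule has_integral_spike[of "{0}", rotated 2])
    fix t :: real assume "t \<in> UNIV - {0}"
    then have t: "t \<noteq> 0" by simp
    let ?z = "sector_contour \<gamma> t"
    have "L (calc_integrand \<gamma> f x t) = (1 / t) *\<^sub>R (f ?z * (?z * L (res ?z x)))"
      using t by (simp add: calc_integrand_def vector_derivative_sector_contour Lc scaleR_conv_of_real divide_simps)
    moreover have "f ?z * (?z * L (res ?z x)) = (if t > 0 then \<Psi> (Complex (ln t) (- \<gamma>)) else \<Psi> (Complex (ln (- t)) \<gamma>))"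
      using t by (auto simp: sector_contour_exp \<Psi>_def)
    ultimately show "(L \<circ> calc_integrand \<gamma> f x) t =
        (1 / t) *\<^sub>R (if t > 0 then \<Psi> (Complex (ln t) (- \<gamma>)) else \<Psi> (Complex (ln (- t)) \<gamma>))" by simp
  qed auto
  then have "integral UNIV (L \<circ> calc_integrand \<gamma> f x) = line_integral (- \<gamma>) \<Psi> - line_integral \<gamma> \<Psi>"
    by (rule integral_unique)
  then have "L (integral UNIV (calc_integrand \<gamma> f x)) = line_integral (- \<gamma>) \<Psi> - line_integral \<gamma> \<Psi>"
    using integral_linear[OF calc_integrand_integrable[OF f g, of x] L] by (simp only:)
  then show "L (calc \<gamma> f x) = sector_integral \<gamma> (\<lambda>\<zeta>. f (exp \<zeta>) * (exp \<zeta> * L (res (exp \<zeta>) x)))"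
    unfolding calc_eq Lc sector_integral_def \<Psi>_def by simp
qed

lemma cinner_calc:
  assumes "sector_decay \<delta> s c f" "\<omega> < \<gamma>" "\<gamma> < \<delta>" "\<delta> \<le> pi"
  shows "cinner (calc \<gamma> f x) y = sector_integral \<gamma> (\<lambda>\<zeta>. f (exp \<zeta>) * res_pair x y \<zeta>)"
    and "\<And>v. \<bar>v\<bar> = \<gamma> \<Longrightarrow> integrable lborel (\<lambda>t. f (exp (Complex t v)) * res_pair x y (Complex t v))"
  unfolding res_pair_def
  using functional_calc(1)[OF assms bounded_linear_cinner_left, where x=x]
    functional_calc(2)[OF assms bounded_linear_cinner_left, where x=x]
  by (auto simp: cinner_scaleC_left)

text \<open>
  The constant depends on the angle alone, and the values of \<open>f\<close> enter only on the contour. This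
  uniformity is what turns pointwise bounds for \<open>f F\<^sub>w H\<^sub>z\<close> into a kernel.
\<close>

lemma calc_norm_bound:
  assumes g: "\<omega> < \<gamma>" "\<gamma> < pi"
  obtains K where "0 < K"
    "\<And>\<delta> s c f b x. sector_decay \<delta> s c f \<Longrightarrow> \<gamma> < \<delta> \<Longrightarrow> \<delta> \<le> pi \<Longrightarrow> integrable lborel b \<Longrightarrow>
       (\<And>t v. \<bar>v\<bar> = \<gamma> \<Longrightarrow> cmod (f (exp (Complex t v))) \<le> b t) \<Longrightarrow>
       norm (calc \<gamma> f x) \<le> K * (\<integral>t. b t \<partial>lborel) * norm x"
proof -
  define \<theta>' where "\<theta>' = (\<omega> + \<gamma>) / 2"
  have t': "\<omega> < \<theta>'" "\<theta>' < \<gamma>" "\<theta>' < pi" "0 \<le> \<theta>'" using g omega by (auto simp: \<theta>'_def)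
  obtain K where K: "0 < K"
    "\<And>\<zeta> x y. cos (Im \<zeta>) < cos \<theta>' \<Longrightarrow> cmod (res_pair x y \<zeta>) \<le> K * norm x * norm y"
    using res_pair_bound[OF t'(1,3)] by blast
  have cosv: "cos v < cos \<theta>'" if "\<bar>v\<bar> = \<gamma>" for v
    by (rule cos_less_of_abs) (use that t' g in auto)
  have "norm (calc \<gamma> f x) \<le> K / pi * (\<integral>t. b t \<partial>lborel) * norm x"
    if f: "sector_decay \<delta> s c f" and d: "\<gamma> < \<delta>" "\<delta> \<le> pi" and b: "integrable lborel b"
      and le: "\<And>t v. \<bar>v\<bar> = \<gamma> \<Longrightarrow> cmod (f (exp (Complex t v))) \<le> b t" for \<delta> s c f b x
  proof (rule norm_le_of_cinner)
    let ?u = "calc \<gamma> f x"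
    let ?\<Psi> = "\<lambda>\<zeta>. f (exp \<zeta>) * res_pair x ?u \<zeta>"
    have b0: "b t \<ge> 0" for t by (rule order_trans[OF norm_ge_zero le[where v=\<gamma>]]) (use g omega in auto)
    have B0: "0 \<le> (\<integral>t. b t \<partial>lborel)" by (intro integral_nonneg_AE) (use b0 in auto)
    then show "0 \<le> K / pi * (\<integral>t. b t \<partial>lborel) * norm x" using K(1) by simp
    have line: "cmod (line_integral v ?\<Psi>) \<le> K * (\<integral>t. b t \<partial>lborel) * norm x * norm ?u" if v: "\<bar>v\<bar> = \<gamma>" for v
    proof -
      have "cmod (line_integral v ?\<Psi>) \<le> (\<integral>t. cmod (?\<Psi> (Complex t v)) \<partial>lborel)"
        unfolding line_integral_def by (rule integral_norm_bound)
      also have "\<dots> \<le> (\<integral>t. b t * (K * norm x * norm ?u) \<partial>lborel)"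
      proof (rule integral_mono)
        show "integrable lborel (\<lambda>t. cmod (?\<Psi> (Complex t v)))"
          using cinner_calc(2)[OF f g(1) d v] by simp
        show "cmod (?\<Psi> (Complex t v)) \<le> b t * (K * norm x * norm ?u)" for t
          unfolding norm_mult using le[OF v, of t] K(2)[of "Complex t v" x ?u] cosv[OF v] b0
          by (intro mult_mono) auto
      qed (use b in auto)
      finally show ?thesis by (simp add: mult_ac)
    qed
    have "cmod (cinner ?u ?u) = cmod (line_integral (- \<gamma>) ?\<Psi> - line_integral \<gamma> ?\<Psi>) / (2 * pi)"
      unfolding cinner_calc(1)[OF f g(1) d] sector_integral_def by (simp add: norm_divide norm_mult)
    also have "\<dots> \<le> (2 * (K * (\<integral>t. b t \<partial>lborel) * norm x * norm ?u)) / (2 * pi)"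
      using line[of \<gamma>] line[of "-\<gamma>"] norm_triangle_ineq4[of "line_integral (- \<gamma>) ?\<Psi>" "line_integral \<gamma> ?\<Psi>"] g omega
      by (intro divide_right_mono) auto
    also have "\<dots> = K / pi * (\<integral>t. b t \<partial>lborel) * norm x * norm ?u" by simp
    finally show "cmod (cinner ?u ?u) \<le> K / pi * (\<integral>t. b t \<partial>lborel) * norm x * norm ?u" .
  qed
  with K(1) show ?thesis by (intro that[of "K / pi"]) auto
qed

lemma calc_diff:
  assumes f: "sector_decay \<delta> s c f" and g: "sector_decay \<delta> s' c' g" and \<gamma>: "\<omega> < \<gamma>" "\<gamma> < \<delta>" "\<delta> \<le> pi"
  shows "calc \<gamma> (\<lambda>z. f z - g z) x = calc \<gamma> f x - calc \<gamma> g x"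
proof -
  have "calc_integrand \<gamma> (\<lambda>z. f z - g z) x = (\<lambda>t. calc_integrand \<gamma> f x t - calc_integrand \<gamma> g x t)"
    by (simp add: calc_integrand_def fun_eq_iff left_diff_distrib scaleC_diff_left)
  then show ?thesis
    using calc_integrand_integrable[OF f \<gamma>] calc_integrand_integrable[OF g \<gamma>]
    by (simp add: calc_eq integral_diff scaleC_diff_right)
qed

text \<open>Cauchy's theorem in the strips between the two angles.\<close>

lemma calc_angle_independent:
  assumes f: "sector_decay \<delta> s c f" and g: "\<omega> < \<gamma>" "\<gamma> < \<delta>" "\<omega> < \<gamma>'" "\<gamma>' < \<delta>" and d: "\<delta> \<le> pi"
  shows "calc \<gamma> f x = calc \<gamma>' f x"
proof (rule cinner_left_cancel)
  fix y
  define \<theta>' where "\<theta>' = (\<omega> + min \<gamma> \<gamma>') / 2"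
  have t': "\<omega> < \<theta>'" "\<theta>' < \<gamma>" "\<theta>' < \<gamma>'" "\<theta>' < pi" "0 \<le> \<theta>'" using g d omega by (auto simp: \<theta>'_def)
  have s: "s > 0" "c \<ge> 0" using f by (auto simp: sector_decay_def)
  obtain K where K: "0 < K"
    "\<And>\<zeta> x y. cos (Im \<zeta>) < cos \<theta>' \<Longrightarrow> cmod (res_pair x y \<zeta>) \<le> K * norm x * norm y"
    using res_pair_bound[OF t'(1,4)] by blast
  have cosv: "cos v < cos \<theta>'" if "\<theta>' < \<bar>v\<bar>" "\<bar>v\<bar> < \<delta>" for v
    by (rule cos_less_of_abs) (use that t' d in auto)
  let ?\<Psi> = "\<lambda>\<zeta>. f (exp \<zeta>) * res_pair x y \<zeta>"
  have hol: "?\<Psi> holomorphic_on {\<zeta>. l < Im \<zeta> \<and> Im \<zeta> < u}"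
    and bd: "\<And>\<zeta>. l < Im \<zeta> \<Longrightarrow> Im \<zeta> < u \<Longrightarrow> cmod (?\<Psi> \<zeta>) \<le> (c * (K * norm x * norm y)) * exp (- s * \<bar>Re \<zeta>\<bar>)"
    if lu: "\<And>v. l < v \<Longrightarrow> v < u \<Longrightarrow> \<theta>' < \<bar>v\<bar> \<and> \<bar>v\<bar> < \<delta>" for l u
  proof -
    show "?\<Psi> holomorphic_on {\<zeta>. l < Im \<zeta> \<and> Im \<zeta> < u}"
    proof (intro holomorphic_on_mult)
      show "(\<lambda>\<zeta>. f (exp \<zeta>)) holomorphic_on {\<zeta>. l < Im \<zeta> \<and> Im \<zeta> < u}"
        by (rule holomorphic_on_subset[OF sector_decay_exp(1)[OF f d]]) (use lu in fastforce)
      show "res_pair x y holomorphic_on {\<zeta>. l < Im \<zeta> \<and> Im \<zeta> < u}"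
        by (rule res_pair_holomorphic[OF t'(1,4)]) (use cosv lu in auto)
    qed
    fix \<zeta> assume "l < Im \<zeta>" "Im \<zeta> < u"
    then have I: "\<theta>' < \<bar>Im \<zeta>\<bar>" "\<bar>Im \<zeta>\<bar> < \<delta>" using lu by auto
    have "cmod (?\<Psi> \<zeta>) \<le> (c * exp (- s * \<bar>Re \<zeta>\<bar>)) * (K * norm x * norm y)"
      unfolding norm_mult
      using sector_decay_exp(2)[OF f d, of \<zeta>] K(2)[OF cosv[OF I], of x y] I s by (intro mult_mono) auto
    then show "cmod (?\<Psi> \<zeta>) \<le> (c * (K * norm x * norm y)) * exp (- s * \<bar>Re \<zeta>\<bar>)" by (simp add: mult_ac)
  qed
  have "line_integral \<gamma> ?\<Psi> = line_integral \<gamma>' ?\<Psi>"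
    by (rule line_integral_shift[OF hol s(1) bd, of \<theta>' \<delta>]) (use g t' in auto)
  moreover have "line_integral (-\<gamma>) ?\<Psi> = line_integral (-\<gamma>') ?\<Psi>"
    by (rule line_integral_shift[OF hol s(1) bd, of "-\<delta>" "-\<theta>'"]) (use g t' in auto)
  ultimately show "cinner (calc \<gamma> f x) y = cinner (calc \<gamma>' f x) y"
    unfolding cinner_calc(1)[OF f g(1,2) d] cinner_calc(1)[OF f g(3,4) d] sector_integral_def by simp
qed

end

section \<open>The Cauchy kernel in logarithmic coordinates\<close>

text \<open>
  With \<open>r = \<bar>e\<^sup>z\<bar>\<close> and \<open>c = cos (Im z)\<close> one has \<open>\<bar>e\<^sup>z - 1\<bar>\<^sup>2 = r\<^sup>2 - 2rc + 1 \<ge> (1 - c)/2\<close>,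
  uniformly in the real part of \<open>z\<close>. This bounds the Cauchy kernel between two rays.
\<close>

lemma cmod_exp_minus_one_ge:
  assumes "0 < a" "b < 2 * pi"
  obtains M where "0 < M" "\<And>z. a \<le> \<bar>Im z\<bar> \<Longrightarrow> \<bar>Im z\<bar> \<le> b \<Longrightarrow> cmod (1 / (exp z - 1)) \<le> M"
proof (cases "a \<le> b")
  case True
  have neg: "cos u < 1" if "0 < u" "u < 2 * pi" for u
  proof (cases "u \<le> pi")
    case True
    then show ?thesis using cos_monotone_0_pi[of 0 u] that by simp
  next
    case False
    then show ?thesis using cos_monotone_0_pi[of 0 "2 * pi - u"] that by simp
  qed
  define m where "m = 1 - max (cos a) (cos b)"
  have m: "m > 0" using neg[of a] neg[of b] assms True by (auto simp: m_def)
  have "cmod (1 / (exp z - 1)) \<le> 1 / sqrt (m / 2)" if z: "a \<le> \<bar>Im z\<bar>" "\<bar>Im z\<bar> \<le> b" for z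
  proof -
    define r c where "r = exp (Re z)" and "c = cos (Im z)"
    have r: "r > 0" by (simp add: r_def)
    have c1: "- 1 \<le> c" "c \<le> 1" by (simp_all add: c_def)
    have "cos \<bar>Im z\<bar> \<le> max (cos a) (cos b)"
    proof (cases "\<bar>Im z\<bar> \<le> pi")
      case True
      then have "cos \<bar>Im z\<bar> \<le> cos a" using z assms by (intro cos_monotone_0_pi_le) auto
      then show ?thesis by simp
    next
      case False
      have "cos (2 * pi - \<bar>Im z\<bar>) \<le> cos (2 * pi - b)"
        using z assms False by (intro cos_monotone_0_pi_le) auto
      then show ?thesis by simp
    qed
    then have mc: "m \<le> 1 - c" by (simp add: m_def c_def)
    have "(cmod (exp z - 1))\<^sup>2 = (r * c - 1)\<^sup>2 + (r * sin (Im z))\<^sup>2"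
      by (simp add: cmod_power2 Re_exp Im_exp r_def c_def)
    also have "\<dots> = r\<^sup>2 * (c\<^sup>2 + (sin (Im z))\<^sup>2) - 2 * r * c + 1"
      by (simp add: power2_eq_square algebra_simps)
    also have "\<dots> = r\<^sup>2 - 2 * r * c + 1" by (simp add: c_def)
    finally have sq: "(cmod (exp z - 1))\<^sup>2 = r\<^sup>2 - 2 * r * c + 1" .
    have "(1 - c) / 2 \<le> r\<^sup>2 - 2 * r * c + 1"
    proof (cases "c \<le> 0")
      case True
      then have "2 * r * c \<le> 0" using r by (simp add: mult_nonneg_nonpos)
      moreover have "0 \<le> r\<^sup>2" by simp
      moreover have "(1 - c) / 2 \<le> 1" using c1 by simp
      ultimately show ?thesis by argo
    next
      case False
      have "(1 - c) * (1 / 2) \<le> (1 - c) * (1 + c)" using c1 False by (intro mult_left_mono) auto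
      also have "\<dots> \<le> (r - c)\<^sup>2 + (1 - c) * (1 + c)" by simp
      also have "\<dots> = r\<^sup>2 - 2 * r * c + 1" by (simp add: power2_eq_square algebra_simps)
      finally show ?thesis by simp
    qed
    with mc have "m / 2 \<le> (cmod (exp z - 1))\<^sup>2" unfolding sq by simp
    from real_sqrt_le_mono[OF this] have le: "sqrt (m / 2) \<le> cmod (exp z - 1)" by simp
    show ?thesis
      unfolding norm_divide using le m by (intro frac_le) auto
  qed
  with m show ?thesis by (intro that[of "1 / sqrt (m / 2)"]) auto
next
  case False
  show ?thesis by (rule that[of 1]) (use False in auto)
qed

lemma exp_kernel_eq:
  fixes \<eta> \<zeta> :: complex
  shows "exp \<zeta> / (exp \<eta> - exp \<zeta>) = 1 / (exp (\<eta> - \<zeta>) - 1)"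
    and "exp \<eta> / (exp \<eta> - exp \<zeta>) = - (1 / (exp (\<zeta> - \<eta>) - 1))"
proof -
  have "exp \<eta> - exp \<zeta> = (exp (\<eta> - \<zeta>) - 1) * exp \<zeta>" for \<eta> \<zeta> :: complex
    by (simp add: exp_diff field_simps)
  from this[of \<eta> \<zeta>] this[of \<zeta> \<eta>]
  show "exp \<zeta> / (exp \<eta> - exp \<zeta>) = 1 / (exp (\<eta> - \<zeta>) - 1)"
    "exp \<eta> / (exp \<eta> - exp \<zeta>) = - (1 / (exp (\<zeta> - \<eta>) - 1))"
    by (simp, metis (no_types, lifting) exp_not_eq_zero minus_diff_eq minus_divide_right
        nonzero_divide_mult_cancel_right)
qed

lemma exp_neq_of_Im:
  assumes "Im \<eta> \<noteq> Im \<zeta>" "\<bar>Im \<eta> - Im \<zeta>\<bar> < 2 * pi"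
  shows "exp \<eta> \<noteq> exp \<zeta>"
  using exp_complex_eqI[of \<eta> \<zeta>] assms by auto

lemma continuous_on_Complex_line: "continuous_on S (\<lambda>t. Complex t y)"
  by (simp add: Complex_eq continuous_intros)

text \<open>Cauchy's integral formula for a sector.\<close>

lemma sector_integral_kernel:
  assumes g: "sector_decay \<delta> s c g" and "\<gamma> < \<delta>" "\<delta> \<le> pi" and p: "\<bar>Im p\<bar> < \<gamma>"
  shows "sector_integral \<gamma> (\<lambda>\<eta>. g (exp \<eta>) * (exp \<eta> / (exp \<eta> - exp p))) = g (exp p)"
proof -
  let ?\<Theta> = "\<lambda>\<eta>. g (exp \<eta>) * (exp \<eta> / (exp \<eta> - exp p))"
  have s: "s > 0" "c \<ge> 0" using g by (auto simp: sector_decay_def)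
  have ne: "exp (Complex t v) \<noteq> exp p" if "\<bar>v\<bar> = \<gamma>" for t v
    by (rule exp_neq_of_Im) (use that assms in auto)
  have cont: "continuous_on UNIV (\<lambda>t. ?\<Theta> (Complex t v))" if "\<bar>v\<bar> = \<gamma>" for v
  proof (intro continuous_on_mult continuous_on_divide continuous_on_diff continuous_on_exp
      continuous_on_const continuous_on_Complex_line)
    show "continuous_on UNIV (\<lambda>t. g (exp (Complex t v)))"
      by (rule holomorphic_continuous_on_line[OF sector_decay_exp(1)[OF g]]) (use that assms in auto)
  qed (use ne[OF that] in auto)
  have "line_integral (-\<gamma>) ?\<Theta> - line_integral \<gamma> ?\<Theta> = 2 * pi * \<i> * g (exp p)"
  proof (rule strip_contour_limit[OF _ s(1), where R="\<bar>Re p\<bar> + 1" and C="c * 2"])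
    show "(?\<Theta> has_contour_integral 2 * pi * \<i> * g (exp p)) (rectpath (Complex (-n) (-\<gamma>)) (Complex n \<gamma>))"
      if "n > \<bar>Re p\<bar> + 1" for n
      by (rule rectpath_kernel[OF sector_decay_exp(1)[OF g]]) (use assms that in auto)
    show "continuous_on UNIV (\<lambda>t. ?\<Theta> (Complex t (-\<gamma>)))" "continuous_on UNIV (\<lambda>t. ?\<Theta> (Complex t \<gamma>))"
      by (rule cont; use p in simp)+
    fix \<eta> assume \<eta>: "- \<gamma> \<le> Im \<eta>" "Im \<eta> \<le> \<gamma>" "\<bar>Re p\<bar> + 1 \<le> \<bar>Re \<eta>\<bar>"
    have e2: "exp 1 \<ge> (2::real)" using exp_ge_add_one_self[of "1::real"] by simp
    have "1 / 2 \<le> cmod (exp (p - \<eta>) - 1)"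
    proof (cases "Re \<eta> \<ge> Re p + 1")
      case True
      have "cmod (exp (p - \<eta>)) \<le> exp (-1)" using True by simp
      also have "exp (-1) \<le> (1 / 2 :: real)" using e2 by (simp add: exp_minus field_simps)
      finally show ?thesis using norm_triangle_ineq2[of 1 "exp (p - \<eta>)"] by (simp add: norm_minus_commute)
    next
      case False
      then have "Re p \<ge> Re \<eta> + 1" using \<eta> by auto
      then have "cmod (exp (p - \<eta>)) \<ge> exp 1" by simp
      with e2 have "cmod (exp (p - \<eta>)) \<ge> 2" by linarith
      then show ?thesis using norm_triangle_ineq2[of "exp (p - \<eta>)" 1] by simp
    qed
    then have "cmod (1 / (exp (p - \<eta>) - 1)) \<le> 1 / (1 / 2)"
      unfolding norm_divide by (intro frac_le) auto
    then have k: "cmod (exp \<eta> / (exp \<eta> - exp p)) \<le> 2"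
      unfolding exp_kernel_eq(2) by simp
    have "cmod (g (exp \<eta>)) \<le> c * exp (- s * \<bar>Re \<eta>\<bar>)"
      by (rule sector_decay_exp(2)[OF g]) (use \<eta> assms in auto)
    then have "cmod (?\<Theta> \<eta>) \<le> (c * exp (- s * \<bar>Re \<eta>\<bar>)) * 2"
      unfolding norm_mult using k s by (intro mult_mono) auto
    then show "cmod (?\<Theta> \<eta>) \<le> c * 2 * exp (- s * \<bar>Re \<eta>\<bar>)" by simp
  qed (use p in auto)
  then show ?thesis by (simp add: sector_integral_def)
qed

text \<open>
  As \<open>e\<^sup>\<eta>\<close> lies outside the contour, the integrand is holomorphic in the whole strip between the two
  lines.
\<close>

lemma sector_integral_kernel_outside:
  assumes f: "sector_decay \<delta> s c f" and "0 < \<gamma>" "\<gamma> < \<bar>Im \<eta>\<bar>" "\<bar>Im \<eta>\<bar> < \<delta>" "\<delta> \<le> pi"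
  shows "sector_integral \<gamma> (\<lambda>\<zeta>. f (exp \<zeta>) * (exp \<zeta> / (exp \<eta> - exp \<zeta>))) = 0"
proof -
  let ?P = "\<lambda>\<zeta>. f (exp \<zeta>) * (exp \<zeta> / (exp \<eta> - exp \<zeta>))"
  define \<gamma>' where "\<gamma>' = (\<gamma> + \<bar>Im \<eta>\<bar>) / 2"
  have g': "\<gamma> < \<gamma>'" "\<gamma>' < \<bar>Im \<eta>\<bar>" using assms by (auto simp: \<gamma>'_def)
  have s: "s > 0" "c \<ge> 0" using f by (auto simp: sector_decay_def)
  obtain M where M: "M > 0" "\<And>z. \<bar>Im \<eta>\<bar> - \<gamma>' \<le> \<bar>Im z\<bar> \<Longrightarrow> \<bar>Im z\<bar> \<le> \<bar>Im \<eta>\<bar> + \<gamma>' \<Longrightarrow> cmod (1 / (exp z - 1)) \<le> M"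
    using cmod_exp_minus_one_ge[of "\<bar>Im \<eta>\<bar> - \<gamma>'" "\<bar>Im \<eta>\<bar> + \<gamma>'"] g' assms by auto
  have ne: "exp \<eta> \<noteq> exp \<zeta>" if "-\<gamma>' < Im \<zeta>" "Im \<zeta> < \<gamma>'" for \<zeta>
    by (rule exp_neq_of_Im) (use that g' assms in auto)
  have "line_integral (-\<gamma>) ?P = line_integral \<gamma> ?P"
  proof (rule line_integral_shift[OF _ s(1), where a'="-\<gamma>'" and b'="\<gamma>'" and C="c * M"])
    show "?P holomorphic_on {\<zeta>. -\<gamma>' < Im \<zeta> \<and> Im \<zeta> < \<gamma>'}"
      by (intro holomorphic_intros holomorphic_on_subset[OF sector_decay_exp(1)[OF f assms(5)]])
         (use ne g' assms in auto)
    fix \<zeta> assume z: "-\<gamma>' < Im \<zeta>" "Im \<zeta> < \<gamma>'"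
    have k: "cmod (exp \<zeta> / (exp \<eta> - exp \<zeta>)) \<le> M"
      unfolding exp_kernel_eq(1) by (rule M(2)) (use z g' in auto)
    have "cmod (f (exp \<zeta>)) \<le> c * exp (- s * \<bar>Re \<zeta>\<bar>)"
      by (rule sector_decay_exp(2)[OF f]) (use z g' assms in auto)
    then have "cmod (?P \<zeta>) \<le> (c * exp (- s * \<bar>Re \<zeta>\<bar>)) * M"
      unfolding norm_mult using k s by (intro mult_mono) auto
    then show "cmod (?P \<zeta>) \<le> c * M * exp (- s * \<bar>Re \<zeta>\<bar>)" by (simp add: mult_ac)
  qed (use g' assms in auto)
  then show ?thesis by (simp add: sector_integral_def)
qed

lemma sector_integral_cong:
  assumes "\<And>\<zeta>. \<bar>Im \<zeta>\<bar> = \<gamma> \<Longrightarrow> \<Psi> \<zeta> = \<Phi> \<zeta>" "0 \<le> \<gamma>"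
  shows "sector_integral \<gamma> \<Psi> = sector_integral \<gamma> \<Phi>"
proof -
  have "line_integral v \<Psi> = line_integral v \<Phi>" if "\<bar>v\<bar> = \<gamma>" for v
    unfolding line_integral_def by (intro Bochner_Integration.integral_cong) (use that in \<open>auto intro!: assms\<close>)
  then show ?thesis using assms(2) by (simp add: sector_integral_def)
qed

lemma sector_integral_diff:
  assumes "\<And>v. \<bar>v\<bar> = \<gamma> \<Longrightarrow> integrable lborel (\<lambda>t. \<Psi> (Complex t v))"
    "\<And>v. \<bar>v\<bar> = \<gamma> \<Longrightarrow> integrable lborel (\<lambda>t. \<Phi> (Complex t v))" "0 \<le> \<gamma>"
  shows "sector_integral \<gamma> (\<lambda>\<zeta>. \<Psi> \<zeta> - \<Phi> \<zeta>) = sector_integral \<gamma> \<Psi> - sector_integral \<gamma> \<Phi>"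
proof -
  have "line_integral v (\<lambda>\<zeta>. \<Psi> \<zeta> - \<Phi> \<zeta>) = line_integral v \<Psi> - line_integral v \<Phi>" if "\<bar>v\<bar> = \<gamma>" for v
    unfolding line_integral_def using assms(1,2)[OF that] by simp
  from this[of \<gamma>] this[of "-\<gamma>"] assms(3) show ?thesis
    by (simp add: sector_integral_def diff_divide_distrib[symmetric])
qed

lemma sector_integral_cmult: "sector_integral \<gamma> (\<lambda>\<zeta>. a * \<Psi> \<zeta>) = a * sector_integral \<gamma> \<Psi>"
  by (simp add: sector_integral_def line_integral_def algebra_simps)

lemma pair_integrable_product_bound:
  fixes Q :: "real \<times> real \<Rightarrow> complex"
  assumes cont: "continuous_on UNIV Q" and b: "integrable lborel b1" "integrable lborel b2"
    and le: "\<And>s t. cmod (Q (s, t)) \<le> b1 s * b2 t"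
  shows "integrable (lborel \<Otimes>\<^sub>M lborel) Q"
proof -
  have [measurable]: "b1 \<in> borel_measurable lborel" "b2 \<in> borel_measurable lborel"
    using b by auto
  have "integrable (lborel \<Otimes>\<^sub>M lborel) (\<lambda>p. b1 (fst p) * b2 (snd p))"
  proof (rule lborel_pair.Fubini_integrable)
    have "integrable lborel (\<lambda>x. norm (b1 x) * (\<integral>y. norm (b2 y) \<partial>lborel))" using b by simp
    then show "integrable lborel (\<lambda>x. \<integral>y. norm (b1 (fst (x, y)) * b2 (snd (x, y))) \<partial>lborel)"
      by (simp add: abs_mult)
  qed (use b in auto)
  then show ?thesis
  proof (rule Bochner_Integration.integrable_bound)
    show "Q \<in> borel_measurable (lborel \<Otimes>\<^sub>M lborel)"
      unfolding lborel_prod using borel_measurable_continuous_onI[OF cont] by simp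
    show "AE p in lborel \<Otimes>\<^sub>M lborel. norm (Q p) \<le> norm (b1 (fst p) * b2 (snd p))"
      using le by (auto intro!: AE_I2 order_trans[OF _ abs_ge_self] simp: split_beta')
  qed
qed

lemma sector_integral_swap:
  assumes cont: "\<And>v w. \<bar>v\<bar> = \<gamma>1 \<Longrightarrow> \<bar>w\<bar> = \<gamma>2 \<Longrightarrow> continuous_on UNIV (\<lambda>p. Q (Complex (fst p) v) (Complex (snd p) w))"
    and b: "integrable lborel b1" "integrable lborel b2"
    and le: "\<And>v w s t. \<bar>v\<bar> = \<gamma>1 \<Longrightarrow> \<bar>w\<bar> = \<gamma>2 \<Longrightarrow> cmod (Q (Complex s v) (Complex t w)) \<le> b1 s * b2 t"
    and g: "0 \<le> \<gamma>1" "0 \<le> \<gamma>2"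
  shows "sector_integral \<gamma>1 (\<lambda>\<zeta>. sector_integral \<gamma>2 (Q \<zeta>)) = sector_integral \<gamma>2 (\<lambda>\<eta>. sector_integral \<gamma>1 (\<lambda>\<zeta>. Q \<zeta> \<eta>))"
proof -
  have int: "integrable (lborel \<Otimes>\<^sub>M lborel) (\<lambda>p. Q (Complex (fst p) v) (Complex (snd p) w))"
    if "\<bar>v\<bar> = \<gamma>1" "\<bar>w\<bar> = \<gamma>2" for v w
    by (rule pair_integrable_product_bound[OF cont b]) (use that le in auto)
  have sw: "line_integral v (\<lambda>\<zeta>. line_integral w (Q \<zeta>)) = line_integral w (\<lambda>\<eta>. line_integral v (\<lambda>\<zeta>. Q \<zeta> \<eta>))"
    if "\<bar>v\<bar> = \<gamma>1" "\<bar>w\<bar> = \<gamma>2" for v w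
    unfolding line_integral_def
    using lborel_pair.Fubini_integral[of "\<lambda>x y. Q (Complex x v) (Complex y w)"] int[OF that]
    by (simp add: split_beta')
  have i1: "integrable lborel (\<lambda>x. line_integral w (Q (Complex x v)))"
    and i2: "integrable lborel (\<lambda>y. line_integral v (\<lambda>\<zeta>. Q \<zeta> (Complex y w)))"
    if "\<bar>v\<bar> = \<gamma>1" "\<bar>w\<bar> = \<gamma>2" for v w
    unfolding line_integral_def
    using lborel_pair.integrable_fst'[OF int[OF that]] lborel_pair.integrable_snd[of "\<lambda>x y. Q (Complex x v) (Complex y w)"] int[OF that]
    by (simp_all add: split_beta')
  let ?k = "2 * complex_of_real pi * \<i>"
  have g': "\<bar>\<gamma>1\<bar> = \<gamma>1" "\<bar>- \<gamma>1\<bar> = \<gamma>1" "\<bar>\<gamma>2\<bar> = \<gamma>2" "\<bar>- \<gamma>2\<bar> = \<gamma>2" using g by auto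
  have L: "line_integral v (\<lambda>\<zeta>. sector_integral \<gamma>2 (Q \<zeta>)) =
      (line_integral v (\<lambda>\<zeta>. line_integral (-\<gamma>2) (Q \<zeta>)) - line_integral v (\<lambda>\<zeta>. line_integral \<gamma>2 (Q \<zeta>))) / ?k"
    if "\<bar>v\<bar> = \<gamma>1" for v
    unfolding sector_integral_def line_integral_def[of v]
    using i1[OF that g'(3)] i1[OF that g'(4)] by simp
  have R: "line_integral w (\<lambda>\<eta>. sector_integral \<gamma>1 (\<lambda>\<zeta>. Q \<zeta> \<eta>)) =
      (line_integral w (\<lambda>\<eta>. line_integral (-\<gamma>1) (\<lambda>\<zeta>. Q \<zeta> \<eta>)) - line_integral w (\<lambda>\<eta>. line_integral \<gamma>1 (\<lambda>\<zeta>. Q \<zeta> \<eta>))) / ?k"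
    if "\<bar>w\<bar> = \<gamma>2" for w
    unfolding sector_integral_def line_integral_def[of w]
    using i2[OF g'(1) that] i2[OF g'(2) that] by simp
  show ?thesis
    unfolding sector_integral_def[of \<gamma>1 "\<lambda>\<zeta>. sector_integral \<gamma>2 (Q \<zeta>)"]
      sector_integral_def[of \<gamma>2 "\<lambda>\<eta>. sector_integral \<gamma>1 (\<lambda>\<zeta>. Q \<zeta> \<eta>)"]
      L[OF g'(1)] L[OF g'(2)] R[OF g'(3)] R[OF g'(4)]
      sw[OF g'(1) g'(3)] sw[OF g'(1) g'(4)] sw[OF g'(2) g'(3)] sw[OF g'(2) g'(4)]
    by (simp add: algebra_simps diff_divide_distrib)
qed

section \<open>Multiplicativity of the functional calculus\<close>

context sectorial_operator
begin

text \<open>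
  When the inner contour has the smaller angle, every point \<open>\<nu>\<close> of it lies inside the outer contour
  and every point \<open>\<mu>\<close> of the outer contour lies outside the inner one. By the resolvent identity
  \<open>R(\<nu>, A) R(\<mu>, A) = (R(\<nu>, A) - R(\<mu>, A)) / (\<mu> - \<nu>)\<close>, so the double integral splits in two: in the
  first term Cauchy's formula for \<open>g\<close> produces \<open>g(\<nu>)\<close>, and the second term vanishes by Cauchy's theorem
  for \<open>f\<close>.
\<close>

lemma calc_mult_nested:
  assumes f: "sector_decay \<delta> s c f" and g: "sector_decay \<delta> s' c' g"
    and \<gamma>: "\<omega> < \<gamma>1" "\<gamma>1 < \<gamma>2" "\<gamma>2 < \<delta>" and d: "\<delta> \<le> pi"
  shows "calc \<gamma>1 f (calc \<gamma>2 g x) = calc \<gamma>1 (\<lambda>z. f z * g z) x"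
proof (rule cinner_left_cancel)
  fix y
  define u where "u = calc \<gamma>2 g x"
  have g0: "0 < \<gamma>1" "0 < \<gamma>2" "\<omega> < \<gamma>2" "\<gamma>1 < \<delta>" using \<gamma> omega by auto
  have s: "s > 0" "c \<ge> 0" "s' > 0" "c' \<ge> 0" using f g by (auto simp: sector_decay_def)
  have fg: "sector_decay \<delta> s' (c' * c) (\<lambda>z. f z * g z)" by (rule sector_decay_mult_decay[OF g f])
  define \<theta>' where "\<theta>' = (\<omega> + \<gamma>1) / 2"
  have t': "\<omega> < \<theta>'" "\<theta>' < \<gamma>1" "\<theta>' < pi" "0 \<le> \<theta>'" using \<gamma> d omega by (auto simp: \<theta>'_def)
  have cosv: "cos v < cos \<theta>'" if "\<gamma>1 \<le> \<bar>v\<bar>" "\<bar>v\<bar> < \<delta>" for v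
    by (rule cos_less_of_abs) (use that t' d in auto)
  have rs: "exp \<zeta> \<in> resolvent_set A" if "\<gamma>1 \<le> \<bar>Im \<zeta>\<bar>" "\<bar>Im \<zeta>\<bar> < \<delta>" for \<zeta>
    using in_resolvent_set[of \<theta>' "exp \<zeta>"] exp_in_cone_complement[OF cosv[OF that]] t' by auto
  obtain K where K: "0 < K"
    "\<And>\<zeta> x y. cos (Im \<zeta>) < cos \<theta>' \<Longrightarrow> cmod (res_pair x y \<zeta>) \<le> K * norm x * norm y"
    using res_pair_bound[OF t'(1,3)] by blast
  define Q where "Q \<zeta> \<eta> = f (exp \<zeta>) * (exp \<zeta> / (exp \<eta> - exp \<zeta>)) * (g (exp \<eta>) * res_pair x y \<eta>)" for \<zeta> \<eta>
  have ne: "exp \<eta> \<noteq> exp \<zeta>" if "\<bar>Im \<zeta>\<bar> = \<gamma>1" "\<bar>Im \<eta>\<bar> = \<gamma>2" for \<zeta> \<eta>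
    by (rule exp_neq_of_Im) (use that \<gamma> g0 d in auto)
  obtain M where M: "M > 0" "\<And>z. \<gamma>2 - \<gamma>1 \<le> \<bar>Im z\<bar> \<Longrightarrow> \<bar>Im z\<bar> \<le> \<gamma>2 + \<gamma>1 \<Longrightarrow> cmod (1 / (exp z - 1)) \<le> M"
    using cmod_exp_minus_one_ge[of "\<gamma>2 - \<gamma>1" "\<gamma>2 + \<gamma>1"] \<gamma> d by auto
  have kb: "cmod (exp \<zeta> / (exp \<eta> - exp \<zeta>)) \<le> M" "cmod (exp \<eta> / (exp \<eta> - exp \<zeta>)) \<le> M"
    if "\<bar>Im \<zeta>\<bar> = \<gamma>1" "\<bar>Im \<eta>\<bar> = \<gamma>2" for \<zeta> \<eta>
    unfolding exp_kernel_eq norm_minus_cancel using that \<gamma> by (auto intro!: M(2))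
  have cline: "continuous_on UNIV (\<lambda>t. h (exp (Complex t v)))" if "sector_decay \<delta> r k h" "\<bar>v\<bar> < \<delta>" for h r k v
    by (rule holomorphic_continuous_on_line[OF sector_decay_exp(1)[OF that(1) d]]) (use that in auto)
  have crp: "continuous_on UNIV (\<lambda>t. res_pair x y (Complex t v))" if "\<gamma>1 \<le> \<bar>v\<bar>" "\<bar>v\<bar> < \<delta>" for v
  proof -
    have "res_pair x y holomorphic_on {\<zeta>. cos (Im \<zeta>) < cos \<theta>'}"
      by (rule res_pair_holomorphic[OF t'(1,3)]) auto
    then show ?thesis
      by (rule continuous_on_compose2[OF holomorphic_on_imp_continuous_on continuous_on_Complex_line])
         (use cosv[OF that] in auto)
  qed
  have gint: "integrable lborel (\<lambda>t. g (exp (Complex t w)) * (exp (Complex t w) / (exp (Complex t w) - exp \<zeta>)))"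
    if "\<bar>Im \<zeta>\<bar> = \<gamma>1" "\<bar>w\<bar> = \<gamma>2" for \<zeta> w
  proof (rule tail_decay_integrable[OF _ s(3), where R=0 and C="c' * M"])
    show "continuous_on UNIV (\<lambda>t. g (exp (Complex t w)) * (exp (Complex t w) / (exp (Complex t w) - exp \<zeta>)))"
      by (intro continuous_intros cline[OF g] continuous_on_Complex_line) (use that ne \<gamma> in auto)
    fix t
    have "cmod (g (exp (Complex t w))) \<le> c' * exp (- s' * \<bar>t\<bar>)"
      using sector_decay_exp(2)[OF g d, of "Complex t w"] that \<gamma> by auto
    then have "cmod (g (exp (Complex t w)) * (exp (Complex t w) / (exp (Complex t w) - exp \<zeta>))) \<le> (c' * exp (- s' * \<bar>t\<bar>)) * M"
      unfolding norm_mult using kb(2)[OF that(1), of "Complex t w"] that s by (intro mult_mono) auto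
    then show "cmod (g (exp (Complex t w)) * (exp (Complex t w) / (exp (Complex t w) - exp \<zeta>))) \<le> c' * M * exp (- s' * \<bar>t\<bar>)"
      by (simp add: mult_ac)
  qed
  \<comment> \<open>the pairing of \<open>g(A)x\<close>, by the resolvent identity and Cauchy's formula for \<open>g\<close>\<close>
  have pair_u: "res_pair u y \<zeta> = res_pair x y \<zeta> * g (exp \<zeta>)
       - sector_integral \<gamma>2 (\<lambda>\<eta>. exp \<zeta> / (exp \<eta> - exp \<zeta>) * (g (exp \<eta>) * res_pair x y \<eta>))"
    if \<zeta>: "\<bar>Im \<zeta>\<bar> = \<gamma>1" for \<zeta>
  proof -
    let ?l = "exp \<zeta>"
    have l: "?l \<in> resolvent_set A" using rs[of \<zeta>] \<zeta> g0 by simp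
    have L: "bounded_linear (\<lambda>v. cinner (res ?l v) y)"
      by (rule bounded_linear_compose[OF bounded_linear_cinner_left bounded_linear_res[OF l]])
    have Lc: "cinner (res ?l (a *\<^sub>C v)) y = a * cinner (res ?l v) y" for a v
      by (simp add: res_scaleC[OF l] cinner_scaleC_left)
    have "res_pair u y \<zeta> = ?l * sector_integral \<gamma>2 (\<lambda>\<eta>. g (exp \<eta>) * (exp \<eta> * cinner (res ?l (res (exp \<eta>) x)) y))"
      unfolding res_pair_def u_def functional_calc(1)[OF g g0(3) \<gamma>(3) d L Lc] ..
    also have "\<dots> = sector_integral \<gamma>2 (\<lambda>\<eta>. ?l * (g (exp \<eta>) * (exp \<eta> * cinner (res ?l (res (exp \<eta>) x)) y)))"
      by (simp only: sector_integral_cmult)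
    also have "\<dots> = sector_integral \<gamma>2 (\<lambda>\<eta>. res_pair x y \<zeta> * (g (exp \<eta>) * (exp \<eta> / (exp \<eta> - ?l)))
        - exp \<zeta> / (exp \<eta> - exp \<zeta>) * (g (exp \<eta>) * res_pair x y \<eta>))"
    proof (rule sector_integral_cong)
      fix \<eta> assume \<eta>: "\<bar>Im \<eta>\<bar> = \<gamma>2"
      have m: "exp \<eta> \<in> resolvent_set A" using rs[of \<eta>] \<eta> \<gamma> by simp
      have n0: "exp \<eta> - ?l \<noteq> 0" using ne[OF \<zeta> \<eta>] by simp
      have "cinner (res ?l x) y - cinner (res (exp \<eta>) x) y = (exp \<eta> - ?l) * cinner (res ?l (res (exp \<eta>) x)) y"
        using arg_cong[OF resolvent_identity[OF l m, of x], of "\<lambda>v. cinner v y"]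
        by (simp add: cinner_diff_left cinner_scaleC_left)
      then have eq: "cinner (res ?l (res (exp \<eta>) x)) y = (cinner (res ?l x) y - cinner (res (exp \<eta>) x) y) / (exp \<eta> - ?l)"
        using n0 by (simp add: field_simps)
      show "?l * (g (exp \<eta>) * (exp \<eta> * cinner (res ?l (res (exp \<eta>) x)) y)) =
         res_pair x y \<zeta> * (g (exp \<eta>) * (exp \<eta> / (exp \<eta> - ?l)))
        - exp \<zeta> / (exp \<eta> - exp \<zeta>) * (g (exp \<eta>) * res_pair x y \<eta>)"
        unfolding res_pair_def eq by (simp add: diff_divide_distrib algebra_simps)
    qed (use g0 in simp)
    also have "\<dots> = sector_integral \<gamma>2 (\<lambda>\<eta>. res_pair x y \<zeta> * (g (exp \<eta>) * (exp \<eta> / (exp \<eta> - ?l))))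
        - sector_integral \<gamma>2 (\<lambda>\<eta>. exp \<zeta> / (exp \<eta> - exp \<zeta>) * (g (exp \<eta>) * res_pair x y \<eta>))"
    proof (rule sector_integral_diff)
      fix w :: real assume w: "\<bar>w\<bar> = \<gamma>2"
      show "integrable lborel (\<lambda>t. res_pair x y \<zeta> * (g (exp (Complex t w)) * (exp (Complex t w) / (exp (Complex t w) - ?l))))"
        by (rule integrable_mult_right[OF gint[OF \<zeta> w]])
      show "integrable lborel (\<lambda>t. exp \<zeta> / (exp (Complex t w) - exp \<zeta>) * (g (exp (Complex t w)) * res_pair x y (Complex t w)))"
      proof (rule tail_decay_integrable[OF _ s(3), where R=0 and C="M * (c' * (K * norm x * norm y))"])
        show "continuous_on UNIV (\<lambda>t. exp \<zeta> / (exp (Complex t w) - exp \<zeta>) * (g (exp (Complex t w)) * res_pair x y (Complex t w)))"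
          by (intro continuous_intros cline[OF g] continuous_on_Complex_line crp) (use \<zeta> w ne \<gamma> in auto)
        fix t
        have "cmod (g (exp (Complex t w))) \<le> c' * exp (- s' * \<bar>t\<bar>)"
          using sector_decay_exp(2)[OF g d, of "Complex t w"] w \<gamma> by auto
        then have "cmod (exp \<zeta> / (exp (Complex t w) - exp \<zeta>) * (g (exp (Complex t w)) * res_pair x y (Complex t w)))
            \<le> M * ((c' * exp (- s' * \<bar>t\<bar>)) * (K * norm x * norm y))"
          unfolding norm_mult using kb(1)[OF \<zeta>, of "Complex t w"] K(2)[OF cosv, of "Complex t w" x y] w \<gamma> s M(1)
          by (intro mult_mono) (auto simp: norm_divide)
        then show "cmod (exp \<zeta> / (exp (Complex t w) - exp \<zeta>) * (g (exp (Complex t w)) * res_pair x y (Complex t w)))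
            \<le> M * (c' * (K * norm x * norm y)) * exp (- s' * \<bar>t\<bar>)"
          by (simp add: mult_ac)
      qed
    qed (use g0 in simp)
    also have "sector_integral \<gamma>2 (\<lambda>\<eta>. res_pair x y \<zeta> * (g (exp \<eta>) * (exp \<eta> / (exp \<eta> - ?l)))) = res_pair x y \<zeta> * g ?l"
      unfolding sector_integral_cmult using sector_integral_kernel[OF g \<gamma>(3) d, of \<zeta>] \<zeta> \<gamma> by simp
    finally show ?thesis .
  qed
  have "sector_integral \<gamma>1 (\<lambda>\<zeta>. sector_integral \<gamma>2 (Q \<zeta>)) = sector_integral \<gamma>2 (\<lambda>\<eta>. sector_integral \<gamma>1 (\<lambda>\<zeta>. Q \<zeta> \<eta>))"
  proof (rule sector_integral_swap)
    show "integrable lborel (\<lambda>t. c * M * exp (- s * \<bar>t\<bar>))"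
      by (intro integrable_mult_right integrable_exp_abs s)
    show "integrable lborel (\<lambda>t. c' * (K * norm x * norm y) * exp (- s' * \<bar>t\<bar>))"
      by (intro integrable_mult_right integrable_exp_abs s)
    fix v w :: real assume vw: "\<bar>v\<bar> = \<gamma>1" "\<bar>w\<bar> = \<gamma>2"
    have "continuous_on UNIV (\<lambda>p. f (exp (Complex (fst p) v)))" "continuous_on UNIV (\<lambda>p. g (exp (Complex (snd p) w)))"
      "continuous_on UNIV (\<lambda>p. res_pair x y (Complex (snd p) w))"
      using vw \<gamma> g0
      by (auto intro!: continuous_on_compose2[OF cline[OF f, of v]] continuous_on_compose2[OF cline[OF g, of w]]
          continuous_on_compose2[OF crp[of w]] continuous_intros)
    moreover have "continuous_on UNIV (\<lambda>p. Complex (fst p) v)" "continuous_on UNIV (\<lambda>p. Complex (snd p) w)"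
      by (simp_all add: Complex_eq continuous_intros)
    ultimately show "continuous_on UNIV (\<lambda>p. Q (Complex (fst p) v) (Complex (snd p) w))"
      unfolding Q_def by (intro continuous_intros) (use ne vw in auto)
    fix t r
    have 1: "cmod (f (exp (Complex t v))) \<le> c * exp (- s * \<bar>t\<bar>)"
      using sector_decay_exp(2)[OF f d, of "Complex t v"] vw g0 by auto
    have 2: "cmod (g (exp (Complex r w))) \<le> c' * exp (- s' * \<bar>r\<bar>)"
      using sector_decay_exp(2)[OF g d, of "Complex r w"] vw \<gamma> by auto
    have "cmod (Q (Complex t v) (Complex r w)) \<le> (c * exp (- s * \<bar>t\<bar>)) * M * ((c' * exp (- s' * \<bar>r\<bar>)) * (K * norm x * norm y))"
      unfolding Q_def norm_mult[of "_ * _" "_ * _"] norm_mult[of "f _"] norm_mult[of "g _"]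
      using kb(1)[of "Complex t v" "Complex r w"] K(2)[OF cosv, of "Complex r w" x y] 1 2 vw \<gamma> s M(1) K(1)
      by (intro mult_mono) auto
    then show "cmod (Q (Complex t v) (Complex r w)) \<le> c * M * exp (- s * \<bar>t\<bar>) * (c' * (K * norm x * norm y) * exp (- s' * \<bar>r\<bar>))"
      by (simp add: mult_ac)
  qed (use g0 in auto)
  also have "\<dots> = sector_integral \<gamma>2 (\<lambda>\<eta>. 0)"
  proof (rule sector_integral_cong)
    fix \<eta> assume \<eta>: "\<bar>Im \<eta>\<bar> = \<gamma>2"
    have "sector_integral \<gamma>1 (\<lambda>\<zeta>. Q \<zeta> \<eta>) = sector_integral \<gamma>1 (\<lambda>\<zeta>. (g (exp \<eta>) * res_pair x y \<eta>) * (f (exp \<zeta>) * (exp \<zeta> / (exp \<eta> - exp \<zeta>))))"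
      unfolding Q_def by (simp add: mult_ac)
    also have "\<dots> = 0"
      unfolding sector_integral_cmult
      using sector_integral_kernel_outside[OF f g0(1), of \<eta>] \<eta> \<gamma> d by simp
    finally show "sector_integral \<gamma>1 (\<lambda>\<zeta>. Q \<zeta> \<eta>) = 0" .
  qed (use g0 in simp)
  also have "\<dots> = 0" by (simp add: sector_integral_def line_integral_def)
  finally have Q0: "sector_integral \<gamma>1 (\<lambda>\<zeta>. sector_integral \<gamma>2 (Q \<zeta>)) = 0" .
  have "sector_integral \<gamma>1 (\<lambda>\<zeta>. sector_integral \<gamma>2 (Q \<zeta>)) =
      sector_integral \<gamma>1 (\<lambda>\<zeta>. f (exp \<zeta>) * g (exp \<zeta>) * res_pair x y \<zeta> - f (exp \<zeta>) * res_pair u y \<zeta>)"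
  proof (rule sector_integral_cong)
    fix \<zeta> assume \<zeta>: "\<bar>Im \<zeta>\<bar> = \<gamma>1"
    have "sector_integral \<gamma>2 (Q \<zeta>) = f (exp \<zeta>) * sector_integral \<gamma>2 (\<lambda>\<eta>. exp \<zeta> / (exp \<eta> - exp \<zeta>) * (g (exp \<eta>) * res_pair x y \<eta>))"
      unfolding sector_integral_cmult[symmetric] Q_def[abs_def] by (simp add: mult.assoc)
    also have "\<dots> = f (exp \<zeta>) * g (exp \<zeta>) * res_pair x y \<zeta> - f (exp \<zeta>) * res_pair u y \<zeta>"
      unfolding pair_u[OF \<zeta>] by (simp add: algebra_simps)
    finally show "sector_integral \<gamma>2 (Q \<zeta>) = f (exp \<zeta>) * g (exp \<zeta>) * res_pair x y \<zeta> - f (exp \<zeta>) * res_pair u y \<zeta>" .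
  qed (use g0 in simp)
  also have "\<dots> = sector_integral \<gamma>1 (\<lambda>\<zeta>. f (exp \<zeta>) * g (exp \<zeta>) * res_pair x y \<zeta>) - sector_integral \<gamma>1 (\<lambda>\<zeta>. f (exp \<zeta>) * res_pair u y \<zeta>)"
    using cinner_calc(2)[OF fg \<gamma>(1) g0(4) d] cinner_calc(2)[OF f \<gamma>(1) g0(4) d] g0
    by (intro sector_integral_diff) auto
  also have "\<dots> = cinner (calc \<gamma>1 (\<lambda>z. f z * g z) x) y - cinner (calc \<gamma>1 f u) y"
    unfolding cinner_calc(1)[OF fg \<gamma>(1) g0(4) d] cinner_calc(1)[OF f \<gamma>(1) g0(4) d] ..
  finally show "cinner (calc \<gamma>1 f (calc \<gamma>2 g x)) y = cinner (calc \<gamma>1 (\<lambda>z. f z * g z) x) y"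
    using Q0 by (simp add: u_def)
qed

text \<open>
  Since the angles may be changed freely, the contour of \<open>g\<close> can be moved outside that of \<open>f\<close>.
\<close>

lemma calc_mult:
  assumes f: "sector_decay \<delta> s c f" and g: "sector_decay \<delta> s' c' g"
    and \<gamma>: "\<omega> < \<gamma>" "\<gamma> < \<delta>" "\<omega> < \<gamma>'" "\<gamma>' < \<delta>" "\<omega> < \<gamma>''" "\<gamma>'' < \<delta>" and d: "\<delta> \<le> pi"
  shows "calc \<gamma> f (calc \<gamma>' g x) = calc \<gamma>'' (\<lambda>z. f z * g z) x"
proof -
  define \<gamma>2 where "\<gamma>2 = (\<gamma> + \<delta>) / 2"
  have g2: "\<gamma> < \<gamma>2" "\<gamma>2 < \<delta>" "\<omega> < \<gamma>2" using \<gamma> by (auto simp: \<gamma>2_def)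
  have fg: "sector_decay \<delta> s' (c' * c) (\<lambda>z. f z * g z)" by (rule sector_decay_mult_decay[OF g f])
  have "calc \<gamma> f (calc \<gamma>' g x) = calc \<gamma> f (calc \<gamma>2 g x)"
    using calc_angle_independent[OF g \<gamma>(3,4) g2(3,2) d] by simp
  also have "\<dots> = calc \<gamma> (\<lambda>z. f z * g z) x" by (rule calc_mult_nested[OF f g \<gamma>(1) g2(1,2) d])
  also have "\<dots> = calc \<gamma>'' (\<lambda>z. f z * g z) x" by (rule calc_angle_independent[OF fg \<gamma>(1,2,5,6) d])
  finally show ?thesis .
qed

end

section \<open>The regularizing operator\<close>

text \<open>
  In the sector of angle \<open>\<delta>\<close> one has \<open>\<bar>1 + z\<bar>\<^sup>2 \<ge> (1 + cos \<delta>)/2 (1 + \<bar>z\<bar>)\<^sup>2\<close>.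
\<close>

lemma sector_decay_regularizer:
  assumes "0 < \<delta>" "\<delta> < pi"
  shows "sector_decay \<delta> 1 (2 / (1 + cos \<delta>)) regularizer"
proof -
  have cd: "- 1 < cos \<delta>" using cos_monotone_0_pi[of \<delta> pi] assms by simp
  have low: "(1 + cos \<delta>) / 2 * (1 + cmod z)\<^sup>2 \<le> (cmod (1 + z))\<^sup>2" if z: "z \<in> sector \<delta>" for z
  proof -
    have z': "cos \<delta> * cmod z \<le> Re z" using z sector_iff_cos[of \<delta> z] assms by auto
    have "0 \<le> (1 - cos \<delta>) / 2 * (1 - cmod z)\<^sup>2" by simp
    also have "\<dots> = 1 + 2 * (cos \<delta> * cmod z) + (cmod z)\<^sup>2 - (1 + cos \<delta>) / 2 * (1 + cmod z)\<^sup>2"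
      by (simp add: power2_eq_square field_simps)
    also have "\<dots> \<le> 1 + 2 * Re z + (cmod z)\<^sup>2 - (1 + cos \<delta>) / 2 * (1 + cmod z)\<^sup>2"
      using z' by simp
    also have "1 + 2 * Re z + (cmod z)\<^sup>2 = (cmod (1 + z))\<^sup>2"
      unfolding cmod_power2 by (simp add: power2_eq_square algebra_simps)
    finally show ?thesis by simp
  qed
  have pos: "0 < cmod (1 + z)" if "z \<in> sector \<delta>" for z
  proof -
    have "0 < (1 + cos \<delta>) / 2 * (1 + cmod z)\<^sup>2"
    proof (intro mult_pos_pos)
      have "0 < 1 + cmod z" using norm_ge_zero[of z] by linarith
      then show "0 < (1 + cmod z)\<^sup>2" by simp
    qed (use cd in auto)
    with low[OF that] have "(cmod (1 + z))\<^sup>2 \<noteq> 0" by linarith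
    then show ?thesis by auto
  qed
  have "cmod (regularizer z) \<le> 2 / (1 + cos \<delta>) * exp (- 1 * \<bar>ln (cmod z)\<bar>)" if z: "z \<in> sector \<delta>" for z
  proof -
    have r: "0 < cmod z" using sector_nonzero[OF z] by simp
    have r1: "0 < (1 + cmod z)\<^sup>2" using r by (intro zero_less_power add_pos_pos) auto
    have "cmod (regularizer z) = cmod z / (cmod (1 + z))\<^sup>2"
      by (simp add: regularizer_def norm_divide norm_power)
    also have "\<dots> \<le> cmod z / ((1 + cos \<delta>) / 2 * (1 + cmod z)\<^sup>2)"
      using low[OF z] cd r1 pos[OF z] add_pos_pos[OF zero_less_one r] by (intro divide_left_mono mult_pos_pos zero_less_power) auto
    also have "\<dots> = 2 / (1 + cos \<delta>) * (cmod z powr 1 / (1 + cmod z) powr (2 * 1))"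
      using r powr_numeral[of "1 + cmod z" "num.Bit0 num.One"] by simp
    also have "\<dots> \<le> 2 / (1 + cos \<delta>) * exp (- 1 * \<bar>ln (cmod z)\<bar>)"
      using powr_quotient_le_exp[OF r, of 1] cd by (intro mult_left_mono) auto
    finally show ?thesis .
  qed
  moreover have "regularizer holomorphic_on sector \<delta>"
    unfolding regularizer_def[abs_def] by (intro holomorphic_intros) (use pos in fastforce)
  ultimately show ?thesis using cd by (auto simp: sector_decay_def)
qed

text \<open>
  The contour is moved across the negative axis, where the bound valid in a sector breaks down. Away
  from \<open>\<bar>z\<bar> = 1\<close> the decay persists in every direction.
\<close>

lemma cmod_regularizer_exp:
  assumes "1 \<le> \<bar>Re \<zeta>\<bar>"
  shows "cmod (regularizer (exp \<zeta>)) \<le> 4 * exp (- 1 * \<bar>Re \<zeta>\<bar>)"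
proof -
  let ?r = "exp (Re \<zeta>)"
  have e2: "exp 1 \<ge> (2::real)" using exp_ge_add_one_self[of "1::real"] by simp
  have low: "max 1 ?r / 2 \<le> cmod (1 + exp \<zeta>)"
  proof (cases "Re \<zeta> \<ge> 1")
    case True
    then have "?r \<ge> exp 1" by simp
    with e2 have "?r \<ge> 2" by linarith
    then show ?thesis using norm_triangle_ineq2[of "exp \<zeta>" "-1"] by (simp add: add.commute)
  next
    case False
    then have "Re \<zeta> \<le> -1" using assms by auto
    then have "?r \<le> exp (-1)" by simp
    also have "exp (-1) \<le> (1 / 2 :: real)" using e2 by (simp add: exp_minus field_simps)
    finally show ?thesis using norm_triangle_ineq2[of 1 "- exp \<zeta>"] by simp
  qed
  have "cmod (regularizer (exp \<zeta>)) = ?r / (cmod (1 + exp \<zeta>))\<^sup>2"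
    by (simp add: regularizer_def norm_divide norm_power)
  also have "\<dots> \<le> ?r / (max 1 ?r / 2)\<^sup>2"
    using low by (intro divide_left_mono power_mono mult_pos_pos zero_less_power) (auto intro: less_le_trans[OF _ low])
  also have "\<dots> = 4 * (?r / (max 1 ?r)\<^sup>2)" by (simp add: power_divide)
  also have "?r / (max 1 ?r)\<^sup>2 = exp (- 1 * \<bar>Re \<zeta>\<bar>)"
    by (cases "Re \<zeta> \<ge> 0") (auto simp: max_def power2_eq_square exp_minus field_simps)
  finally show ?thesis .
qed

context sectorial_operator
begin

lemma minus_one_resolvent: "- 1 \<in> resolvent_set A"
proof -
  have "cos pi < cos \<omega>" using omega by (intro cos_monotone_0_pi) auto
  then show ?thesis using in_resolvent_set[of \<omega> "-1"] omega by simp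
qed

lemma res_expansion:
  assumes "\<nu> \<in> resolvent_set A"
  shows "res \<nu> x = res (-1) x - (1 + \<nu>) *\<^sub>C res (-1) (res (-1) x) + ((1 + \<nu>)\<^sup>2) *\<^sub>C res \<nu> (res (-1) (res (-1) x))"
proof -
  have 1: "res \<nu> u = res (-1) u - (1 + \<nu>) *\<^sub>C res \<nu> (res (-1) u)" for u
  proof -
    have "res \<nu> u - res (-1) u = (- (1 + \<nu>)) *\<^sub>C res \<nu> (res (-1) u)"
      using resolvent_identity[OF assms minus_one_resolvent, of u] by simp
    then show ?thesis unfolding scaleC_minus_left by (simp add: algebra_simps)
  qed
  show ?thesis
    by (subst 1, subst 1) (simp add: scaleC_diff_right scaleC_scaleC power2_eq_square)
qed

text \<open>
  The operator \<open>\<phi>(A)\<close> is \<open>A(1+A)\<^sup>-\<^sup>2 = (1+A)\<^sup>-\<^sup>1 - (1+A)\<^sup>-\<^sup>2\<close>. Deforming the contour away from the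
  spectrum, through the strip between the angles \<open>\<gamma>\<close> and \<open>2\<pi> - \<gamma>\<close>, meets only the double pole of
  \<open>\<phi>\<close> at \<open>-1\<close>. Expanding the resolvent to second order there splits the integrand into a part
  without a pole, a simple pole and an exact differential.
\<close>

lemma calc_regularizer:
  assumes g: "\<omega> < \<gamma>" "\<gamma> < pi"
  shows "calc \<gamma> regularizer x = - res (-1) x - res (-1) (res (-1) x)"
proof (rule cinner_left_cancel)
  fix y
  define \<delta> where "\<delta> = (\<gamma> + pi) / 2"
  have d: "\<gamma> < \<delta>" "\<delta> < pi" "0 < \<delta>" using g omega by (auto simp: \<delta>_def)
  note reg = sector_decay_regularizer[OF d(3,2)]
  define \<theta>' where "\<theta>' = (\<omega> + \<gamma>) / 2"
  have t': "\<omega> < \<theta>'" "\<theta>' < \<gamma>" "\<theta>' < pi" "0 \<le> \<theta>'" using g omega by (auto simp: \<theta>'_def)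
  have cosv: "cos v < cos \<theta>'" if "\<theta>' < v" "v < 2 * pi - \<theta>'" for v
  proof (cases "v \<le> pi")
    case True
    then show ?thesis using that t' by (intro cos_monotone_0_pi) auto
  next
    case False
    then have "cos (2 * pi - v) < cos \<theta>'" using that t' by (intro cos_monotone_0_pi) auto
    then show ?thesis by simp
  qed
  obtain K where K: "0 < K"
    "\<And>\<zeta> x y. cos (Im \<zeta>) < cos \<theta>' \<Longrightarrow> cmod (res_pair x y \<zeta>) \<le> K * norm x * norm y"
    using res_pair_bound[OF t'(1,3)] by blast
  define r1 where "r1 = res (-1) x"
  define r2 where "r2 = res (-1) r1"
  let ?\<Psi> = "\<lambda>\<zeta>. regularizer (exp \<zeta>) * res_pair x y \<zeta>"
  let ?I = "2 * pi * \<i> * (cinner r1 y + cinner r2 y)"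
  have ne: "exp \<zeta> \<noteq> -1" if "0 < Im \<zeta>" "Im \<zeta> < pi \<or> pi < Im \<zeta> \<or> Re \<zeta> \<noteq> 0" "Im \<zeta> < 2 * pi" for \<zeta>
  proof
    assume "exp \<zeta> = -1"
    then have eq: "exp \<zeta> = exp (\<i> * pi)" by simp
    have "\<bar>Im \<zeta> - Im (\<i> * pi)\<bar> < 2 * pi" using that by simp
    from exp_complex_eqI[OF this eq] have "\<zeta> = \<i> * pi" .
    with that show False by auto
  qed
  have hp: "res_pair u y holomorphic_on {\<zeta>. \<theta>' < Im \<zeta> \<and> Im \<zeta> < 2 * pi - \<theta>'}" for u
    by (rule res_pair_holomorphic[OF t'(1,3)]) (use cosv in auto)
  have "line_integral \<gamma> ?\<Psi> - line_integral (2 * pi - \<gamma>) ?\<Psi> = ?I"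
  proof (rule strip_contour_limit[where s=1 and R=1 and C="4 * (K * norm x * norm y)"])
    show "\<gamma> < 2 * pi - \<gamma>" using g by simp
    have cont: "continuous_on UNIV (\<lambda>t. ?\<Psi> (Complex t v))" if v: "\<theta>' < v" "v < 2 * pi - \<theta>'" "v \<noteq> pi" for v
    proof -
      have "exp (Complex t v) + 1 \<noteq> 0" for t
        using ne[of "Complex t v"] v(1,2) v(3)[unfolded neq_iff] t' by (auto simp: add_eq_0_iff2)
      then have "continuous_on UNIV (\<lambda>t. regularizer (exp (Complex t v)))"
        unfolding regularizer_def by (intro continuous_intros continuous_on_Complex_line) (auto simp: add.commute)
      moreover have "continuous_on UNIV (\<lambda>t. res_pair x y (Complex t v))"
        by (rule holomorphic_continuous_on_line[OF hp v(1,2)])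
      ultimately show ?thesis by (intro continuous_on_mult)
    qed
    show "continuous_on UNIV (\<lambda>t. ?\<Psi> (Complex t \<gamma>))" "continuous_on UNIV (\<lambda>t. ?\<Psi> (Complex t (2 * pi - \<gamma>)))"
      by (rule cont; use t' g in simp)+
    show "cmod (?\<Psi> \<zeta>) \<le> 4 * (K * norm x * norm y) * exp (- 1 * \<bar>Re \<zeta>\<bar>)"
      if z: "\<gamma> \<le> Im \<zeta>" "Im \<zeta> \<le> 2 * pi - \<gamma>" "1 \<le> \<bar>Re \<zeta>\<bar>" for \<zeta>
    proof -
      have "cmod (?\<Psi> \<zeta>) \<le> (4 * exp (- 1 * \<bar>Re \<zeta>\<bar>)) * (K * norm x * norm y)"
        unfolding norm_mult
        by (intro mult_mono cmod_regularizer_exp K(2) cosv) (use z t' in auto)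
      then show ?thesis by (simp add: mult_ac)
    qed
    fix n :: real assume n: "1 < n"
    let ?R = "rectpath (Complex (-n) \<gamma>) (Complex n (2 * pi - \<gamma>))"
    let ?p = "\<i> * complex_of_real pi"
    have sub: "path_image ?R \<subseteq> {\<zeta>. \<theta>' < Im \<zeta> \<and> Im \<zeta> < 2 * pi - \<theta>'}"
      by (rule path_image_rectpath_strip) (use n g t' in auto)
    have neR: "exp \<zeta> + 1 \<noteq> 0" if z: "\<zeta> \<in> path_image ?R" for \<zeta>
    proof -
      have "Re \<zeta> \<noteq> 0 \<or> Im \<zeta> \<noteq> pi"
        using z n g by (subst (asm) path_image_rectpath) auto
      then have "Im \<zeta> < pi \<or> pi < Im \<zeta> \<or> Re \<zeta> \<noteq> 0" by linarith
      then show ?thesis using ne[of \<zeta>] subsetD[OF sub z] t' by (auto simp: add_eq_0_iff2)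
    qed
    have h1: "((\<lambda>\<zeta>. exp \<zeta> * res_pair r2 y \<zeta>) has_contour_integral 0) ?R"
      by (rule rectpath_Cauchy[where a'=\<theta>' and b'="2 * pi - \<theta>'"])
         (use n g t' in \<open>auto intro!: holomorphic_intros hp\<close>)
    have kern: "((\<lambda>\<zeta>. P \<zeta> * (exp \<zeta> / (exp \<zeta> - exp ?p))) has_contour_integral 2 * pi * \<i> * P ?p) ?R"
      if "P holomorphic_on UNIV" for P
      by (rule rectpath_kernel[where a'=\<theta>' and b'="2 * pi - \<theta>'"])
         (use n g t' that in \<open>auto intro: holomorphic_on_subset\<close>)
    have h2: "((\<lambda>\<zeta>. exp \<zeta> * (exp \<zeta> / (exp \<zeta> + 1))) has_contour_integral - (2 * pi * \<i>)) ?R"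
      using kern[of exp] by (simp add: holomorphic_on_exp)
    have h3: "((\<lambda>\<zeta>. exp \<zeta> / (exp \<zeta> + 1)) has_contour_integral 2 * pi * \<i>) ?R"
      using kern[of "\<lambda>_. 1"] by simp
    have h4: "((\<lambda>\<zeta>. exp \<zeta> / (exp \<zeta> + 1)\<^sup>2) has_contour_integral 0) ?R"
    proof -
      have "((\<lambda>\<zeta>. exp \<zeta> / (exp \<zeta> + 1)\<^sup>2) has_contour_integral
          ((\<lambda>\<zeta>. - 1 / (exp \<zeta> + 1)) (pathfinish ?R) - (\<lambda>\<zeta>. - 1 / (exp \<zeta> + 1)) (pathstart ?R))) ?R"
      proof (rule contour_integral_primitive[where S="{\<zeta>. exp \<zeta> + 1 \<noteq> 0}"])
        show "((\<lambda>\<zeta>. - 1 / (exp \<zeta> + 1)) has_field_derivative exp \<zeta> / (exp \<zeta> + 1)\<^sup>2) (at \<zeta> within {\<zeta>. exp \<zeta> + 1 \<noteq> 0})"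
          if "\<zeta> \<in> {\<zeta>. exp \<zeta> + 1 \<noteq> 0}" for \<zeta>
          using that by (auto intro!: derivative_eq_intros simp: power2_eq_square)
        show "path_image ?R \<subseteq> {\<zeta>. exp \<zeta> + 1 \<noteq> 0}" using neR by auto
      qed auto
      then show ?thesis by simp
    qed
    have "((\<lambda>\<zeta>. cinner r1 y * (exp \<zeta> / (exp \<zeta> + 1) - exp \<zeta> / (exp \<zeta> + 1)\<^sup>2)
         - cinner r2 y * (exp \<zeta> * (exp \<zeta> / (exp \<zeta> + 1))) + exp \<zeta> * res_pair r2 y \<zeta>) has_contour_integral
         (cinner r1 y * (2 * pi * \<i> - 0) - cinner r2 y * (- (2 * pi * \<i>)) + 0)) ?R"
      by (intro has_contour_integral_add has_contour_integral_diff has_contour_integral_lmul h1 h2 h3 h4)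
    then have "((\<lambda>\<zeta>. cinner r1 y * (exp \<zeta> / (exp \<zeta> + 1) - exp \<zeta> / (exp \<zeta> + 1)\<^sup>2)
         - cinner r2 y * (exp \<zeta> * (exp \<zeta> / (exp \<zeta> + 1))) + exp \<zeta> * res_pair r2 y \<zeta>) has_contour_integral ?I) ?R"
      by (simp add: algebra_simps)
    then show "(?\<Psi> has_contour_integral ?I) ?R"
    proof (rule has_contour_integral_eq)
      fix \<zeta> assume z: "\<zeta> \<in> path_image ?R"
      let ?l = "exp \<zeta>"
      have n0: "?l + 1 \<noteq> 0" by (rule neR[OF z])
      have l: "?l \<in> resolvent_set A"
        using in_resolvent_set[of \<theta>' ?l] exp_in_cone_complement[of \<zeta> \<theta>', OF cosv] subsetD[OF sub z] t' by auto
      have "cinner (res ?l x) y = cinner r1 y - (1 + ?l) * cinner r2 y + (1 + ?l)\<^sup>2 * cinner (res ?l r2) y"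
        using arg_cong[OF res_expansion[OF l, of x], of "\<lambda>v. cinner v y"]
        by (simp add: cinner_diff_left cinner_add_left cinner_scaleC_left r1_def r2_def)
      then have "?\<Psi> \<zeta> = ?l / (1 + ?l)\<^sup>2 * (?l * (cinner r1 y - (1 + ?l) * cinner r2 y + (1 + ?l)\<^sup>2 * cinner (res ?l r2) y))"
        by (simp add: regularizer_def res_pair_def)
      also have "\<dots> = cinner r1 y * (?l / (?l + 1) - ?l / (?l + 1)\<^sup>2)
         - cinner r2 y * (?l * (?l / (?l + 1))) + ?l * (?l * cinner (res ?l r2) y)"
        using n0 by (simp add: divide_simps add.commute) (simp add: algebra_simps power2_eq_square)
      finally show "cinner r1 y * (?l / (?l + 1) - ?l / (?l + 1)\<^sup>2)
         - cinner r2 y * (?l * (?l / (?l + 1))) + ?l * res_pair r2 y \<zeta> = ?\<Psi> \<zeta>"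
        by (simp add: res_pair_def)
    qed
  qed auto
  moreover have "line_integral (2 * pi - \<gamma>) ?\<Psi> = line_integral (-\<gamma>) ?\<Psi>"
  proof -
    have "exp (Complex t (2 * pi - \<gamma>)) = exp (Complex t (-\<gamma>))" for t
      by (simp add: complex_eq_iff Re_exp Im_exp cos_diff sin_diff)
    then show ?thesis by (simp add: line_integral_def res_pair_def)
  qed
  ultimately have "line_integral (-\<gamma>) ?\<Psi> - line_integral \<gamma> ?\<Psi> = - ?I"
    by (simp add: algebra_simps)
  then show "cinner (calc \<gamma> regularizer x) y = cinner (- res (-1) x - res (-1) (res (-1) x)) y"
    unfolding cinner_calc(1)[OF reg g(1) d(1) less_imp_le[OF d(2)]] sector_integral_def
    by (simp add: cinner_diff_left cinner_minus_left r1_def r2_def)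
qed

text \<open>
  Besides the range condition this gives injectivity: \<open>\<phi>(A) = A(1+A)\<^sup>-\<^sup>2\<close> is composed of injective
  maps when \<open>A\<close> is one-one.
\<close>

lemma A_res_minus_one:
  assumes "\<omega> < \<gamma>" "\<gamma> < pi"
  shows "A (res (-1) (res (-1) x)) = Some (calc \<gamma> regularizer x)"
proof -
  have "A (res (-1) (res (-1) x)) = Some ((-1) *\<^sub>C res (-1) (res (-1) x) - res (-1) x)"
    by (rule res_solves[OF minus_one_resolvent])
  then show ?thesis
    by (simp add: calc_regularizer[OF assms] scaleC_minus_left scaleC_one)
qed

lemma calc_regularizer_in_ran: "\<omega> < \<gamma> \<Longrightarrow> \<gamma> < pi \<Longrightarrow> calc \<gamma> regularizer x \<in> ran A"
  using A_res_minus_one by (auto simp: ran_def)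

lemma calc_regularizer_in_dom:
  assumes "\<omega> < \<gamma>" "\<gamma> < pi"
  shows "calc \<gamma> regularizer x \<in> dom A"
proof -
  have 1: "A (res (-1) x) = Some (- res (-1) x - x)" for x
    using res_solves[OF minus_one_resolvent, of x] by (simp add: scaleC_minus_left scaleC_one)
  have "A (res (-1) x + res (-1) (res (-1) x)) = Some ((- res (-1) x - x) + (- res (-1) (res (-1) x) - res (-1) x))"
    by (rule clinear_A(1)[OF 1 1])
  from clinear_A(2)[OF this, of "-1"] show ?thesis
    unfolding calc_regularizer[OF assms] by (simp add: scaleC_minus_left scaleC_one dom_def)
qed

lemma inj_res: "inj (res (-1))"
proof (rule injI)
  fix x y assume eq: "res (-1) x = res (-1) y"
  show "x = y"
    using res_solves[OF minus_one_resolvent, of x] res_solves[OF minus_one_resolvent, of y] unfolding eq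
    by simp
qed

lemma inj_calc_regularizer:
  assumes "\<omega> < \<gamma>" "\<gamma> < pi" "inj_on A (dom A)"
  shows "inj (calc \<gamma> regularizer)"
proof (rule injI)
  fix x y assume "calc \<gamma> regularizer x = calc \<gamma> regularizer y"
  then have "A (res (-1) (res (-1) x)) = A (res (-1) (res (-1) y))"
    by (simp add: A_res_minus_one[OF assms(1,2)])
  then have "res (-1) (res (-1) x) = res (-1) (res (-1) y)"
    by (rule inj_onD[OF assms(3)]) (use A_res_minus_one[OF assms(1,2)] in \<open>auto simp: dom_def\<close>)
  then show "x = y" using inj_res by (simp add: inj_eq)
qed

text \<open>
  By multiplicativity \<open>(f\<phi>)(A) g(A) = \<phi>(A) (fg)(A)\<close>, and \<open>\<phi>(A)\<close> is injective with range in the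
  domain and in the range of \<open>A\<close>. Hence the possibly unbounded operator \<open>f(A)\<close> is defined on the range
  of \<open>g(A)\<close> for every decaying \<open>g\<close>.
\<close>

lemma Hinf_calc_calc:
  assumes inj: "inj_on A (dom A)" and f: "f \<in> Hinf \<theta>" and t: "\<omega> < \<theta>" "\<theta> < pi"
    and g: "sector_decay \<delta> s c g" and d: "(\<omega> + \<theta>) / 2 < \<delta>" "\<delta> \<le> \<theta>" and \<gamma>: "\<omega> < \<gamma>" "\<gamma> < \<delta>"
  shows "Hinf_calc A \<omega> \<theta> f (calc \<gamma> g x) = Some (calc \<gamma> (\<lambda>z. f z * g z) x)"
proof -
  let ?m = "(\<omega> + \<theta>) / 2"
  have m: "\<omega> < ?m" "?m < pi" using t by auto
  have d0: "0 < \<delta>" "\<delta> < pi" "\<delta> \<le> pi" using d t omega \<gamma> by auto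
  note reg = sector_decay_regularizer[OF d0(1,2)]
  have fhol: "f holomorphic_on sector \<delta>" and "bounded (f ` sector \<theta>)"
    using f holomorphic_on_subset sector_mono[OF d(2)] by (auto simp: Hinf_def)
  then obtain M where M: "\<And>z. z \<in> sector \<theta> \<Longrightarrow> cmod (f z) \<le> M" by (auto simp: bounded_iff)
  have fM: "cmod (f z) \<le> \<bar>M\<bar>" if "z \<in> sector \<delta>" for z
    using M[of z] that sector_mono[OF d(2)] by fastforce
  have fg: "sector_decay \<delta> s (c * \<bar>M\<bar>) (\<lambda>z. f z * g z)"
    by (rule sector_decay_mult[OF g fhol fM]) auto
  have freg: "sector_decay \<delta> 1 (2 / (1 + cos \<delta>) * \<bar>M\<bar>) (\<lambda>z. f z * regularizer z)"
    by (rule sector_decay_mult[OF reg fhol fM]) auto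
  \<comment> \<open>both sides are \<open>(f \<phi> g)(A)x\<close>; injectivity of \<open>\<phi>(A)\<close> then identifies the value\<close>
  have "calc ?m (\<lambda>z. f z * regularizer z) (calc \<gamma> g x) = calc \<gamma> (\<lambda>z. f z * regularizer z * g z) x"
    by (rule calc_mult[OF freg g m(1) d(1) \<gamma> \<gamma> d0(3)])
  also have "\<dots> = calc \<gamma> (\<lambda>z. regularizer z * (f z * g z)) x"
    by (simp add: mult_ac)
  also have "\<dots> = calc ?m regularizer (calc \<gamma> (\<lambda>z. f z * g z) x)"
    by (rule calc_mult[OF reg fg m(1) d(1) \<gamma> \<gamma> d0(3), symmetric])
  finally have eq: "Hinf0_calc A \<omega> \<theta> (\<lambda>z. f z * regularizer z) (calc \<gamma> g x) = calc ?m regularizer (calc \<gamma> (\<lambda>z. f z * g z) x)"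
    by (simp add: Hinf0_calc_def)
  show ?thesis
    unfolding Hinf_calc_def eq Let_def
    using calc_regularizer_in_dom[OF m] calc_regularizer_in_ran[OF m]
    by (simp add: Hinf0_calc_def inv_f_f[OF inj_calc_regularizer[OF m inj]])
qed

end

section \<open>A reproducing formula\<close>

text \<open>
  On the positive axis this function is \<open>\<bar>G\<bar>\<^sup>2\<close>. By Cauchy's theorem its integral with respect to
  \<open>dr/r\<close> is the same along every ray, so this number, which is positive unless \<open>G = 0\<close>, is the
  constant of a reproducing formula.
\<close>

definition conj_square :: "(complex \<Rightarrow> complex) \<Rightarrow> complex \<Rightarrow> complex" where
  "conj_square G z = cnj (G (cnj z)) * G z"

lemma sector_decay_cnj:
  assumes "sector_decay \<theta> s c G" "0 \<le> \<theta>" "\<theta> \<le> pi"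
  shows "sector_decay \<theta> s c (\<lambda>z. cnj (G (cnj z)))"
proof -
  have im: "cnj ` sector \<theta> = sector \<theta>"
    using cnj_in_sector[OF _ assms(3)] by (force simp: image_iff intro: bexI[of _ "cnj _"])
  have "cnj \<circ> G \<circ> cnj holomorphic_on sector \<theta>"
    by (rule holomorphic_on_compose_cnj_cnj)
       (use assms open_sector[OF assms(2,3)] in \<open>auto simp: im sector_decay_def\<close>)
  moreover have "cmod (cnj (G (cnj z))) \<le> c * exp (- s * \<bar>ln (cmod z)\<bar>)" if "z \<in> sector \<theta>" for z
    using assms(1) cnj_in_sector[OF that assms(3)] unfolding sector_decay_def by fastforce
  ultimately show ?thesis
    using assms(1) by (auto simp: sector_decay_def comp_def)
qed

lemma sector_decay_conj_square:
  assumes "sector_decay \<theta> s c G" "0 \<le> \<theta>" "\<theta> \<le> pi"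
  shows "sector_decay \<theta> s (c * c) (conj_square G)"
  unfolding conj_square_def[abs_def]
  by (rule sector_decay_mult_decay[OF assms(1) sector_decay_cnj[OF assms]])

definition reproducing_constant :: "(complex \<Rightarrow> complex) \<Rightarrow> complex" where
  "reproducing_constant G = (\<integral>v. conj_square G (complex_of_real (exp v)) \<partial>lborel)"

lemma ray_integral_conj_square:
  assumes G: "sector_decay \<theta> s c G" "0 < \<theta>" "\<theta> \<le> pi" and p: "p \<in> sector \<theta>"
  shows "(\<integral>v. conj_square G (complex_of_real (exp v) * p) \<partial>lborel) = reproducing_constant G"
proof -
  note P = sector_decay_conj_square[OF G(1) less_imp_le[OF G(2)] G(3)]
  have s: "s > 0" using G by (simp add: sector_decay_def)
  let ?q = "Ln p"
  have e: "complex_of_real (exp v) * p = exp (Complex (v + Re ?q) (Im ?q))" for v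
  proof -
    have "exp (Complex (v + Re ?q) (Im ?q)) = exp (complex_of_real v + ?q)"
      by (rule arg_cong[of _ _ exp]) (simp add: complex_eq_iff)
    then show ?thesis using sector_Ln(1)[OF p] by (simp add: exp_add exp_of_real)
  qed
  have "(\<integral>v. conj_square G (complex_of_real (exp v) * p) \<partial>lborel) = line_integral (Im ?q) (\<lambda>\<zeta>. conj_square G (exp \<zeta>))"
    unfolding e line_integral_def
    using lborel_integral_real_affine[of 1 "\<lambda>v. conj_square G (exp (Complex v (Im ?q)))" "Re ?q"]
    by (simp add: add.commute)
  also have "\<dots> = line_integral 0 (\<lambda>\<zeta>. conj_square G (exp \<zeta>))"
    by (rule line_integral_shift[OF sector_decay_exp(1)[OF P G(3)] s sector_decay_exp(2)[OF P G(3)]])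
       (use sector_Ln(2)[OF p] G in auto)
  also have "\<dots> = reproducing_constant G"
    by (simp add: line_integral_def reproducing_constant_def Complex_eq exp_of_real)
  finally show ?thesis .
qed

text \<open>
  Otherwise \<open>G\<close> would vanish on the positive axis, hence in the whole sector by the identity theorem.
\<close>

lemma reproducing_constant_nonzero:
  assumes G: "sector_decay \<theta> s c G" "0 < \<theta>" "\<theta> \<le> pi" and ne: "\<exists>z\<in>sector \<theta>. G z \<noteq> 0"
  shows "reproducing_constant G \<noteq> 0"
proof
  assume zero: "reproducing_constant G = 0"
  note P = sector_decay_conj_square[OF G(1) less_imp_le[OF G(2)] G(3)]
  have s: "s > 0" using G by (simp add: sector_decay_def)
  let ?h = "\<lambda>v::real. (cmod (G (complex_of_real (exp v))))\<^sup>2"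
  have eq: "conj_square G (complex_of_real (exp v)) = complex_of_real (?h v)" for v
    by (simp add: conj_square_def complex_norm_square mult.commute del: of_real_power)
  have contP: "continuous_on UNIV (\<lambda>v. conj_square G (exp (Complex v 0)))"
    by (rule holomorphic_continuous_on_line[OF sector_decay_exp(1)[OF P G(3)]]) (use G in auto)
  have contG: "continuous_on UNIV (\<lambda>v. G (exp (Complex v 0)))"
    by (rule holomorphic_continuous_on_line[OF sector_decay_exp(1)[OF G(1,3)]]) (use G in auto)
  have e0: "exp (Complex v 0) = complex_of_real (exp v)" for v by (simp add: Complex_eq exp_of_real)
  have cont: "continuous_on UNIV ?h"
    using contG unfolding e0 by (intro continuous_intros)
  have "integrable lborel (\<lambda>v. conj_square G (exp (Complex v 0)))"
    by (rule tail_decay_integrable[OF contP s, where R=0 and C="c * c"])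
       (use sector_decay_exp(2)[OF P G(3), of "Complex _ 0"] G in auto)
  then have "integrable lborel (\<lambda>v. complex_of_real (?h v))" unfolding e0 eq .
  then have int: "integrable lborel ?h" using integrable_Re by fastforce
  have "complex_of_real (\<integral>v. ?h v \<partial>lborel) = 0"
    using zero unfolding reproducing_constant_def eq by (simp del: of_real_power)
  then have int0: "(\<integral>v. ?h v \<partial>lborel) = 0" using of_real_eq_0_iff by blast
  have h0: "?h v = 0" for v
  proof -
    have hi: "?h integrable_on cbox (v - 1) (v + 1)"
      by (rule integrable_on_subcbox[OF integrable_on_lborel[OF int]]) auto
    have "integral (cbox (v - 1) (v + 1)) ?h \<le> integral UNIV ?h"
      by (rule integral_subset_le) (use hi integrable_on_lborel[OF int] in auto)
    moreover have "0 \<le> integral (cbox (v - 1) (v + 1)) ?h" by (rule integral_nonneg[OF hi]) auto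
    ultimately have "integral (cbox (v - 1) (v + 1)) ?h = 0"
      using integral_lborel[OF int] int0 by simp
    with hi have "(?h has_integral 0) (cbox (v - 1) (v + 1))" by (simp add: has_integral_iff)
    from has_integral_0_cbox_imp_0[OF continuous_on_subset[OF cont] _ this, of v]
    show ?thesis by (auto simp: box_real)
  qed
  have "G w = 0" if w: "w \<in> sector \<theta>" for w
  proof (rule analytic_continuation[where f=G and S="sector \<theta>" and U="complex_of_real ` {0<..}" and \<xi>=1])
    show "G holomorphic_on sector \<theta>" using G(1) by (simp add: sector_decay_def)
    show "open (sector \<theta>)" "connected (sector \<theta>)" using G open_sector connected_sector by auto
    show "complex_of_real ` {0<..} \<subseteq> sector \<theta>" using G(2) by (auto simp: sector_def)
    show "1 \<in> sector \<theta>" using G(2) by (simp add: sector_def)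
    show "1 islimpt complex_of_real ` {0<..}"
      unfolding islimpt_approachable
    proof (intro allI impI)
      fix e :: real assume "e > 0"
      then have "complex_of_real (1 + e / 2) \<noteq> 1" "dist (complex_of_real (1 + e / 2)) 1 < e"
        by (auto simp: dist_norm simp flip: of_real_divide)
      moreover have "complex_of_real (1 + e / 2) \<in> complex_of_real ` {0<..}"
        by (rule imageI) (use \<open>e > 0\<close> in simp)
      ultimately show "\<exists>x'\<in>complex_of_real ` {0<..}. x' \<noteq> 1 \<and> dist x' 1 < e" by blast
    qed
    show "G z = 0" if z: "z \<in> complex_of_real ` {0<..}" for z
    proof -
      from z obtain r where "z = complex_of_real r" "r > 0" by auto
      then have "z = complex_of_real (exp (ln r))" by simp
      then show ?thesis using h0[of "ln r"] by simp
    qed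
  qed (rule w)
  with ne show False by blast
qed

section \<open>Convolution estimates\<close>

text \<open>Schur's test, obtained from the Cauchy-Schwarz inequality for the measures with densities
  \<open>k u\<close>.\<close>

lemma schur_test:
  fixes k :: "real \<Rightarrow> real \<Rightarrow> ennreal" and N :: "real \<Rightarrow> ennreal"
  assumes k[measurable]: "(\<lambda>(u, v). k u v) \<in> borel_measurable (lborel \<Otimes>\<^sub>M lborel)"
    and N[measurable]: "N \<in> borel_measurable lborel"
    and row: "\<And>u. (\<integral>\<^sup>+v. k u v \<partial>lborel) \<le> \<kappa>" and col: "\<And>v. (\<integral>\<^sup>+u. k u v \<partial>lborel) \<le> \<kappa>"
  shows "(\<integral>\<^sup>+u. (\<integral>\<^sup>+v. k u v * N v \<partial>lborel)\<^sup>2 \<partial>lborel) \<le> \<kappa>\<^sup>2 * (\<integral>\<^sup>+v. (N v)\<^sup>2 \<partial>lborel)"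
proof -
  have ku[measurable]: "k u \<in> borel_measurable lborel" for u
    using measurable_Pair2[OF k, of u] by simp
  have "(\<integral>\<^sup>+v. k u v * N v \<partial>lborel)\<^sup>2 \<le> \<kappa> * (\<integral>\<^sup>+v. k u v * (N v)\<^sup>2 \<partial>lborel)" for u
  proof -
    let ?M = "density lborel (k u)"
    have "(\<integral>\<^sup>+v. N v * 1 \<partial>?M)\<^sup>2 \<le> (\<integral>\<^sup>+v. (N v)\<^sup>2 \<partial>?M) * (\<integral>\<^sup>+v. 1\<^sup>2 \<partial>?M)"
      by (rule Cauchy_Schwarz_nn_integral) auto
    also have "(\<integral>\<^sup>+v. N v * 1 \<partial>?M) = (\<integral>\<^sup>+v. k u v * N v \<partial>lborel)"
      by (simp add: nn_integral_density)
    also have "(\<integral>\<^sup>+v. (N v)\<^sup>2 \<partial>?M) = (\<integral>\<^sup>+v. k u v * (N v)\<^sup>2 \<partial>lborel)"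
      by (simp add: nn_integral_density)
    also have "(\<integral>\<^sup>+v. 1\<^sup>2 \<partial>?M) = (\<integral>\<^sup>+v. k u v \<partial>lborel)"
      by (simp add: nn_integral_density emeasure_density)
    also have "(\<integral>\<^sup>+v. k u v * (N v)\<^sup>2 \<partial>lborel) * (\<integral>\<^sup>+v. k u v \<partial>lborel) \<le> (\<integral>\<^sup>+v. k u v * (N v)\<^sup>2 \<partial>lborel) * \<kappa>"
      by (intro mult_left_mono row) auto
    finally show ?thesis by (simp add: mult.commute)
  qed
  then have "(\<integral>\<^sup>+u. (\<integral>\<^sup>+v. k u v * N v \<partial>lborel)\<^sup>2 \<partial>lborel) \<le> (\<integral>\<^sup>+u. \<kappa> * (\<integral>\<^sup>+v. k u v * (N v)\<^sup>2 \<partial>lborel) \<partial>lborel)"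
    by (intro nn_integral_mono)
  also have "\<dots> = \<kappa> * (\<integral>\<^sup>+u. (\<integral>\<^sup>+v. k u v * (N v)\<^sup>2 \<partial>lborel) \<partial>lborel)"
    by (intro nn_integral_cmult) measurable
  also have "(\<integral>\<^sup>+u. (\<integral>\<^sup>+v. k u v * (N v)\<^sup>2 \<partial>lborel) \<partial>lborel) = (\<integral>\<^sup>+v. (\<integral>\<^sup>+u. k u v * (N v)\<^sup>2 \<partial>lborel) \<partial>lborel)"
    by (rule lborel_pair.Fubini') measurable
  also have "\<dots> = (\<integral>\<^sup>+v. (\<integral>\<^sup>+u. k u v \<partial>lborel) * (N v)\<^sup>2 \<partial>lborel)"
    by (intro nn_integral_cong nn_integral_multc) measurable
  also have "\<dots> \<le> (\<integral>\<^sup>+v. \<kappa> * (N v)\<^sup>2 \<partial>lborel)"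
    by (intro nn_integral_mono mult_right_mono col) auto
  also have "\<dots> = \<kappa> * (\<integral>\<^sup>+v. (N v)\<^sup>2 \<partial>lborel)"
    by (intro nn_integral_cmult) measurable
  finally show ?thesis by (simp add: power2_eq_square mult.assoc mult_left_mono)
qed

text \<open>
  An upper bound, up to constants, for the norm of \<open>(f F\<^sub>w H\<^sub>z)(A)\<close> when \<open>u = ln \<bar>w\<bar>\<close> and
  \<open>v = ln \<bar>z\<bar>\<close>; the integration variable is \<open>ln \<bar>l\<bar>\<close> for the points \<open>l\<close> of the contour.
\<close>

definition exp_conv_kernel :: "real \<Rightarrow> real \<Rightarrow> real \<Rightarrow> real \<Rightarrow> ennreal" where
  "exp_conv_kernel s1 s2 u v = (\<integral>\<^sup>+t. ennreal (exp (- s1 * \<bar>u + t\<bar>) * exp (- s2 * \<bar>v + t\<bar>)) \<partial>lborel)"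

definition exp_mass :: "real \<Rightarrow> real" where
  "exp_mass s = (\<integral>t. exp (- s * \<bar>t\<bar>) \<partial>lborel)"

lemma nn_integral_exp_shift:
  assumes "0 < s"
  shows "(\<integral>\<^sup>+t. ennreal (exp (- s * \<bar>t + a\<bar>)) \<partial>lborel) = ennreal (exp_mass s)"
proof -
  have "(\<integral>\<^sup>+t. ennreal (exp (- s * \<bar>t + a\<bar>)) \<partial>lborel) = (\<integral>\<^sup>+t. ennreal (exp (- s * \<bar>t\<bar>)) \<partial>lborel)"
    by (subst nn_integral_real_affine[where c=1 and t=a, of "\<lambda>t. ennreal (exp (- s * \<bar>t\<bar>))"])
       (auto simp: add.commute)
  also have "\<dots> = ennreal (exp_mass s)"
    unfolding exp_mass_def by (rule nn_integral_eq_integral[OF integrable_exp_abs[OF assms]]) auto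
  finally show ?thesis .
qed

lemma exp_mass_nonneg: "0 \<le> exp_mass s"
  unfolding exp_mass_def by (rule integral_nonneg_AE) auto

lemma exp_conv_kernel_measurable:
  "(\<lambda>(u, v). exp_conv_kernel s1 s2 (u + a) (v + b)) \<in> borel_measurable (lborel \<Otimes>\<^sub>M lborel)"
  unfolding exp_conv_kernel_def by measurable

lemma exp_conv_kernel_mass:
  assumes "0 < s1" "0 < s2"
  shows "(\<integral>\<^sup>+v. exp_conv_kernel s1 s2 u (v + b) \<partial>lborel) = ennreal (exp_mass s1 * exp_mass s2)"
    and "(\<integral>\<^sup>+u. exp_conv_kernel s1 s2 (u + a) v \<partial>lborel) = ennreal (exp_mass s1 * exp_mass s2)"
proof -
  have "(\<integral>\<^sup>+v. exp_conv_kernel s1 s2 u (v + b) \<partial>lborel) =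
     (\<integral>\<^sup>+t. (\<integral>\<^sup>+v. ennreal (exp (- s1 * \<bar>u + t\<bar>) * exp (- s2 * \<bar>v + b + t\<bar>)) \<partial>lborel) \<partial>lborel)"
    unfolding exp_conv_kernel_def by (rule lborel_pair.Fubini') measurable
  also have "\<dots> = (\<integral>\<^sup>+t. ennreal (exp (- s1 * \<bar>u + t\<bar>)) * ennreal (exp_mass s2) \<partial>lborel)"
    using nn_integral_exp_shift[OF assms(2), of "b + _"]
    by (intro nn_integral_cong) (simp add: ennreal_mult nn_integral_cmult add.assoc)
  also have "\<dots> = ennreal (exp_mass s1) * ennreal (exp_mass s2)"
    using nn_integral_exp_shift[OF assms(1), of u] by (simp add: nn_integral_multc add.commute)
  finally show "(\<integral>\<^sup>+v. exp_conv_kernel s1 s2 u (v + b) \<partial>lborel) = ennreal (exp_mass s1 * exp_mass s2)"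
    by (simp add: ennreal_mult exp_mass_nonneg)
  have "(\<integral>\<^sup>+u. exp_conv_kernel s1 s2 (u + a) v \<partial>lborel) =
     (\<integral>\<^sup>+t. (\<integral>\<^sup>+u. ennreal (exp (- s1 * \<bar>u + a + t\<bar>) * exp (- s2 * \<bar>v + t\<bar>)) \<partial>lborel) \<partial>lborel)"
    unfolding exp_conv_kernel_def by (rule lborel_pair.Fubini') measurable
  also have "\<dots> = (\<integral>\<^sup>+t. ennreal (exp_mass s1) * ennreal (exp (- s2 * \<bar>v + t\<bar>)) \<partial>lborel)"
    using nn_integral_exp_shift[OF assms(1), of "a + _"]
    by (intro nn_integral_cong) (simp add: ennreal_mult nn_integral_multc add.assoc)
  also have "\<dots> = ennreal (exp_mass s1) * ennreal (exp_mass s2)"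
    using nn_integral_exp_shift[OF assms(2), of v] by (simp add: nn_integral_cmult add.commute)
  finally show "(\<integral>\<^sup>+u. exp_conv_kernel s1 s2 (u + a) v \<partial>lborel) = ennreal (exp_mass s1 * exp_mass s2)"
    by (simp add: ennreal_mult exp_mass_nonneg)
qed

lemma exp_product_integrable:
  assumes "0 < s1" "0 < s2"
  shows "integrable lborel (\<lambda>t::real. exp (- s1 * \<bar>u + t\<bar>) * exp (- s2 * \<bar>v + t\<bar>))"
proof (rule Bochner_Integration.integrable_bound[OF integrable_exp_abs_shift[OF assms(1), of u]])
  show "AE t in lborel. norm (exp (- s1 * \<bar>u + t\<bar>) * exp (- s2 * \<bar>v + t\<bar>)) \<le> norm (exp (- s1 * \<bar>u + t\<bar>))"
    using assms by (auto intro!: AE_I2 simp: mult_le_cancel_left1)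
qed auto

section \<open>The estimate along rays\<close>

lemma sector_integral_integral_swap:
  fixes Q :: "complex \<Rightarrow> real \<Rightarrow> complex"
  assumes cont: "\<And>v. \<bar>v\<bar> = \<gamma> \<Longrightarrow> continuous_on UNIV (\<lambda>p. Q (Complex (fst p) v) (snd p))"
    and b: "integrable lborel b1" "integrable lborel b2"
    and le: "\<And>v s r. \<bar>v\<bar> = \<gamma> \<Longrightarrow> cmod (Q (Complex s v) r) \<le> b1 s * b2 r"
    and g: "0 \<le> \<gamma>"
  shows "sector_integral \<gamma> (\<lambda>\<zeta>. \<integral>r. Q \<zeta> r \<partial>lborel) = (\<integral>r. sector_integral \<gamma> (\<lambda>\<zeta>. Q \<zeta> r) \<partial>lborel)"
proof -
  have int: "integrable (lborel \<Otimes>\<^sub>M lborel) (\<lambda>p. Q (Complex (fst p) v) (snd p))"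
    if "\<bar>v\<bar> = \<gamma>" for v
    by (rule pair_integrable_product_bound[OF cont b]) (use that le in auto)
  have sw: "line_integral v (\<lambda>\<zeta>. \<integral>r. Q \<zeta> r \<partial>lborel) = (\<integral>r. line_integral v (\<lambda>\<zeta>. Q \<zeta> r) \<partial>lborel)"
    if "\<bar>v\<bar> = \<gamma>" for v
    unfolding line_integral_def
    using lborel_pair.Fubini_integral[of "\<lambda>x r. Q (Complex x v) r"] int[OF that]
    by (simp add: split_beta')
  have i: "integrable lborel (\<lambda>r. line_integral v (\<lambda>\<zeta>. Q \<zeta> r))" if "\<bar>v\<bar> = \<gamma>" for v
    unfolding line_integral_def
    using lborel_pair.integrable_snd[of "\<lambda>x r. Q (Complex x v) r"] int[OF that]
    by (simp_all add: split_beta')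
  have g': "\<bar>\<gamma>\<bar> = \<gamma>" "\<bar>- \<gamma>\<bar> = \<gamma>" using g by auto
  show ?thesis
    unfolding sector_integral_def sw[OF g'(1)] sw[OF g'(2)] using i[OF g'(1)] i[OF g'(2)] by simp
qed

lemma sector_decay_dilate_exp:
  assumes F: "sector_decay \<theta> s c F" and w: "w \<in> sector a" and v: "\<bar>v\<bar> + a \<le> \<theta>" "0 < a" and t: "\<theta> \<le> pi"
  shows "w * exp (Complex t v) \<in> sector \<theta>"
    and "cmod (F (w * exp (Complex t v))) \<le> c * exp (- s * \<bar>ln (cmod w) + t\<bar>)"
proof -
  have "w * exp (Complex t v) = exp (Ln w + Complex t v)"
    using sector_Ln(1)[OF w] by (simp add: exp_add)
  moreover have "exp (Ln w + Complex t v) \<in> sector \<theta>"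
    using sector_Ln(2)[OF w] v t by (intro exp_in_sector) auto
  ultimately show *: "w * exp (Complex t v) \<in> sector \<theta>" by simp
  have "ln (cmod (w * exp (Complex t v))) = ln (cmod w) + t"
    using sector_nonzero[OF w] by (simp add: norm_mult ln_mult)
  with F * show "cmod (F (w * exp (Complex t v))) \<le> c * exp (- s * \<bar>ln (cmod w) + t\<bar>)"
    by (fastforce simp: sector_decay_def)
qed

lemma scale_in_sector: "z \<in> sector a \<Longrightarrow> complex_of_real (exp u) * z \<in> sector a"
  using Arg_times_of_real[of "exp u" z] by (simp add: sector_def)

lemma scale_in_sector_iff: "complex_of_real (exp u) * z \<in> sector a \<longleftrightarrow> z \<in> sector a"
  using Arg_times_of_real[of "exp u" z] by (auto simp: sector_def)

context sectorial_operator
begin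

text \<open>
  By dominated convergence for the values on the contour. Continuity makes the square functions
  measurable, as the exchange of integrals requires.
\<close>

lemma calc_dilate_continuous:
  assumes F: "sector_decay \<theta> s c F" and f: "f holomorphic_on sector \<theta>"
    and M: "\<And>z. z \<in> sector \<theta> \<Longrightarrow> cmod (f z) \<le> M"
    and g: "\<omega> < \<gamma>" "\<gamma> + a < \<theta>" "0 < a" and t: "\<theta> \<le> pi"
  shows "continuous_on (sector a) (\<lambda>z. calc \<gamma> (\<lambda>l. f l * F (z * l)) x)"
  unfolding continuous_on_sequentially
proof (intro allI ballI impI)
  fix zs z assume z: "z \<in> sector a" and "(\<forall>n. zs n \<in> sector a) \<and> zs \<longlonglongrightarrow> z"
  then have zs: "\<And>n. zs n \<in> sector a" and lim: "zs \<longlonglongrightarrow> z" by auto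
  define \<delta> where "\<delta> = \<theta> - a"
  have d: "\<gamma> < \<delta>" "\<delta> \<le> pi" "a + \<delta> \<le> \<theta>" "\<delta> \<le> \<theta>" using g t by (auto simp: \<delta>_def)
  have s: "s > 0" "c \<ge> 0" using F by (auto simp: sector_decay_def)
  have M0: "0 \<le> M"
    by (rule order_trans[OF norm_ge_zero M[of 1]]) (use g omega in \<open>auto simp: sector_def\<close>)
  have "(\<lambda>n. \<bar>ln (cmod (zs n))\<bar>) \<longlonglongrightarrow> \<bar>ln (cmod z)\<bar>"
    using sector_nonzero[OF z] by (intro tendsto_intros lim) auto
  then have "Bseq (\<lambda>n. \<bar>ln (cmod (zs n))\<bar>)" by (rule convergent_imp_Bseq[OF convergentI])
  then obtain L0 where L0: "\<And>n. \<bar>ln (cmod (zs n))\<bar> \<le> L0" by (auto simp: Bseq_def)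
  define L where "L = max L0 \<bar>ln (cmod z)\<bar>"
  have L: "\<bar>ln (cmod (zs n))\<bar> \<le> L" "\<bar>ln (cmod z)\<bar> \<le> L" for n using L0[of n] by (auto simp: L_def)
  define \<phi> where "\<phi> z l = f l * F (z * l)" for z l
  have dec: "sector_decay \<delta> s (c * exp (s * \<bar>ln (cmod w)\<bar>) * M) (\<phi> w)" if "w \<in> sector a" for w
    unfolding \<phi>_def
    by (rule sector_decay_mult[OF sector_decay_dilate[OF F that d(3) t]])
       (use f M M0 sector_mono[OF d(4)] in \<open>auto intro: holomorphic_on_subset\<close>)
  have bd: "cmod (\<phi> w (exp (Complex t v))) \<le> c * exp (s * L) * M * exp (- s * \<bar>t\<bar>)"
    if w: "w \<in> sector a" "\<bar>ln (cmod w)\<bar> \<le> L" and v: "\<bar>v\<bar> = \<gamma>" for w t v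
  proof -
    have "cmod (\<phi> w (exp (Complex t v))) \<le> (c * exp (s * \<bar>ln (cmod w)\<bar>) * M) * exp (- s * \<bar>t\<bar>)"
      using sector_decay_exp(2)[OF dec[OF w(1)] d(2), of "Complex t v"] v d by auto
    also have "\<dots> \<le> (c * exp (s * L) * M) * exp (- s * \<bar>t\<bar>)"
      using w(2) s M0 by (intro mult_right_mono mult_left_mono) auto
    finally show ?thesis .
  qed
  define D where "D n v t = cmod (\<phi> (zs n) (exp (Complex t v)) - \<phi> z (exp (Complex t v)))" for n v t
  define b where "b n t = D n \<gamma> t + D n (-\<gamma>) t" for n t
  define B where "B = 2 * (c * exp (s * L) * M)"
  have cont: "continuous_on UNIV (D n v)" if v: "\<bar>v\<bar> = \<gamma>" for n v
  proof -
    have "continuous_on UNIV (\<lambda>t. \<phi> w (exp (Complex t v)))" if "w \<in> sector a" for w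
      by (rule holomorphic_continuous_on_line[OF sector_decay_exp(1)[OF dec[OF that] d(2)]]) (use v d in auto)
    from this[OF zs] this[OF z] show ?thesis
      unfolding D_def[abs_def] by (intro continuous_intros)
  qed
  have Dle: "D n v t \<le> B * exp (- s * \<bar>t\<bar>)" if v: "\<bar>v\<bar> = \<gamma>" for n v t
    unfolding D_def B_def
    using bd[OF zs L(1) v, of n t] bd[OF z L(2) v, of t]
      norm_triangle_ineq4[of "\<phi> (zs n) (exp (Complex t v))" "\<phi> z (exp (Complex t v))"] by simp
  have g': "\<bar>\<gamma>\<bar> = \<gamma>" "\<bar>-\<gamma>\<bar> = \<gamma>" using g omega by auto
  have int: "integrable lborel (\<lambda>t. 2 * B * exp (- s * \<bar>t\<bar>))"
    by (intro integrable_mult_right integrable_exp_abs s)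
  have bmeas: "b n \<in> borel_measurable lborel" for n
  proof -
    have "continuous_on UNIV (b n)" unfolding b_def[abs_def] by (intro continuous_on_add cont g')
    then show ?thesis using borel_measurable_continuous_onI by simp
  qed
  have ble: "b n t \<le> 2 * B * exp (- s * \<bar>t\<bar>)" for n t
    unfolding b_def using Dle[OF g'(1), of n t] Dle[OF g'(2), of n t] by linarith
  have b0: "0 \<le> b n t" for n t by (simp add: b_def D_def)
  have bint: "integrable lborel (b n)" for n
    by (rule Bochner_Integration.integrable_bound[OF int bmeas])
       (use ble b0 in \<open>auto intro!: AE_I2 order_trans[OF _ abs_ge_self]\<close>)
  have D0: "(\<lambda>n. D n v t) \<longlonglongrightarrow> 0" if v: "\<bar>v\<bar> = \<gamma>" for v t
  proof -
    let ?l = "exp (Complex t v)"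
    have zl: "z * ?l \<in> sector \<theta>"
      by (rule sector_decay_dilate_exp(1)[OF F z _ g(3) t]) (use v g in auto)
    have "isCont F (z * ?l)"
      using F zl open_sector[of \<theta>] g t omega
      by (intro holomorphic_on_imp_continuous_on[THEN continuous_on_interior, of F "sector \<theta>"])
         (auto simp: sector_decay_def interior_open)
    then have "(\<lambda>n. F (zs n * ?l)) \<longlonglongrightarrow> F (z * ?l)"
      by (rule isCont_tendsto_compose) (intro tendsto_intros lim)
    then have "(\<lambda>n. D n v t) \<longlonglongrightarrow> cmod (\<phi> z ?l - \<phi> z ?l)"
      unfolding D_def \<phi>_def by (intro tendsto_intros)
    then show ?thesis by simp
  qed
  have "(\<lambda>n. \<integral>t. b n t \<partial>lborel) \<longlonglongrightarrow> (\<integral>t. 0 \<partial>(lborel :: real measure))"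
  proof (rule integral_dominated_convergence[OF _ bmeas int])
    show "AE t in lborel. (\<lambda>n. b n t) \<longlonglongrightarrow> 0"
      unfolding b_def using tendsto_add[OF D0[OF g'(1)] D0[OF g'(2)]] by simp
    show "AE t in lborel. norm (b n t) \<le> 2 * B * exp (- s * \<bar>t\<bar>)" for n
      using ble b0 by simp
  qed auto
  then have I0: "(\<lambda>n. \<integral>t. b n t \<partial>lborel) \<longlonglongrightarrow> 0" by simp
  obtain K where K: "0 < K"
    "\<And>\<delta> s c f b x. sector_decay \<delta> s c f \<Longrightarrow> \<gamma> < \<delta> \<Longrightarrow> \<delta> \<le> pi \<Longrightarrow> integrable lborel b \<Longrightarrow>
       (\<And>t v. \<bar>v\<bar> = \<gamma> \<Longrightarrow> cmod (f (exp (Complex t v))) \<le> b t) \<Longrightarrow>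
       norm (calc \<gamma> f x) \<le> K * (\<integral>t. b t \<partial>lborel) * norm x"
    using calc_norm_bound[of \<gamma>] g t omega by auto
  have diff: "norm (calc \<gamma> (\<phi> (zs n)) x - calc \<gamma> (\<phi> z) x) \<le> K * (\<integral>t. b n t \<partial>lborel) * norm x" for n
  proof -
    have "norm (calc \<gamma> (\<lambda>l. \<phi> (zs n) l - \<phi> z l) x) \<le> K * (\<integral>t. b n t \<partial>lborel) * norm x"
    proof (rule K(2)[OF sector_decay_diff[OF dec[OF zs]] d(1,2) bint])
      show "sector_decay \<delta> s (c * exp (s * \<bar>ln (cmod z)\<bar>) * M) (\<phi> z)" by (rule dec[OF z])
      fix t v :: real assume "\<bar>v\<bar> = \<gamma>"
      then have "v = \<gamma> \<or> v = -\<gamma>" by auto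
      then show "cmod (\<phi> (zs n) (exp (Complex t v)) - \<phi> z (exp (Complex t v))) \<le> b n t"
        by (auto simp: b_def D_def)
    qed
    then show ?thesis by (simp add: calc_diff[OF dec[OF zs] dec[OF z] g(1) d(1,2)])
  qed
  show "((\<lambda>z. calc \<gamma> (\<lambda>l. f l * F (z * l)) x) \<circ> zs) \<longlonglongrightarrow> calc \<gamma> (\<lambda>l. f l * F (z * l)) x"
  proof (rule LIM_zero_cancel, rule Lim_null_comparison)
    show "eventually (\<lambda>n. norm (((\<lambda>z. calc \<gamma> (\<lambda>l. f l * F (z * l)) x) \<circ> zs) n - calc \<gamma> (\<lambda>l. f l * F (z * l)) x)
       \<le> K * (\<integral>t. b n t \<partial>lborel) * norm x) sequentially"
      using diff unfolding \<phi>_def[abs_def] by simp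
    show "(\<lambda>n. K * (\<integral>t. b n t \<partial>lborel) * norm x) \<longlonglongrightarrow> 0"
      using tendsto_mult[OF tendsto_mult[OF tendsto_const[of K] I0] tendsto_const[of "norm x"]] by simp
  qed
qed

text \<open>
  Inserting the reproducing formula into the contour integral of \<open>f(A)F(wA)x\<close> and exchanging the
  integrals expresses it as an average of the vectors \<open>(f F\<^sub>w H\<^sub>z)(A) G(zA)x\<close>, where \<open>z\<close> runs
  along a ray. The operator norms decay exponentially in \<open>ln \<bar>w\<bar> - ln \<bar>z\<bar>\<close>.
\<close>

lemma calc_dilate_average_bound:
  assumes F: "sector_decay \<theta> sF cF F" and G: "sector_decay \<theta> sG cG G"
    and ab: "0 < \<alpha>" "0 < \<beta>" and \<delta>: "\<delta> + \<alpha> \<le> \<theta>" "\<delta> + \<beta> \<le> \<theta>" and t: "\<theta> \<le> pi"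
    and \<gamma>: "\<omega> < \<gamma>" "\<gamma> < \<delta>" "\<omega> < \<gamma>'" "\<gamma>' < \<delta>"
  obtains K where "0 < K" "\<And>f M w z x. f holomorphic_on sector \<theta> \<Longrightarrow> (\<And>l. l \<in> sector \<theta> \<Longrightarrow> cmod (f l) \<le> M) \<Longrightarrow>
    w \<in> sector \<alpha> \<Longrightarrow> z \<in> sector \<beta> \<Longrightarrow>
    ennreal (cmod (reproducing_constant G) * norm (calc \<gamma> (\<lambda>l. f l * F (w * l)) x)) \<le>
    ennreal (K * M) * (\<integral>\<^sup>+v. exp_conv_kernel sF sG (ln (cmod w)) (v + ln (cmod z)) *
       ennreal (norm (calc \<gamma>' (\<lambda>l. G (complex_of_real (exp v) * z * l)) x)) \<partial>lborel)"
proof -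
  have d: "\<delta> \<le> pi" "\<delta> \<le> \<theta>" "0 < \<theta>" "0 < \<gamma>" "\<gamma> < pi" using \<delta> t ab \<gamma> omega by auto
  have s: "sF > 0" "cF \<ge> 0" "sG > 0" "cG \<ge> 0" using F G by (auto simp: sector_decay_def)
  note P = sector_decay_conj_square[OF G less_imp_le[OF d(3)] t]
  note H = sector_decay_cnj[OF G less_imp_le[OF d(3)] t]
  obtain K where K: "0 < K"
    "\<And>\<delta> s c f b x. sector_decay \<delta> s c f \<Longrightarrow> \<gamma> < \<delta> \<Longrightarrow> \<delta> \<le> pi \<Longrightarrow> integrable lborel b \<Longrightarrow>
       (\<And>t v. \<bar>v\<bar> = \<gamma> \<Longrightarrow> cmod (f (exp (Complex t v))) \<le> b t) \<Longrightarrow>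
       norm (calc \<gamma> f x) \<le> K * (\<integral>t. b t \<partial>lborel) * norm x"
    using calc_norm_bound[OF \<gamma>(1) d(5)] by blast
  define \<theta>' where "\<theta>' = (\<omega> + \<gamma>) / 2"
  have t': "\<omega> < \<theta>'" "\<theta>' < \<gamma>" "\<theta>' < pi" "0 \<le> \<theta>'" using \<gamma> d omega by (auto simp: \<theta>'_def)
  have cosv: "cos v < cos \<theta>'" if "\<bar>v\<bar> = \<gamma>" for v
    by (rule cos_less_of_abs) (use that t' d in auto)
  obtain Kr where Kr: "0 < Kr"
    "\<And>\<zeta> x y. cos (Im \<zeta>) < cos \<theta>' \<Longrightarrow> cmod (res_pair x y \<zeta>) \<le> Kr * norm x * norm y"
    using res_pair_bound[OF t'(1,3)] by blast
  have main: "ennreal (cmod (reproducing_constant G) * norm (calc \<gamma> (\<lambda>l. f l * F (w * l)) x)) \<le>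
    ennreal (K * cF * cG * M) * (\<integral>\<^sup>+v. exp_conv_kernel sF sG (ln (cmod w)) (v + ln (cmod z)) *
       ennreal (norm (calc \<gamma>' (\<lambda>l. G (complex_of_real (exp v) * z * l)) x)) \<partial>lborel)"
    if f: "f holomorphic_on sector \<theta>" and M: "\<And>l. l \<in> sector \<theta> \<Longrightarrow> cmod (f l) \<le> M"
      and w: "w \<in> sector \<alpha>" and z: "z \<in> sector \<beta>" for f M w z x
  proof -
    have M0: "0 \<le> M"
      by (rule order_trans[OF norm_ge_zero M[of 1]]) (use d in \<open>auto simp: sector_def\<close>)
    define a where "a = ln (cmod w)"
    define b where "b = ln (cmod z)"
    define \<phi> where "\<phi> = (\<lambda>l. f l * F (w * l))"
    define zv where "zv v = complex_of_real (exp v) * z" for v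
    have zv: "zv v \<in> sector \<beta>" "ln (cmod (zv v)) = v + b" for v
      using scale_in_sector[OF z] sector_nonzero[OF z] by (auto simp: zv_def b_def norm_mult ln_mult)
    define X where "X = calc \<gamma> \<phi> x"
    define c\<phi> where "c\<phi> = cF * exp (sF * \<bar>ln (cmod w)\<bar>) * M"
    have \<phi>: "sector_decay \<delta> sF c\<phi> \<phi>"
      unfolding \<phi>_def c\<phi>_def
      by (rule sector_decay_mult[OF sector_decay_dilate[OF F w _ t]])
         (use f M M0 \<delta> sector_mono[OF d(2)] in \<open>auto intro: holomorphic_on_subset\<close>)
    have c\<phi>0: "0 \<le> c\<phi>" using \<phi> by (simp add: sector_decay_def)
    have \<phi>bd: "cmod (\<phi> (exp (Complex r v))) \<le> M * (cF * exp (- sF * \<bar>a + r\<bar>))" if v: "\<bar>v\<bar> = \<gamma>" for r v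
      unfolding \<phi>_def norm_mult a_def
    proof (rule mult_mono)
      show "cmod (f (exp (Complex r v))) \<le> M" by (rule M, rule exp_in_sector) (use v \<gamma> d t in auto)
      show "cmod (F (w * exp (Complex r v))) \<le> cF * exp (- sF * \<bar>ln (cmod w) + r\<bar>)"
        by (rule sector_decay_dilate_exp(2)[OF F w _ ab(1) t]) (use v \<gamma> \<delta> in auto)
    qed (use M0 in auto)
    have dilP: "sector_decay \<delta> sG (cG * cG * exp (sG * \<bar>ln (cmod (zv v))\<bar>)) (\<lambda>l. conj_square G (zv v * l))"
      and dilG: "sector_decay \<delta> sG (cG * exp (sG * \<bar>ln (cmod (zv v))\<bar>)) (\<lambda>l. G (zv v * l))"
      and dilH: "sector_decay \<delta> sG (cG * exp (sG * \<bar>ln (cmod (zv v))\<bar>)) (\<lambda>l. cnj (G (cnj (zv v * l))))" for v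
      using sector_decay_dilate[OF P zv(1) _ t, of \<delta> v] sector_decay_dilate[OF G zv(1) _ t, of \<delta> v]
        sector_decay_dilate[OF H zv(1) _ t, of \<delta> v] \<delta> by (auto simp: add.commute)
    define T where "T v = calc \<gamma> (\<lambda>l. \<phi> l * conj_square G (zv v * l)) x" for v
    have \<phi>P: "sector_decay \<delta> sG (cG * cG * exp (sG * \<bar>ln (cmod (zv v))\<bar>) * c\<phi>) (\<lambda>l. \<phi> l * conj_square G (zv v * l))" for v
      by (rule sector_decay_mult_decay[OF dilP \<phi>])
    define Q where "Q \<zeta> v = \<phi> (exp \<zeta>) * res_pair x X \<zeta> * conj_square G (zv v * exp \<zeta>)" for \<zeta> v
    \<comment> \<open>the constant, written as an integral along the ray through \<open>z e\<^sup>\<zeta>\<close>, is inserted under the contour integral\<close>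
    have A1: "reproducing_constant G * cinner X X = sector_integral \<gamma> (\<lambda>\<zeta>. \<integral>v. Q \<zeta> v \<partial>lborel)"
    proof -
      have "reproducing_constant G * cinner X X = sector_integral \<gamma> (\<lambda>\<zeta>. reproducing_constant G * (\<phi> (exp \<zeta>) * res_pair x X \<zeta>))"
        unfolding sector_integral_cmult using cinner_calc(1)[OF \<phi> \<gamma>(1,2) d(1), of x X] by (simp add: X_def)
      also have "\<dots> = sector_integral \<gamma> (\<lambda>\<zeta>. \<integral>v. Q \<zeta> v \<partial>lborel)"
      proof (rule sector_integral_cong)
        fix \<zeta> assume \<zeta>: "\<bar>Im \<zeta>\<bar> = \<gamma>"
        have "z * exp (Complex (Re \<zeta>) (Im \<zeta>)) \<in> sector \<theta>"
          by (rule sector_decay_dilate_exp(1)[OF G z _ ab(2) t]) (use \<zeta> \<gamma> \<delta> in auto)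
        then have "z * exp \<zeta> \<in> sector \<theta>" by simp
        from ray_integral_conj_square[OF G d(3) t this]
        have "reproducing_constant G = (\<integral>v. conj_square G (zv v * exp \<zeta>) \<partial>lborel)"
          by (simp add: zv_def mult.assoc)
        then show "reproducing_constant G * (\<phi> (exp \<zeta>) * res_pair x X \<zeta>) = (\<integral>v. Q \<zeta> v \<partial>lborel)"
          by (simp add: Q_def mult.commute)
      qed (use d in simp)
      finally show ?thesis .
    qed
    have A2: "sector_integral \<gamma> (\<lambda>\<zeta>. \<integral>v. Q \<zeta> v \<partial>lborel) = (\<integral>v. sector_integral \<gamma> (\<lambda>\<zeta>. Q \<zeta> v) \<partial>lborel)"
    proof (rule sector_integral_integral_swap)
      \<comment> \<open>half of the available decay in \<open>r\<close> is spent on separating the variables \<open>r\<close> and \<open>v\<close>\<close>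
      define m where "m = min sF sG / 2"
      have m: "m > 0" "2 * m \<le> sF" "m \<le> sG" using s by (auto simp: m_def)
      show "integrable lborel (\<lambda>r. c\<phi> * (Kr * norm x * norm X) * exp (- m * \<bar>r\<bar>))"
        "integrable lborel (\<lambda>v. cG * cG * exp (m * \<bar>b\<bar>) * exp (- m * \<bar>v\<bar>))"
        by (intro integrable_mult_right integrable_exp_abs m)+
      fix y :: real assume y: "\<bar>y\<bar> = \<gamma>"
      have "continuous_on UNIV (\<lambda>r. \<phi> (exp (Complex r y)))"
        by (rule holomorphic_continuous_on_line[OF sector_decay_exp(1)[OF \<phi> d(1)]]) (use y \<gamma> in auto)
      then have c1: "continuous_on UNIV (\<lambda>p::real \<times> real. \<phi> (exp (Complex (fst p) y)))"
        by (rule continuous_on_compose2) (auto intro!: continuous_intros)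
      have "res_pair x X holomorphic_on {\<zeta>. cos (Im \<zeta>) < cos \<theta>'}"
        by (rule res_pair_holomorphic[OF t'(1,3)]) auto
      then have "continuous_on UNIV (\<lambda>r. res_pair x X (Complex r y))"
        by (rule continuous_on_compose2[OF holomorphic_on_imp_continuous_on continuous_on_Complex_line])
           (use cosv[OF y] in auto)
      then have c2: "continuous_on UNIV (\<lambda>p::real \<times> real. res_pair x X (Complex (fst p) y))"
        by (rule continuous_on_compose2) (auto intro!: continuous_intros)
      have c3: "continuous_on UNIV (\<lambda>p::real \<times> real. conj_square G (zv (snd p) * exp (Complex (fst p) y)))"
      proof (rule continuous_on_compose2[where t="sector \<theta>" and g="conj_square G"])
        show "continuous_on (sector \<theta>) (conj_square G)"
          using P by (simp add: sector_decay_def holomorphic_on_imp_continuous_on)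
        show "continuous_on UNIV (\<lambda>p::real \<times> real. zv (snd p) * exp (Complex (fst p) y))"
          unfolding zv_def Complex_eq by (intro continuous_intros)
        show "(\<lambda>p::real \<times> real. zv (snd p) * exp (Complex (fst p) y)) ` UNIV \<subseteq> sector \<theta>"
          using sector_decay_dilate_exp(1)[OF G zv(1) _ ab(2) t] y \<gamma> \<delta> by auto
      qed
      show "continuous_on UNIV (\<lambda>p. Q (Complex (fst p) y) (snd p))"
        unfolding Q_def by (intro continuous_on_mult c1 c2 c3)
      fix r v :: real
      have 1: "cmod (\<phi> (exp (Complex r y))) \<le> c\<phi> * exp (- sF * \<bar>r\<bar>)"
        using sector_decay_exp(2)[OF \<phi> d(1), of "Complex r y"] y \<gamma> by auto
      have 2: "cmod (conj_square G (zv v * exp (Complex r y))) \<le> cG * cG * exp (- sG * \<bar>v + b + r\<bar>)"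
        using sector_decay_dilate_exp(2)[OF P zv(1) _ ab(2) t, of y v r] y \<gamma> \<delta> by (simp add: zv(2))
      have "cmod (Q (Complex r y) v) \<le> (c\<phi> * exp (- sF * \<bar>r\<bar>)) * (Kr * norm x * norm X) * (cG * cG * exp (- sG * \<bar>v + b + r\<bar>))"
        unfolding Q_def norm_mult
        using 1 2 Kr(2)[of "Complex r y" x X] cosv[OF y] c\<phi>0 s Kr(1) by (intro mult_mono) auto
      also have "\<dots> = (c\<phi> * (Kr * norm x * norm X) * (cG * cG)) * exp (- sF * \<bar>r\<bar> + - sG * \<bar>v + b + r\<bar>)"
        by (simp only: exp_add mult_ac)
      also have "\<dots> \<le> (c\<phi> * (Kr * norm x * norm X) * (cG * cG)) * exp (- m * \<bar>r\<bar> + (m * \<bar>b\<bar> + - m * \<bar>v\<bar>))"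
      proof (rule mult_left_mono)
        have "m * \<bar>v\<bar> \<le> m * (\<bar>v + b + r\<bar> + \<bar>b\<bar> + \<bar>r\<bar>)" using m by (intro mult_left_mono) auto
        moreover have "2 * m * \<bar>r\<bar> \<le> sF * \<bar>r\<bar>" "m * \<bar>v + b + r\<bar> \<le> sG * \<bar>v + b + r\<bar>"
          using m by (auto intro!: mult_right_mono)
        ultimately show "exp (- sF * \<bar>r\<bar> + - sG * \<bar>v + b + r\<bar>) \<le> exp (- m * \<bar>r\<bar> + (m * \<bar>b\<bar> + - m * \<bar>v\<bar>))"
          by (simp add: algebra_simps)
      qed (use c\<phi>0 Kr s in auto)
      also have "\<dots> = c\<phi> * (Kr * norm x * norm X) * exp (- m * \<bar>r\<bar>) * (cG * cG * exp (m * \<bar>b\<bar>) * exp (- m * \<bar>v\<bar>))"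
        by (simp only: exp_add mult_ac)
      finally show "cmod (Q (Complex r y) v) \<le> c\<phi> * (Kr * norm x * norm X) * exp (- m * \<bar>r\<bar>) * (cG * cG * exp (m * \<bar>b\<bar>) * exp (- m * \<bar>v\<bar>))" .
    qed (use d in auto)
    have A3: "sector_integral \<gamma> (\<lambda>\<zeta>. Q \<zeta> v) = cinner (T v) X" for v
      unfolding T_def cinner_calc(1)[OF \<phi>P \<gamma>(1,2) d(1)] Q_def by (simp add: mult_ac)
    define N where "N v = norm (calc \<gamma>' (\<lambda>l. G (zv v * l)) x)" for v
    define k where "k v = (\<integral>r. exp (- sF * \<bar>a + r\<bar>) * exp (- sG * \<bar>(v + b) + r\<bar>) \<partial>lborel)" for v
    have k: "ennreal (k v) = exp_conv_kernel sF sG a (v + b)" for v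
      unfolding k_def exp_conv_kernel_def
      by (rule nn_integral_eq_integral[symmetric, OF exp_product_integrable[OF s(1,3)]]) auto
    have Tbd: "norm (T v) \<le> K * cF * cG * M * k v * N v" for v
    proof -
      have "T v = calc \<gamma> (\<lambda>l. \<phi> l * cnj (G (cnj (zv v * l)))) (calc \<gamma>' (\<lambda>l. G (zv v * l)) x)"
        using calc_mult[OF sector_decay_mult_decay[OF dilH \<phi>] dilG \<gamma> \<gamma>(1,2) d(1), of v v x]
        by (simp add: T_def conj_square_def mult.assoc)
      also have "norm \<dots> \<le> K * (\<integral>r. M * (cF * exp (- sF * \<bar>a + r\<bar>)) * (cG * exp (- sG * \<bar>(v + b) + r\<bar>)) \<partial>lborel) * N v"
        unfolding N_def
      proof (rule K(2)[OF sector_decay_mult_decay[OF dilH \<phi>] \<gamma>(2) d(1)])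
        have "integrable lborel (\<lambda>r. M * cF * cG * (exp (- sF * \<bar>a + r\<bar>) * exp (- sG * \<bar>(v + b) + r\<bar>)))"
          by (intro integrable_mult_right exp_product_integrable s)
        then show "integrable lborel (\<lambda>r. M * (cF * exp (- sF * \<bar>a + r\<bar>)) * (cG * exp (- sG * \<bar>(v + b) + r\<bar>)))"
          by (simp add: mult_ac)
        fix r y :: real assume y: "\<bar>y\<bar> = \<gamma>"
        have "cmod (cnj (G (cnj (zv v * exp (Complex r y))))) \<le> cG * exp (- sG * \<bar>(v + b) + r\<bar>)"
          using sector_decay_dilate_exp(2)[OF H zv(1) _ ab(2) t, of y v r] y \<gamma> \<delta> unfolding zv(2) by simp
        then show "cmod (\<phi> (exp (Complex r y)) * cnj (G (cnj (zv v * exp (Complex r y))))) \<le>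
            M * (cF * exp (- sF * \<bar>a + r\<bar>)) * (cG * exp (- sG * \<bar>(v + b) + r\<bar>))"
          unfolding norm_mult using \<phi>bd[OF y, of r] M0 s by (intro mult_mono) auto
      qed
      also have "(\<integral>r. M * (cF * exp (- sF * \<bar>a + r\<bar>)) * (cG * exp (- sG * \<bar>(v + b) + r\<bar>)) \<partial>lborel) = M * cF * cG * k v"
      proof -
        have "(\<integral>r. M * (cF * exp (- sF * \<bar>a + r\<bar>)) * (cG * exp (- sG * \<bar>(v + b) + r\<bar>)) \<partial>lborel) =
          (\<integral>r. M * cF * cG * (exp (- sF * \<bar>a + r\<bar>) * exp (- sG * \<bar>(v + b) + r\<bar>)) \<partial>lborel)"
          by (simp only: mult_ac)
        then show ?thesis unfolding k_def by simp
      qed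
      finally show ?thesis by (simp add: mult_ac)
    qed
    define C where "C = K * cF * cG * M"
    have C0: "0 \<le> C" using K(1) s M0 by (simp add: C_def)
    have k0: "0 \<le> k v" for v unfolding k_def by (rule integral_nonneg_AE) auto
    have N0: "0 \<le> N v" for v by (simp add: N_def)
    let ?c0 = "cmod (reproducing_constant G)"
    have "ennreal (?c0 * norm X * norm X) = ennreal (cmod (\<integral>v. cinner (T v) X \<partial>lborel))"
    proof -
      have "reproducing_constant G * cinner X X = (\<integral>v. cinner (T v) X \<partial>lborel)"
        using A1 A2 A3 by simp
      then have "cmod (reproducing_constant G * cinner X X) = cmod (\<integral>v. cinner (T v) X \<partial>lborel)" by simp
      then show ?thesis by (simp add: norm_mult cinner_self norm_power power2_eq_square mult.assoc)
    qed
    also have "\<dots> \<le> (\<integral>\<^sup>+v. ennreal (cmod (cinner (T v) X)) \<partial>lborel)"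
      by (cases "integrable lborel (\<lambda>v. cinner (T v) X)")
         (auto simp: integral_norm_bound_ennreal not_integrable_integral_eq)
    also have "\<dots> \<le> (\<integral>\<^sup>+v. ennreal (norm X) * (ennreal C * (ennreal (k v) * ennreal (N v))) \<partial>lborel)"
    proof (rule nn_integral_mono)
      fix v
      have "cmod (cinner (T v) X) \<le> norm (T v) * norm X" by (rule norm_cinner_le)
      also have "\<dots> \<le> (C * k v * N v) * norm X"
        using Tbd[of v] by (intro mult_right_mono) (auto simp: C_def)
      finally have "cmod (cinner (T v) X) \<le> norm X * (C * (k v * N v))" by (simp add: mult_ac)
      then have "ennreal (cmod (cinner (T v) X)) \<le> ennreal (norm X * (C * (k v * N v)))" by (rule ennreal_leI)
      also have "\<dots> = ennreal (norm X) * (ennreal C * (ennreal (k v) * ennreal (N v)))"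
        using C0 k0[of v] N0[of v] by (simp add: ennreal_mult)
      finally show "ennreal (cmod (cinner (T v) X)) \<le> ennreal (norm X) * (ennreal C * (ennreal (k v) * ennreal (N v)))" .
    qed
    also have "\<dots> = ennreal (norm X) * (ennreal C * (\<integral>\<^sup>+v. ennreal (k v) * ennreal (N v) \<partial>lborel))"
    proof -
      have [measurable]: "(\<lambda>v. ennreal (k v)) \<in> borel_measurable lborel"
        unfolding k exp_conv_kernel_def by measurable
      have "continuous_on UNIV (\<lambda>v. calc \<gamma>' (\<lambda>l. 1 * G (zv v * l)) x)"
      proof (rule continuous_on_compose2[OF calc_dilate_continuous[where f="\<lambda>_. 1" and M=1, OF G _ _ \<gamma>(3) _ ab(2) t]])
        show "continuous_on UNIV zv" unfolding zv_def[abs_def] by (intro continuous_intros)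
      qed (use zv \<gamma> \<delta> in auto)
      then have "continuous_on UNIV N" unfolding N_def[abs_def] by (intro continuous_on_norm) simp
      then have [measurable]: "N \<in> borel_measurable lborel" using borel_measurable_continuous_onI by simp
      show ?thesis by (simp add: nn_integral_cmult)
    qed
    finally have fin: "ennreal (norm X) * ennreal (?c0 * norm X) \<le> ennreal (norm X) * (ennreal C * (\<integral>\<^sup>+v. ennreal (k v) * ennreal (N v) \<partial>lborel))"
      by (simp add: ennreal_mult[symmetric] mult_ac)
    have "ennreal (?c0 * norm X) \<le> ennreal C * (\<integral>\<^sup>+v. ennreal (k v) * ennreal (N v) \<partial>lborel)"
    proof (cases "X = 0")
      case False
      with fin show ?thesis by (subst (asm) ennreal_mult_le_mult_iff) auto
    qed simp
    then show ?thesis unfolding k by (simp add: X_def \<phi>_def C_def N_def zv_def a_def b_def)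
  qed
  show ?thesis
  proof (rule that[of "K * cF * cG + 1"])
    show "0 < K * cF * cG + 1" using K(1) s by (intro add_nonneg_pos mult_nonneg_nonneg) auto
    fix f M w z x
    assume f: "f holomorphic_on sector \<theta>" and M: "\<And>l. l \<in> sector \<theta> \<Longrightarrow> cmod (f l) \<le> M"
      and w: "w \<in> sector \<alpha>" and z: "z \<in> sector \<beta>"
    have M0: "0 \<le> M"
      by (rule order_trans[OF norm_ge_zero M[of 1]]) (use d in \<open>auto simp: sector_def\<close>)
    have "K * cF * cG * M \<le> (K * cF * cG + 1) * M" using M0 by (simp add: distrib_right)
    then have le: "ennreal (K * cF * cG * M) \<le> ennreal ((K * cF * cG + 1) * M)" by (rule ennreal_leI)
    show "ennreal (cmod (reproducing_constant G) * norm (calc \<gamma> (\<lambda>l. f l * F (w * l)) x)) \<le>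
    ennreal ((K * cF * cG + 1) * M) * (\<integral>\<^sup>+v. exp_conv_kernel sF sG (ln (cmod w)) (v + ln (cmod z)) *
       ennreal (norm (calc \<gamma>' (\<lambda>l. G (complex_of_real (exp v) * z * l)) x)) \<partial>lborel)"
      by (rule order_trans[OF main[OF f M w z] mult_right_mono[OF le]]) auto
  qed
qed

end

context sectorial_operator
begin

text \<open>
  Schur's test applied to the averages of the preceding lemma. The mass of the kernel is invariant
  under translations, so the constant is the same for all rays.
\<close>

lemma calc_dilate_ray_bound:
  assumes F: "sector_decay \<theta> sF cF F" and G: "sector_decay \<theta> sG cG G" and G0: "\<exists>z\<in>sector \<theta>. G z \<noteq> 0"
    and ab: "0 < \<alpha>" "0 < \<beta>" and \<delta>: "\<delta> + \<alpha> \<le> \<theta>" "\<delta> + \<beta> \<le> \<theta>" and t: "\<theta> \<le> pi"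
    and \<gamma>: "\<omega> < \<gamma>" "\<gamma> < \<delta>" "\<omega> < \<gamma>'" "\<gamma>' < \<delta>"
  obtains C where "0 < C" "\<And>f M w z x. f holomorphic_on sector \<theta> \<Longrightarrow> (\<And>l. l \<in> sector \<theta> \<Longrightarrow> cmod (f l) \<le> M) \<Longrightarrow>
    w \<in> sector \<alpha> \<Longrightarrow> z \<in> sector \<beta> \<Longrightarrow>
    (\<integral>\<^sup>+u. ennreal ((norm (calc \<gamma> (\<lambda>l. f l * F (complex_of_real (exp u) * w * l)) x))\<^sup>2) \<partial>lborel) \<le>
    ennreal ((C * M)\<^sup>2) * (\<integral>\<^sup>+v. ennreal ((norm (calc \<gamma>' (\<lambda>l. G (complex_of_real (exp v) * z * l)) x))\<^sup>2) \<partial>lborel)"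
proof -
  obtain K where K: "0 < K" "\<And>f M w z x. f holomorphic_on sector \<theta> \<Longrightarrow> (\<And>l. l \<in> sector \<theta> \<Longrightarrow> cmod (f l) \<le> M) \<Longrightarrow>
    w \<in> sector \<alpha> \<Longrightarrow> z \<in> sector \<beta> \<Longrightarrow>
    ennreal (cmod (reproducing_constant G) * norm (calc \<gamma> (\<lambda>l. f l * F (w * l)) x)) \<le>
    ennreal (K * M) * (\<integral>\<^sup>+v. exp_conv_kernel sF sG (ln (cmod w)) (v + ln (cmod z)) *
       ennreal (norm (calc \<gamma>' (\<lambda>l. G (complex_of_real (exp v) * z * l)) x)) \<partial>lborel)"
    using calc_dilate_average_bound[OF F G ab \<delta> t \<gamma>] by blast
  have s: "sF > 0" "sG > 0" using F G by (auto simp: sector_decay_def)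
  have th: "0 < \<theta>" using ab \<delta> \<gamma> omega by auto
  define c0 where "c0 = cmod (reproducing_constant G)"
  have c0: "0 < c0" using reproducing_constant_nonzero[OF G th t G0] by (simp add: c0_def)
  define E where "E = exp_mass sF * exp_mass sG"
  have E0: "0 \<le> E" by (simp add: E_def exp_mass_nonneg)
  define C where "C = K / c0 * (E + 1)"
  have C0: "0 < C" using K(1) c0 E0 by (simp add: C_def)
  show ?thesis
  proof (rule that[OF C0])
    fix f M w z x
    assume f: "f holomorphic_on sector \<theta>" and M: "\<And>l. l \<in> sector \<theta> \<Longrightarrow> cmod (f l) \<le> M"
      and w: "w \<in> sector \<alpha>" and z: "z \<in> sector \<beta>"
    have M0: "0 \<le> M"
      by (rule order_trans[OF norm_ge_zero M[of 1]]) (use th in \<open>auto simp: sector_def\<close>)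
    define X where "X u = norm (calc \<gamma> (\<lambda>l. f l * F (complex_of_real (exp u) * w * l)) x)" for u
    define N where "N v = ennreal (norm (calc \<gamma>' (\<lambda>l. G (complex_of_real (exp v) * z * l)) x))" for v
    define k where "k u v = exp_conv_kernel sF sG (u + ln (cmod w)) (v + ln (cmod z))" for u v
    have kmeas: "(\<lambda>(u, v). k u v) \<in> borel_measurable (lborel \<Otimes>\<^sub>M lborel)"
      unfolding k_def by (rule exp_conv_kernel_measurable)
    have Nmeas[measurable]: "N \<in> borel_measurable lborel"
    proof -
      have "continuous_on UNIV (\<lambda>v. calc \<gamma>' (\<lambda>l. 1 * G ((complex_of_real (exp v) * z) * l)) x)"
      proof (rule continuous_on_compose2[OF calc_dilate_continuous[where f="\<lambda>_. 1" and M=1, OF G _ _ \<gamma>(3) _ ab(2) t]])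
        show "continuous_on UNIV (\<lambda>v. complex_of_real (exp v) * z)" by (intro continuous_intros)
      qed (use scale_in_sector[OF z] \<gamma> \<delta> in auto)
      then have "continuous_on UNIV (\<lambda>v. norm (calc \<gamma>' (\<lambda>l. G (complex_of_real (exp v) * z * l)) x))"
        by (intro continuous_on_norm) simp
      from borel_measurable_continuous_onI[OF this] show ?thesis unfolding N_def[abs_def] by simp
    qed
    have step: "ennreal (X u) \<le> ennreal (K * M / c0) * (\<integral>\<^sup>+v. k u v * N v \<partial>lborel)" for u
    proof -
      let ?w = "complex_of_real (exp u) * w"
      have "ln (cmod ?w) = u + ln (cmod w)" using sector_nonzero[OF w] by (simp add: norm_mult ln_mult)
      with K(2)[OF f M scale_in_sector[OF w] z, of u x]
      have 1: "ennreal (c0 * X u) \<le> ennreal (K * M) * (\<integral>\<^sup>+v. k u v * N v \<partial>lborel)"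
        by (simp add: c0_def X_def k_def N_def)
      have "ennreal (X u) = ennreal (1 / c0) * ennreal (c0 * X u)"
        using c0 by (simp add: ennreal_mult[symmetric] X_def)
      also have "\<dots> \<le> ennreal (1 / c0) * (ennreal (K * M) * (\<integral>\<^sup>+v. k u v * N v \<partial>lborel))"
        by (rule mult_left_mono[OF 1]) simp
      also have "\<dots> = ennreal (K * M / c0) * (\<integral>\<^sup>+v. k u v * N v \<partial>lborel)"
        using c0 K(1) M0 by (simp add: ennreal_mult[symmetric] mult.assoc[symmetric])
      finally show ?thesis .
    qed
    have Jmeas[measurable]: "(\<lambda>u. \<integral>\<^sup>+v. k u v * N v \<partial>lborel) \<in> borel_measurable lborel"
      using kmeas by measurable
    have "(\<integral>\<^sup>+u. ennreal ((X u)\<^sup>2) \<partial>lborel) \<le> (\<integral>\<^sup>+u. ennreal ((K * M / c0)\<^sup>2) * (\<integral>\<^sup>+v. k u v * N v \<partial>lborel)\<^sup>2 \<partial>lborel)"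
    proof (rule nn_integral_mono)
      fix u
      have "ennreal ((X u)\<^sup>2) = (ennreal (X u))\<^sup>2" by (simp add: ennreal_power X_def)
      also have "\<dots> \<le> (ennreal (K * M / c0) * (\<integral>\<^sup>+v. k u v * N v \<partial>lborel))\<^sup>2"
        by (rule power_mono[OF step]) simp
      also have "\<dots> = ennreal ((K * M / c0)\<^sup>2) * (\<integral>\<^sup>+v. k u v * N v \<partial>lborel)\<^sup>2"
        using K(1) M0 c0 by (simp add: power_mult_distrib ennreal_power)
      finally show "ennreal ((X u)\<^sup>2) \<le> ennreal ((K * M / c0)\<^sup>2) * (\<integral>\<^sup>+v. k u v * N v \<partial>lborel)\<^sup>2" .
    qed
    also have "\<dots> = ennreal ((K * M / c0)\<^sup>2) * (\<integral>\<^sup>+u. (\<integral>\<^sup>+v. k u v * N v \<partial>lborel)\<^sup>2 \<partial>lborel)"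
      by (rule nn_integral_cmult) measurable
    also have "\<dots> \<le> ennreal ((K * M / c0)\<^sup>2) * ((ennreal E)\<^sup>2 * (\<integral>\<^sup>+v. (N v)\<^sup>2 \<partial>lborel))"
    proof (intro mult_left_mono schur_test[OF kmeas Nmeas])
      show "(\<integral>\<^sup>+v. k u v \<partial>lborel) \<le> ennreal E" for u
        unfolding k_def E_def by (simp add: exp_conv_kernel_mass(1)[OF s])
      show "(\<integral>\<^sup>+u. k u v \<partial>lborel) \<le> ennreal E" for v
        unfolding k_def E_def by (simp add: exp_conv_kernel_mass(2)[OF s])
    qed simp
    also have "\<dots> = ennreal ((K * M / c0 * E)\<^sup>2) * (\<integral>\<^sup>+v. (N v)\<^sup>2 \<partial>lborel)"
    proof -
      have "(ennreal E)\<^sup>2 = ennreal (E\<^sup>2)" by (simp add: ennreal_power E0)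
      then show ?thesis
        by (simp only: mult.assoc[symmetric] ennreal_mult[symmetric, OF zero_le_power2 zero_le_power2] power_mult_distrib)
    qed
    also have "\<dots> \<le> ennreal ((C * M)\<^sup>2) * (\<integral>\<^sup>+v. (N v)\<^sup>2 \<partial>lborel)"
    proof (intro mult_right_mono ennreal_leI power_mono)
      have "K * M / c0 * E \<le> K * M / c0 * (E + 1)" using K(1) M0 c0 by (intro mult_left_mono) auto
      then show "K * M / c0 * E \<le> C * M" by (simp add: C_def mult_ac)
      show "0 \<le> K * M / c0 * E" using K(1) M0 c0 E0 by simp
    qed simp
    finally show "(\<integral>\<^sup>+u. ennreal ((norm (calc \<gamma> (\<lambda>l. f l * F (complex_of_real (exp u) * w * l)) x))\<^sup>2) \<partial>lborel) \<le>
      ennreal ((C * M)\<^sup>2) * (\<integral>\<^sup>+v. ennreal ((norm (calc \<gamma>' (\<lambda>l. G (complex_of_real (exp v) * z * l)) x))\<^sup>2) \<partial>lborel)"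
      by (simp add: X_def N_def ennreal_power)
  qed
qed

end

section \<open>From rays to sectors\<close>

lemma nn_integral_complex_scale:
  fixes g :: "complex \<Rightarrow> ennreal"
  assumes [measurable]: "g \<in> borel_measurable borel" and c: "0 < c"
  shows "(\<integral>\<^sup>+z. g z \<partial>lborel) = (\<integral>\<^sup>+z. ennreal (c\<^sup>2) * g (complex_of_real c * z) \<partial>lborel)"
proof -
  have "(\<integral>\<^sup>+z. g z \<partial>lborel) = (\<integral>\<^sup>+z. g z \<partial>density (distr lborel borel (\<lambda>z. 0 + c *\<^sub>R z)) (\<lambda>_. \<bar>c\<bar> ^ DIM(complex)))"
    using lborel_affine[of c "0::complex"] c by simp
  also have "\<dots> = (\<integral>\<^sup>+z. ennreal (c\<^sup>2) * g (c *\<^sub>R z) \<partial>lborel)"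
    using c by (simp add: nn_integral_density nn_integral_distr)
  finally show ?thesis by (simp add: scaleR_conv_of_real)
qed

definition annular_sector :: "real \<Rightarrow> complex set" where
  "annular_sector a = {z \<in> sector a. 0 \<le> ln (cmod z) \<and> ln (cmod z) \<le> 1}"

definition invariant_density :: "complex \<Rightarrow> ennreal" where
  "invariant_density z = ennreal (1 / (cmod z)\<^sup>2)"

lemma sector_measurable: "0 \<le> a \<Longrightarrow> a \<le> pi \<Longrightarrow> sector a \<in> sets borel"
  using open_sector by simp

lemma annular_sector_measurable: "0 \<le> a \<Longrightarrow> a \<le> pi \<Longrightarrow> annular_sector a \<in> sets borel"
proof -
  assume a: "0 \<le> a" "a \<le> pi"
  have "annular_sector a = sector a \<inter> {z \<in> space borel. 0 \<le> ln (cmod z) \<and> ln (cmod z) \<le> 1}"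
    by (auto simp: annular_sector_def)
  also have "\<dots> \<in> sets borel"
  proof (intro sets.Int sector_measurable[OF a])
    show "{z \<in> space borel. 0 \<le> ln (cmod z) \<and> ln (cmod z) \<le> 1} \<in> sets borel" by measurable
  qed
  finally show ?thesis .
qed

lemma invariant_density_measurable [measurable]: "invariant_density \<in> borel_measurable borel"
  unfolding invariant_density_def[abs_def] by measurable

text \<open>
  A substitute for polar coordinates that uses nothing but the invariance of \<open>dm(z)/\<bar>z\<bar>\<^sup>2\<close>
  under dilations: the integral over the sector is the integral, over the part of the sector where
  \<open>1 \<le> \<bar>z\<bar> \<le> e\<close>, of the integrals along the rays through its points.
\<close>

lemma nn_integral_sector_rays:
  fixes \<Phi> :: "complex \<Rightarrow> ennreal"
  assumes a: "0 \<le> a" "a \<le> pi"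
    and \<Phi>: "(\<lambda>z. indicator (sector a) z * \<Phi> z) \<in> borel_measurable borel"
  shows "(\<integral>\<^sup>+z. indicator (sector a) z * \<Phi> z * invariant_density z \<partial>lborel) =
    (\<integral>\<^sup>+z. indicator (annular_sector a) z * invariant_density z * (\<integral>\<^sup>+u. \<Phi> (complex_of_real (exp u) * z) \<partial>lborel) \<partial>lborel)"
proof -
  define \<Psi> where "\<Psi> z = indicator (sector a) z * \<Phi> z * invariant_density z" for z
  have \<Psi>m[measurable]: "\<Psi> \<in> borel_measurable borel"
    unfolding \<Psi>_def[abs_def] using \<Phi> by measurable
  \<comment> \<open>a weight in \<open>ln \<bar>z\<bar>\<close> of total mass one; averaging it over all dilations gives the constant one\<close>
  define \<eta> :: "real \<Rightarrow> ennreal" where "\<eta> = indicator {0..1}"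
  have \<eta>m[measurable]: "\<eta> \<in> borel_measurable borel" unfolding \<eta>_def by measurable
  have one: "(\<integral>\<^sup>+u. \<eta> (c - u) \<partial>lborel) = 1" for c
  proof -
    have "(\<integral>\<^sup>+u. \<eta> (c - u) \<partial>lborel) = (\<integral>\<^sup>+u. indicator {c - 1..c} u \<partial>lborel)"
      by (intro nn_integral_cong) (auto simp: \<eta>_def indicator_def)
    then show ?thesis by simp
  qed
  have dens: "invariant_density z = ennreal ((exp u)\<^sup>2) * invariant_density (complex_of_real (exp u) * z)" for u z
    by (cases "z = 0") (auto simp: invariant_density_def norm_mult power_mult_distrib ennreal_mult[symmetric])
  have point: "indicator (annular_sector a) z * invariant_density z * \<Phi> (complex_of_real (exp u) * z) =
      ennreal ((exp u)\<^sup>2) * (\<eta> (ln (cmod (complex_of_real (exp u) * z)) - u) * \<Psi> (complex_of_real (exp u) * z))" for u z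
  proof (cases "z \<in> sector a")
    case True
    have "ln (cmod (complex_of_real (exp u) * z)) - u = ln (cmod z)"
      using sector_nonzero[OF True] by (simp add: norm_mult ln_mult)
    moreover have "indicator (annular_sector a) z = \<eta> (ln (cmod z))"
      using True by (simp add: annular_sector_def \<eta>_def indicator_def)
    ultimately show ?thesis
      using True scale_in_sector[OF True, of u] unfolding \<Psi>_def dens[of z u] by (simp add: mult_ac)
  next
    case False
    then show ?thesis by (simp add: annular_sector_def \<Psi>_def scale_in_sector_iff)
  qed
  have ray: "indicator (annular_sector a) z * invariant_density z * (\<integral>\<^sup>+u. \<Phi> (complex_of_real (exp u) * z) \<partial>lborel) =
      (\<integral>\<^sup>+u. ennreal ((exp u)\<^sup>2) * (\<eta> (ln (cmod (complex_of_real (exp u) * z)) - u) * \<Psi> (complex_of_real (exp u) * z)) \<partial>lborel)" for z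
  proof (cases "z \<in> sector a")
    case True
    have "(\<lambda>u. indicator (sector a) (complex_of_real (exp u) * z) * \<Phi> (complex_of_real (exp u) * z)) \<in> borel_measurable borel"
      by (rule measurable_compose[OF _ \<Phi>]) measurable
    then have "(\<lambda>u. \<Phi> (complex_of_real (exp u) * z)) \<in> borel_measurable lborel"
      using scale_in_sector[OF True] by simp
    then show ?thesis unfolding point[symmetric] by (rule nn_integral_cmult[symmetric])
  next
    case False
    then show ?thesis by (simp add: annular_sector_def \<Psi>_def scale_in_sector_iff)
  qed
  have "(\<integral>\<^sup>+z. \<Psi> z \<partial>lborel) = (\<integral>\<^sup>+z. (\<integral>\<^sup>+u. \<eta> (ln (cmod z) - u) * \<Psi> z \<partial>lborel) \<partial>lborel)"
    by (intro nn_integral_cong) (simp add: nn_integral_multc one)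
  also have "\<dots> = (\<integral>\<^sup>+u. (\<integral>\<^sup>+z. \<eta> (ln (cmod z) - u) * \<Psi> z \<partial>lborel) \<partial>lborel)"
    by (rule lborel_pair.Fubini') measurable
  also have "\<dots> = (\<integral>\<^sup>+u. (\<integral>\<^sup>+z. ennreal ((exp u)\<^sup>2) * (\<eta> (ln (cmod (complex_of_real (exp u) * z)) - u) * \<Psi> (complex_of_real (exp u) * z)) \<partial>lborel) \<partial>lborel)"
    by (intro nn_integral_cong nn_integral_complex_scale) auto
  also have "\<dots> = (\<integral>\<^sup>+z. (\<integral>\<^sup>+u. ennreal ((exp u)\<^sup>2) * (\<eta> (ln (cmod (complex_of_real (exp u) * z)) - u) * \<Psi> (complex_of_real (exp u) * z)) \<partial>lborel) \<partial>lborel)"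
    by (rule lborel_pair.Fubini') measurable
  also have "\<dots> = (\<integral>\<^sup>+z. indicator (annular_sector a) z * invariant_density z * (\<integral>\<^sup>+u. \<Phi> (complex_of_real (exp u) * z) \<partial>lborel) \<partial>lborel)"
    by (simp add: ray)
  finally show ?thesis by (simp add: \<Psi>_def)
qed

text \<open>
  The averages over rays are normalized by this number, which must therefore be neither zero nor
  infinite.
\<close>

lemma annular_sector_mass:
  assumes a: "0 < a" "a < pi"
  obtains m where "0 < m" "(\<integral>\<^sup>+z. indicator (annular_sector a) z * invariant_density z \<partial>lborel) = ennreal m"
proof -
  have [measurable]: "annular_sector a \<in> sets borel" using annular_sector_measurable[of a] a by simp
  let ?I = "\<integral>\<^sup>+z. indicator (annular_sector a) z * invariant_density z \<partial>lborel"
  have nz: "1 \<le> cmod z" "cmod z < 3" if "z \<in> annular_sector a" for z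
  proof -
    have z: "z \<noteq> 0" "0 \<le> ln (cmod z)" "ln (cmod z) \<le> 1" using that sector_nonzero by (auto simp: annular_sector_def)
    then show "1 \<le> cmod z" by simp
    have "cmod z = exp (ln (cmod z))" using z by simp
    also have "\<dots> \<le> exp 1" using z(3) by (simp only: exp_le_cancel_iff)
    also have "\<dots> < 3" using e_less_272 by simp
    finally show "cmod z < 3" .
  qed
  have "?I \<le> (\<integral>\<^sup>+z. indicator (ball 0 3) z \<partial>(lborel :: complex measure))"
  proof (rule nn_integral_mono)
    fix z :: complex
    show "indicator (annular_sector a) z * invariant_density z \<le> indicator (ball 0 3) z"
    proof (cases "z \<in> annular_sector a")
      case True
      have "1 \<le> (cmod z)\<^sup>2" by (rule one_le_power[OF nz(1)[OF True]])
      then have "1 / (cmod z)\<^sup>2 \<le> 1" by (simp add: divide_le_eq_1)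
      then have "invariant_density z \<le> 1" unfolding invariant_density_def by (simp add: ennreal_le_1)
      then show ?thesis using True nz(2)[OF True] by simp
    qed simp
  qed
  also have "\<dots> < \<infinity>" using emeasure_lborel_ball_finite[of "0::complex" 3] by simp
  finally have fin: "?I < \<infinity>" .
  have "?I \<noteq> 0"
  proof
    assume "?I = 0"
    then have "AE z in lborel. indicator (annular_sector a) z * invariant_density z = 0"
      by (subst (asm) nn_integral_0_iff_AE) measurable
    then have "AE z in lborel. z \<notin> annular_sector a"
    proof (rule AE_mp, intro AE_I2 impI)
      fix z :: complex assume "indicator (annular_sector a) z * invariant_density z = 0"
      then show "z \<notin> annular_sector a"
        using nz(1)[of z] by (auto simp: invariant_density_def indicator_def ennreal_eq_0_iff split: if_splits)
    qed
    then have null: "annular_sector a \<in> null_sets lborel"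
      by (subst (asm) AE_iff_null_sets[symmetric]) auto
    define U where "U = sector a \<inter> {z. 1 < cmod z} \<inter> {z. cmod z < exp 1}"
    have "U \<subseteq> annular_sector a"
    proof
      fix z assume z: "z \<in> U"
      then have "0 < cmod z" by (auto simp: U_def)
      moreover from this z have "ln (cmod z) \<le> 1"
        using ln_mono[of "cmod z" "exp 1"] by (simp add: U_def)
      ultimately show "z \<in> annular_sector a" using z by (simp add: U_def annular_sector_def)
    qed
    moreover have "open U" unfolding U_def
      using open_sector[of a] a by (intro open_Int open_Collect_less continuous_intros) auto
    ultimately have "U \<in> null_sets lborel"
      using null_sets_subset[OF null] by auto
    then have "negligible U"
      using null_sets_completionI negligible_iff_null_sets by blast
    moreover have "complex_of_real (3 / 2) \<in> U"
    proof -
      have "cmod (complex_of_real (3 / 2)) = 3 / 2" "Arg (complex_of_real (3 / 2)) = 0" "complex_of_real (3 / 2) \<noteq> 0"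
        by (simp_all only: norm_of_real Arg_of_real) auto
      then show ?thesis
        using a exp_ge_add_one_self[of "1::real"] unfolding U_def sector_def by auto
    qed
    ultimately show False using open_not_negligible[OF \<open>open U\<close>] by blast
  qed
  then show ?thesis
    using fin by (intro that[of "enn2real ?I"]) (auto simp: enn2real_positive_iff zero_less_iff_neq_zero)
qed

lemma ennsqrt_le:
  assumes "a \<le> ennreal (C\<^sup>2) * b" "0 < C"
  shows "ennsqrt a \<le> ennreal C * ennsqrt b"
proof (cases "b = \<infinity>")
  case True
  then show ?thesis using assms(2) by (simp add: ennsqrt_def ennreal_mult_top)
next
  case False
  then obtain r where r: "b = ennreal r" "0 \<le> r" by (cases b) auto
  have "a \<le> ennreal (C\<^sup>2 * r)" using assms r by (simp add: ennreal_mult)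
  then obtain q where q: "a = ennreal q" "0 \<le> q" "q \<le> C\<^sup>2 * r"
    by (cases a) (auto simp: top_unique r)
  have "sqrt q \<le> C * sqrt r"
    using real_sqrt_le_mono[OF q(3)] assms(2) by (simp add: real_sqrt_mult)
  then show ?thesis
    using q r assms(2) by (simp add: ennsqrt_def ennreal_mult[symmetric])
qed

lemma sector_L2_norm_eq:
  "sector_L2_norm a u = ennsqrt (\<integral>\<^sup>+z. indicator (sector a) z * ennreal ((norm (u z))\<^sup>2) * invariant_density z \<partial>lborel)"
  unfolding sector_L2_norm_def invariant_density_def
  by (intro arg_cong[of _ _ ennsqrt] nn_integral_cong) (simp add: ennreal_mult[symmetric] mult.commute indicator_def)

lemma sector_L2_norm_cong:
  "(\<And>z. z \<in> sector a \<Longrightarrow> u z = v z) \<Longrightarrow> sector_L2_norm a u = sector_L2_norm a v"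
  unfolding sector_L2_norm_eq by (intro arg_cong[of _ _ ennsqrt] nn_integral_cong) (simp add: indicator_def)

context sectorial_operator
begin

lemma calc_dilate_sector_measurable:
  assumes "sector_decay \<theta> s c F" "f holomorphic_on sector \<theta>" "\<And>z. z \<in> sector \<theta> \<Longrightarrow> cmod (f z) \<le> M"
    "\<omega> < \<gamma>" "\<gamma> + a < \<theta>" "0 < a" "\<theta> \<le> pi"
  shows "(\<lambda>z. indicator (sector a) z * ennreal ((norm (calc \<gamma> (\<lambda>l. f l * F (z * l)) x))\<^sup>2)) \<in> borel_measurable borel"
proof -
  have "open (sector a)" using assms omega by (intro open_sector) auto
  have c: "continuous_on (sector a) (\<lambda>z. (norm (calc \<gamma> (\<lambda>l. f l * F (z * l)) x))\<^sup>2)"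
    by (intro continuous_intros calc_dilate_continuous[OF assms])
  have "(\<lambda>z. indicator (sector a) z *\<^sub>R (norm (calc \<gamma> (\<lambda>l. f l * F (z * l)) x))\<^sup>2) \<in> borel_measurable borel"
    by (rule borel_measurable_continuous_on_indicator[OF _ c]) (use \<open>open (sector a)\<close> in auto)
  then have "(\<lambda>z. ennreal (indicator (sector a) z *\<^sub>R (norm (calc \<gamma> (\<lambda>l. f l * F (z * l)) x))\<^sup>2)) \<in> borel_measurable borel"
    by measurable
  then show ?thesis
    by (rule measurable_cong[THEN iffD1, rotated]) (simp add: indicator_def)
qed

text \<open>
  The estimate between rays is integrated over the annular part of either sector. All functions of the
  calculus live on the sector of angle \<open>\<delta> = \<theta> - max \<alpha> \<beta>\<close>, which contains the contours used for
  \<open>F(wA)\<close>, \<open>G(zA)\<close> and \<open>f(A)\<close> exactly because \<open>\<alpha>\<close> and \<open>\<beta>\<close> are less than \<open>(\<theta> - \<omega>)/2\<close>.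
\<close>

lemma sector_L2_estimate:
  assumes F: "F \<in> Hinf0 \<theta>" and G: "G \<in> Hinf0 \<theta>" and G0: "\<exists>z\<in>sector \<theta>. G z \<noteq> 0"
    and t: "\<omega> < \<theta>" "\<theta> < pi"
    and a: "0 < \<alpha>" "\<alpha> < (\<theta> - \<omega>) / 2" and b: "0 < \<beta>" "\<beta> < (\<theta> - \<omega>) / 2"
  obtains K where "0 < K" "\<And>f M x. f holomorphic_on sector \<theta> \<Longrightarrow> (\<And>l. l \<in> sector \<theta> \<Longrightarrow> cmod (f l) \<le> M) \<Longrightarrow>
    sector_L2_norm \<alpha> (\<lambda>z. calc ((\<omega> + (\<theta> - \<alpha>)) / 2) (\<lambda>l. f l * F (z * l)) x) \<le> ennreal (K * M) * area_norm A \<omega> \<theta> G \<beta> x"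
proof -
  obtain sF cF where F': "sector_decay \<theta> sF cF F" using Hinf0_decay[OF F] by blast
  obtain sG cG where G': "sector_decay \<theta> sG cG G" using Hinf0_decay[OF G] by blast
  define \<delta> where "\<delta> = \<theta> - max \<alpha> \<beta>"
  define \<gamma> where "\<gamma> = (\<omega> + (\<theta> - \<alpha>)) / 2"
  define \<gamma>' where "\<gamma>' = (\<omega> + (\<theta> - \<beta>)) / 2"
  have d: "\<delta> + \<alpha> \<le> \<theta>" "\<delta> + \<beta> \<le> \<theta>" by (auto simp: \<delta>_def)
  have g: "\<omega> < \<gamma>" "\<gamma> < \<delta>" "\<omega> < \<gamma>'" "\<gamma>' < \<delta>"
    using a b t by (auto simp: \<gamma>_def \<gamma>'_def \<delta>_def max_def field_simps)
  have ta: "\<alpha> < pi" "\<beta> < pi" "\<theta> \<le> pi" using a b t omega by auto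
  obtain C where C: "0 < C" "\<And>f M w z x. f holomorphic_on sector \<theta> \<Longrightarrow> (\<And>l. l \<in> sector \<theta> \<Longrightarrow> cmod (f l) \<le> M) \<Longrightarrow>
    w \<in> sector \<alpha> \<Longrightarrow> z \<in> sector \<beta> \<Longrightarrow>
    (\<integral>\<^sup>+u. ennreal ((norm (calc \<gamma> (\<lambda>l. f l * F (complex_of_real (exp u) * w * l)) x))\<^sup>2) \<partial>lborel) \<le>
    ennreal ((C * M)\<^sup>2) * (\<integral>\<^sup>+v. ennreal ((norm (calc \<gamma>' (\<lambda>l. G (complex_of_real (exp v) * z * l)) x))\<^sup>2) \<partial>lborel)"
    using calc_dilate_ray_bound[OF F' G' G0 a(1) b(1) d ta(3) g] by blast
  obtain ma where ma: "0 < ma" "(\<integral>\<^sup>+z. indicator (annular_sector \<alpha>) z * invariant_density z \<partial>lborel) = ennreal ma"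
    using annular_sector_mass[OF a(1) ta(1)] by blast
  obtain mb where mb: "0 < mb" "(\<integral>\<^sup>+z. indicator (annular_sector \<beta>) z * invariant_density z \<partial>lborel) = ennreal mb"
    using annular_sector_mass[OF b(1) ta(2)] by blast
  have [measurable]: "annular_sector \<alpha> \<in> sets borel" "annular_sector \<beta> \<in> sets borel"
    using annular_sector_measurable a b ta by auto
  define K where "K = C * sqrt (ma / mb)"
  have K0: "0 < K" using C ma mb by (simp add: K_def)
  have K2: "K\<^sup>2 = C\<^sup>2 * (ma / mb)" using ma mb by (simp add: K_def power_mult_distrib)
  show ?thesis
  proof (rule that[OF K0])
    fix f M x
    assume f: "f holomorphic_on sector \<theta>" and M: "\<And>l. l \<in> sector \<theta> \<Longrightarrow> cmod (f l) \<le> M"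
    have M0: "0 \<le> M"
      by (rule order_trans[OF norm_ge_zero M[of 1]]) (use t omega in \<open>auto simp: sector_def\<close>)
    define \<Phi> where "\<Phi> z = ennreal ((norm (calc \<gamma> (\<lambda>l. f l * F (z * l)) x))\<^sup>2)" for z
    define \<Gamma> where "\<Gamma> z = ennreal ((norm (calc \<gamma>' (\<lambda>l. G (z * l)) x))\<^sup>2)" for z
    have \<Phi>m: "(\<lambda>z. indicator (sector \<alpha>) z * \<Phi> z) \<in> borel_measurable borel"
      unfolding \<Phi>_def by (rule calc_dilate_sector_measurable[OF F' f M g(1) _ a(1) ta(3)]) (use g d in auto)
    have "(\<lambda>z. indicator (sector \<beta>) z * ennreal ((norm (calc \<gamma>' (\<lambda>l. 1 * G (z * l)) x))\<^sup>2)) \<in> borel_measurable borel"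
      by (rule calc_dilate_sector_measurable[where f="\<lambda>_. 1" and M=1, OF G' _ _ g(3) _ b(1) ta(3)]) (use g d in auto)
    then have \<Gamma>m: "(\<lambda>z. indicator (sector \<beta>) z * \<Gamma> z) \<in> borel_measurable borel"
      unfolding \<Gamma>_def by simp
    define IF where "IF = (\<integral>\<^sup>+z. indicator (sector \<alpha>) z * \<Phi> z * invariant_density z \<partial>lborel)"
    define IG where "IG = (\<integral>\<^sup>+z. indicator (sector \<beta>) z * \<Gamma> z * invariant_density z \<partial>lborel)"
    define rF where "rF w = (\<integral>\<^sup>+u. \<Phi> (complex_of_real (exp u) * w) \<partial>lborel)" for w
    define rG where "rG z = (\<integral>\<^sup>+u. \<Gamma> (complex_of_real (exp u) * z) \<partial>lborel)" for z
    have IF: "IF = (\<integral>\<^sup>+w. indicator (annular_sector \<alpha>) w * invariant_density w * rF w \<partial>lborel)"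
      unfolding IF_def rF_def by (rule nn_integral_sector_rays[OF _ _ \<Phi>m]) (use a ta in auto)
    have IG: "IG = (\<integral>\<^sup>+z. indicator (annular_sector \<beta>) z * invariant_density z * rG z \<partial>lborel)"
      unfolding IG_def rG_def by (rule nn_integral_sector_rays[OF _ _ \<Gamma>m]) (use b ta in auto)
    have ray: "rF w \<le> ennreal ((C * M)\<^sup>2) * rG z" if "w \<in> sector \<alpha>" "z \<in> sector \<beta>" for w z
      unfolding rF_def rG_def \<Phi>_def \<Gamma>_def by (rule C(2)[OF f M that])
    have 1: "IF \<le> ennreal ma * (ennreal ((C * M)\<^sup>2) * rG z)" if z: "z \<in> sector \<beta>" for z
    proof -
      have "IF \<le> (\<integral>\<^sup>+w. indicator (annular_sector \<alpha>) w * invariant_density w * (ennreal ((C * M)\<^sup>2) * rG z) \<partial>lborel)"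
        unfolding IF
      proof (rule nn_integral_mono)
        fix w
        show "indicator (annular_sector \<alpha>) w * invariant_density w * rF w \<le>
          indicator (annular_sector \<alpha>) w * invariant_density w * (ennreal ((C * M)\<^sup>2) * rG z)"
          using ray[OF _ z, of w] by (cases "w \<in> annular_sector \<alpha>") (auto simp: annular_sector_def intro: mult_left_mono)
      qed
      also have "\<dots> = ennreal ma * (ennreal ((C * M)\<^sup>2) * rG z)"
        unfolding ma(2)[symmetric] by (rule nn_integral_multc) measurable
      finally show ?thesis .
    qed
    \<comment> \<open>the bound holds for every ray, so it may be averaged over the second annular sector\<close>
    have "ennreal mb * IF = (\<integral>\<^sup>+z. indicator (annular_sector \<beta>) z * invariant_density z * IF \<partial>lborel)"
      unfolding mb(2)[symmetric] by (rule nn_integral_multc[symmetric]) measurable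
    also have "\<dots> \<le> (\<integral>\<^sup>+z. ennreal (ma * (C * M)\<^sup>2) * (indicator (annular_sector \<beta>) z * invariant_density z * rG z) \<partial>lborel)"
    proof (rule nn_integral_mono)
      fix z
      show "indicator (annular_sector \<beta>) z * invariant_density z * IF \<le>
        ennreal (ma * (C * M)\<^sup>2) * (indicator (annular_sector \<beta>) z * invariant_density z * rG z)"
      proof (cases "z \<in> annular_sector \<beta>")
        case True
        then have "IF \<le> ennreal (ma * (C * M)\<^sup>2) * rG z"
          using 1[of z] ma(1) by (simp add: annular_sector_def ennreal_mult mult.assoc)
        then have "invariant_density z * IF \<le> invariant_density z * (ennreal (ma * (C * M)\<^sup>2) * rG z)"
          by (rule mult_left_mono) simp
        with True show ?thesis by (simp add: mult_ac)
      qed simp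
    qed
    also have "\<dots> = ennreal (ma * (C * M)\<^sup>2) * IG"
    proof -
      have meas: "(\<lambda>z. indicator (annular_sector \<beta>) z * invariant_density z * rG z) \<in> borel_measurable lborel"
      proof -
        have m1: "(\<lambda>(z, u). indicator (sector \<beta>) (complex_of_real (exp u) * z) * \<Gamma> (complex_of_real (exp u) * z))
            \<in> borel_measurable (borel \<Otimes>\<^sub>M lborel)"
          unfolding split_beta' by (rule measurable_compose[OF _ \<Gamma>m]) measurable
        have "(\<lambda>z. \<integral>\<^sup>+u. indicator (sector \<beta>) (complex_of_real (exp u) * z) * \<Gamma> (complex_of_real (exp u) * z) \<partial>lborel)
            \<in> borel_measurable borel"
          using m1 by measurable
        then have "(\<lambda>z. indicator (annular_sector \<beta>) z * invariant_density z *
            (\<integral>\<^sup>+u. indicator (sector \<beta>) (complex_of_real (exp u) * z) * \<Gamma> (complex_of_real (exp u) * z) \<partial>lborel)) \<in> borel_measurable lborel"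
          by measurable
        moreover have "indicator (annular_sector \<beta>) z * invariant_density z *
            (\<integral>\<^sup>+u. indicator (sector \<beta>) (complex_of_real (exp u) * z) * \<Gamma> (complex_of_real (exp u) * z) \<partial>lborel) =
            indicator (annular_sector \<beta>) z * invariant_density z * rG z" for z
          by (cases "z \<in> annular_sector \<beta>") (auto simp: rG_def annular_sector_def scale_in_sector)
        ultimately show ?thesis by simp
      qed
      show ?thesis unfolding IG by (rule nn_integral_cmult[OF meas])
    qed
    finally have "ennreal mb * IF \<le> ennreal (ma * (C * M)\<^sup>2) * IG" .
    then have "ennreal (1 / mb) * (ennreal mb * IF) \<le> ennreal (1 / mb) * (ennreal (ma * (C * M)\<^sup>2) * IG)"
      by (rule mult_left_mono) simp
    moreover have "ennreal (1 / mb) * ennreal mb = 1"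
      using mb(1) by (simp add: ennreal_mult[symmetric])
    moreover have "ennreal (1 / mb) * ennreal (ma * (C * M)\<^sup>2) = ennreal ((K * M)\<^sup>2)"
    proof -
      have "ennreal (1 / mb) * ennreal (ma * (C * M)\<^sup>2) = ennreal (1 / mb * (ma * (C * M)\<^sup>2))"
        using ma(1) mb(1) by (intro ennreal_mult[symmetric]) auto
      also have "1 / mb * (ma * (C * M)\<^sup>2) = (K * M)\<^sup>2"
        by (simp add: power_mult_distrib K2)
      finally show ?thesis .
    qed
    ultimately have le: "IF \<le> ennreal ((K * M)\<^sup>2) * IG"
      by (simp only: mult.assoc[symmetric] mult_1_left)
    have LF: "sector_L2_norm \<alpha> (\<lambda>z. calc ((\<omega> + (\<theta> - \<alpha>)) / 2) (\<lambda>l. f l * F (z * l)) x) = ennsqrt IF"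
      unfolding sector_L2_norm_eq IF_def \<Phi>_def \<gamma>_def ..
    have LG: "area_norm A \<omega> \<theta> G \<beta> x = ennsqrt IG"
      unfolding area_norm_def sector_L2_norm_eq dilated_calc_def Hinf0_calc_def IG_def \<Gamma>_def \<gamma>'_def ..
    show "sector_L2_norm \<alpha> (\<lambda>z. calc ((\<omega> + (\<theta> - \<alpha>)) / 2) (\<lambda>l. f l * F (z * l)) x) \<le> ennreal (K * M) * area_norm A \<omega> \<theta> G \<beta> x"
    proof (cases "M = 0")
      case True
      then have "IF = 0" using le by simp
      then show ?thesis unfolding LF by (simp add: ennsqrt_def)
    next
      case False
      then show ?thesis unfolding LF LG using K0 M0 by (intro ennsqrt_le[OF le]) auto
    qed
  qed
qed

end

lemma Hinf_norm_ge:
  assumes "f \<in> Hinf \<theta>" "z \<in> sector \<theta>"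
  shows "cmod (f z) \<le> Hinf_norm \<theta> f"
proof -
  have "bounded (f ` sector \<theta>)" using assms(1) by (simp add: Hinf_def)
  then have "bdd_above ((\<lambda>z. cmod (f z)) ` sector \<theta>)"
    by (auto simp: bounded_iff bdd_above_def)
  then show ?thesis unfolding Hinf_norm_def using assms(2) by (rule cSUP_upper[rotated])
qed

theorem theorem2p2:
  fixes A :: "'a::complex_hilbert_space \<rightharpoonup> 'a"
    and \<omega> \<theta> \<alpha> \<beta> :: real
    and F G :: "complex \<Rightarrow> complex"
  assumes "0 < \<omega>" and "\<omega> < pi"
    and "sectorial \<omega> A"
    and "inj_on A (dom A)"
    and "\<omega> < \<theta>" and "\<theta> < pi"
    and "0 < \<alpha>" and "\<alpha> < (\<theta> - \<omega>) / 2"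
    and "0 < \<beta>" and "\<beta> < (\<theta> - \<omega>) / 2"
    and "F \<in> Hinf0 \<theta>" and "\<exists>z\<in>sector \<theta>. F z \<noteq> 0"
    and "G \<in> Hinf0 \<theta>" and "\<exists>z\<in>sector \<theta>. G z \<noteq> 0"
  shows "(\<exists>K>0. \<forall>f\<in>Hinf \<theta>. \<forall>x.
            sector_L2_norm \<alpha> (\<lambda>z. the (Hinf_calc A \<omega> \<theta> f (dilated_calc A \<omega> \<theta> F \<alpha> z x)))
              \<le> ennreal (K * Hinf_norm \<theta> f) * area_norm A \<omega> \<theta> G \<beta> x)
       \<and> (\<exists>C>0. \<forall>x.
            ennreal (inverse C) * area_norm A \<omega> \<theta> G \<beta> x \<le> area_norm A \<omega> \<theta> F \<alpha> x
          \<and> area_norm A \<omega> \<theta> F \<alpha> x \<le> ennreal C * area_norm A \<omega> \<theta> G \<beta> x)"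
proof -
  interpret sectorial_operator A \<omega>
    using assms by unfold_locales
  obtain K where K: "0 < K" "\<And>f M x. f holomorphic_on sector \<theta> \<Longrightarrow> (\<And>l. l \<in> sector \<theta> \<Longrightarrow> cmod (f l) \<le> M) \<Longrightarrow>
    sector_L2_norm \<alpha> (\<lambda>z. calc ((\<omega> + (\<theta> - \<alpha>)) / 2) (\<lambda>l. f l * F (z * l)) x) \<le> ennreal (K * M) * area_norm A \<omega> \<theta> G \<beta> x"
    using sector_L2_estimate[OF assms(11,13,14,5-10)] by blast
  obtain K' where K': "0 < K'" "\<And>f M x. f holomorphic_on sector \<theta> \<Longrightarrow> (\<And>l. l \<in> sector \<theta> \<Longrightarrow> cmod (f l) \<le> M) \<Longrightarrow>
    sector_L2_norm \<beta> (\<lambda>z. calc ((\<omega> + (\<theta> - \<beta>)) / 2) (\<lambda>l. f l * G (z * l)) x) \<le> ennreal (K' * M) * area_norm A \<omega> \<theta> F \<alpha> x"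
    using sector_L2_estimate[OF assms(13,11,12,5,6,9,10,7,8)] by blast
  obtain s c where Fd: "sector_decay \<theta> s c F" using Hinf0_decay[OF assms(11)] by blast
  have i: "sector_L2_norm \<alpha> (\<lambda>z. the (Hinf_calc A \<omega> \<theta> f (dilated_calc A \<omega> \<theta> F \<alpha> z x)))
              \<le> ennreal (K * Hinf_norm \<theta> f) * area_norm A \<omega> \<theta> G \<beta> x" if f: "f \<in> Hinf \<theta>" for f x
  proof -
    have "the (Hinf_calc A \<omega> \<theta> f (dilated_calc A \<omega> \<theta> F \<alpha> z x)) = calc ((\<omega> + (\<theta> - \<alpha>)) / 2) (\<lambda>l. f l * F (z * l)) x"
      if z: "z \<in> sector \<alpha>" for z
    proof -
      have Fz: "sector_decay (\<theta> - \<alpha>) s (c * exp (s * \<bar>ln (cmod z)\<bar>)) (\<lambda>l. F (z * l))"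
        by (rule sector_decay_dilate[OF Fd z]) (use assms in auto)
      show ?thesis
        unfolding dilated_calc_def Hinf0_calc_def
        by (subst Hinf_calc_calc[OF assms(4) f assms(5,6) Fz]) (use assms in \<open>auto simp: field_simps\<close>)
    qed
    then have "sector_L2_norm \<alpha> (\<lambda>z. the (Hinf_calc A \<omega> \<theta> f (dilated_calc A \<omega> \<theta> F \<alpha> z x))) =
        sector_L2_norm \<alpha> (\<lambda>z. calc ((\<omega> + (\<theta> - \<alpha>)) / 2) (\<lambda>l. f l * F (z * l)) x)"
      by (rule sector_L2_norm_cong)
    also have "\<dots> \<le> ennreal (K * Hinf_norm \<theta> f) * area_norm A \<omega> \<theta> G \<beta> x"
      by (rule K(2)) (use f Hinf_norm_ge[OF f] in \<open>auto simp: Hinf_def\<close>)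
    finally show ?thesis .
  qed
  define C where "C = max K K'"
  have C: "0 < C" "K \<le> C" "K' \<le> C" using K(1) by (auto simp: C_def)
  have FG: "area_norm A \<omega> \<theta> F \<alpha> x \<le> ennreal C * area_norm A \<omega> \<theta> G \<beta> x" for x
  proof -
    have "area_norm A \<omega> \<theta> F \<alpha> x \<le> ennreal K * area_norm A \<omega> \<theta> G \<beta> x"
      using K(2)[of "\<lambda>_. 1" 1 x] by (simp add: area_norm_def dilated_calc_def Hinf0_calc_def)
    also have "\<dots> \<le> ennreal C * area_norm A \<omega> \<theta> G \<beta> x" using C by (intro mult_right_mono ennreal_leI) auto
    finally show ?thesis .
  qed
  have GF: "ennreal (inverse C) * area_norm A \<omega> \<theta> G \<beta> x \<le> area_norm A \<omega> \<theta> F \<alpha> x" for x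
  proof -
    have "area_norm A \<omega> \<theta> G \<beta> x \<le> ennreal K' * area_norm A \<omega> \<theta> F \<alpha> x"
      using K'(2)[of "\<lambda>_. 1" 1 x] by (simp add: area_norm_def dilated_calc_def Hinf0_calc_def)
    also have "\<dots> \<le> ennreal C * area_norm A \<omega> \<theta> F \<alpha> x" using C by (intro mult_right_mono ennreal_leI) auto
    finally have "ennreal (inverse C) * area_norm A \<omega> \<theta> G \<beta> x \<le> ennreal (inverse C) * (ennreal C * area_norm A \<omega> \<theta> F \<alpha> x)"
      by (rule mult_left_mono) simp
    also have "\<dots> = area_norm A \<omega> \<theta> F \<alpha> x"
      using C(1) by (simp add: mult.assoc[symmetric] ennreal_mult[symmetric])
    finally show ?thesis .
  qed
  show ?thesis using i K(1) FG GF C(1) by blast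
qed

end
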